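(* For any fixed $\phi>0$, the algorithm WFAST (with window size $W$, maximal weight $M$, accuracy $\epsilon>0$ and parameter $\phi$) processes new elements (Add) and answers window-volume queries (WinQuery) in constant time, while finding the window's weighted heavy hitters in $O\left(\frac1\epsilon\right)$ time.
   Context: Streams and problem. Given a set $\mathcal U$ (the universe of ids) and a positive integer $M$, a $(\mathcal U,M)$-weighted stream of length $N$ is a sequence $\langle p_1,\dots,p_N\rangle$ with $p_i=(d_i,w_i)\in\mathcal U\times\{1,\dots,M\}$ (id and weight). For a positive integer window size $W$, the window volume of $x$ is $v^W_x=\sum_{i\in\{N-W+1,\dots,N\},\,d_i=x}w_i$. The $(W,\theta,\epsilon,M)$-Weighted Heavy Hitters problem (threshold parameter $\theta$) is to return a set $H\subseteq\mathcal U$ such that for all $x\in\mathcal U$: $v^W_x>WM\theta\implies x\in H$, and $v^W_x<WM(\theta-\epsilon)\implies x\notin H$. Finding the window's weighted heavy hitters means solving this problem; WFAST does so by returning the items $x$ for which the WinQuery$(x)$ value is at least $MW\theta$. Algorithm FAST$(M,\delta,\phi)$. Let $s=\lfloor M\phi/2+1\rfloor$ and $\mathfrak C=\lceil (1+\phi)/\delta\rceil$. State: a set $C\subseteq\mathcal U$ (the items with allocated counters) and non-negative integers $c_x,r_x$ (counter and remainder) for $x\in\mathcal U$; initially $C=\emptyset$, $c_x=r_x=0$. Add$(x,w)$: if $x\in C$ or $|C|<\mathfrak C$, set $c_x\gets c_x+\lfloor (r_x+w)/s\rfloor$, $r_x\gets (r_x+w)\bmod s$ (both using the old $r_x$), $C\gets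 C\cup\{x\}$; otherwise choose an arbitrary $m\in\arg\min_{y\in C}c_y$, set $c_x\gets c_m+\lfloor (s-1+w)/s\rfloor$, $r_x\gets (s-1+w)\bmod s$, $C\gets (C\setminus\{m\})\cup\{x\}$. Query$(x)$: if $x\in C$ or $|C|<\mathfrak C$, return $r_x+s c_x$; otherwise return $s-1+s\min_{y\in C}c_y$. Flushing the instance means resetting all counters and remainders to $0$. The items of $C$ are stored in groups by the value $c_x$; the groups form a list ordered by $c$-value, items inside a group are unordered, each item's node stores $r_x$, and a hash table maps each id in $C$ to its node. Algorithm WFAST. Let $k=\lceil 4/\epsilon\rceil$; it is assumed that $W/k$ is an integer. State: a FAST instance $y=$ FAST$(M,1/k,\phi)$; an offset $o$, initially $0$; a queue $b$ of $k+1$ queues of ids, initially all empty, whose head is the queue of the current (newest) block and whose tail is the queue of the oldest block; and a hash table $B$ of integer counts indexed by ids, initially empty. Add$(x,w)$: 1. $o\gets (o+1)\bmod W$. 2. If $o=0$ (new frame), flush $y$. 3. If $o\bmod (W/k)=0$ (new block), remove the oldest (tail) queue from $b$ and append a new empty queue as the head. 4. If the tail queue of $b$ is not empty, pop an id $z$ from it, decrease $B[z]$ by $1$, and remove $z$ from $B$ if $B[z]=0$. 5. Let $\pi=\left\lfloor \frac{y.\mathrm{Query}(x)}{MW/k}\right\rfloor$, then call $y.\mathrm{Add}(x,w)$. 6. If now $\left\lfloor \frac{y.\mathrm{Query}(x)}{MW/k}\right\rfloor>\pi$ ($x$ overflows), push $x$ onto the head queue of $b$, and increase $B[x]$ by $1$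 (setting $B[x]=1$ if $x$ was not in $B$). WinQuery$(x)$: if $x$ is in $B$, return $\frac{MW}{k}(B[x]+2)+\left(y.\mathrm{Query}(x)\bmod \frac{MW}{k}\right)$; otherwise return $2\frac{MW}{k}+y.\mathrm{Query}(x)$. Running times are counted with hash table accesses taking constant time. Since $\phi$ is fixed, "constant" and the constant in $O(\cdot)$ may depend on $\phi$.
   Formalization: Flushing FAST also empties C (if C were kept, unseen ids could be reported wrongly, e.g. φ=6, M=2, ε=1, W=4); the O(1/ε) time for finding heavy hitters is claimed for θ≥ε only (for θ≤2/k every id qualifies), and for ε>1 that bound is a constant. *)

theory Defs
  imports Complex_Main "HOL-Library.State_Monad"
begin

section \<open>Streams and the heavy hitters problem\<close>

definition weighted_stream :: "'a set \<Rightarrow> nat \<Rightarrow> ('a \<times> nat) list \<Rightarrow> bool" where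
  "weighted_stream U M p \<longleftrightarrow> set p \<subseteq> U \<times> {1..M}"

text \<open>Positions are counted from \<open>0\<close>. For a stream shorter than the window, the truncated
  subtraction makes the window the whole stream.\<close>

definition window_volume :: "nat \<Rightarrow> ('a \<times> nat) list \<Rightarrow> 'a \<Rightarrow> nat" where
  "window_volume W p x =
     (\<Sum>i | i \<in> {length p - W..<length p} \<and> fst (p ! i) = x. snd (p ! i))"

definition solves_heavy_hitters ::
    "'a set \<Rightarrow> nat \<Rightarrow> real \<Rightarrow> real \<Rightarrow> nat \<Rightarrow> ('a \<times> nat) list \<Rightarrow> 'a set \<Rightarrow> bool" where
  "solves_heavy_hitters U W \<theta> \<epsilon> M p H \<longleftrightarrow>
     H \<subseteq> U \<and>
     (\<forall>x\<in>U. (real (window_volume W p x) > real W * real M * \<theta> \<longrightarrow> x \<in> H) \<and>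
            (real (window_volume W p x) < real W * real M * (\<theta> - \<epsilon>) \<longrightarrow> x \<notin> H))"


section \<open>FAST and WFAST as abstract algorithms\<close>

record 'a fast =
  alloc :: "'a set"
  cnt :: "'a \<Rightarrow> nat"
  rmd :: "'a \<Rightarrow> nat"

text \<open>Flushing an instance also deallocates its counters, i.e. it restores this initial state.
  If the allocated set survived a flush, a query for an unallocated item could return
  \<open>s - 1\<close> at the start of a frame; for large \<open>\<phi>\<close> and small \<open>W/k\<close> that error exceeds the
  allowed one.\<close>

definition fast_init :: "'a fast" where
  "fast_init = \<lparr>alloc = {}, cnt = (\<lambda>_. 0), rmd = (\<lambda>_. 0)\<rparr>"

definition fast_step :: "nat \<Rightarrow> real \<Rightarrow> nat" where
  "fast_step M \<phi> = nat \<lfloor>real M * \<phi> / 2 + 1\<rfloor>"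

definition fast_capacity :: "real \<Rightarrow> real \<Rightarrow> nat" where
  "fast_capacity \<delta> \<phi> = nat \<lceil>(1 + \<phi>) / \<delta>\<rceil>"

context
  fixes M :: nat and \<delta> \<phi> :: real
begin

definition fast_query :: "'a fast \<Rightarrow> 'a \<Rightarrow> nat" where
  "fast_query y x =
     (let s = fast_step M \<phi> in
      if x \<in> alloc y \<or> card (alloc y) < fast_capacity \<delta> \<phi>
      then rmd y x + s * cnt y x
      else s - 1 + s * Min (cnt y ` alloc y))"

text \<open>A relation, because any item with minimal counter may be evicted.\<close>

inductive fast_add :: "'a \<Rightarrow> nat \<Rightarrow> 'a fast \<Rightarrow> 'a fast \<Rightarrow> bool" where
  increment:
    "x \<in> alloc y \<or> card (alloc y) < fast_capacity \<delta> \<phi> \<Longrightarrow> s = fast_step M \<phi> \<Longrightarrow>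
     fast_add x w y
       \<lparr>alloc = insert x (alloc y),
        cnt = (cnt y)(x := cnt y x + (rmd y x + w) div s),
        rmd = (rmd y)(x := (rmd y x + w) mod s)\<rparr>"
| evict:
    "x \<notin> alloc y \<Longrightarrow> \<not> card (alloc y) < fast_capacity \<delta> \<phi> \<Longrightarrow> s = fast_step M \<phi> \<Longrightarrow>
     m \<in> alloc y \<Longrightarrow> \<forall>z\<in>alloc y. cnt y m \<le> cnt y z \<Longrightarrow>
     fast_add x w y
       \<lparr>alloc = insert x (alloc y - {m}),
        cnt = (cnt y)(x := cnt y m + (s - 1 + w) div s),
        rmd = (rmd y)(x := (s - 1 + w) mod s)\<rparr>"

end

definition block_count :: "real \<Rightarrow> nat" where
  "block_count \<epsilon> = nat \<lceil>4 / \<epsilon>\<rceil>"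

text \<open>The list of block queues has the newest block first and the oldest block last;
  ids are popped at the front of a queue and pushed at its back.\<close>

record 'a wfast =
  inst :: "'a fast"
  offset :: nat
  queues :: "'a list list"
  overflows :: "'a \<rightharpoonup> nat"

definition decrement :: "'a \<Rightarrow> ('a \<rightharpoonup> nat) \<Rightarrow> ('a \<rightharpoonup> nat)" where
  "decrement z B = (case B z of None \<Rightarrow> B | Some n \<Rightarrow> if n \<le> 1 then B(z := None) else B(z \<mapsto> n - 1))"

definition increment :: "'a \<Rightarrow> ('a \<rightharpoonup> nat) \<Rightarrow> ('a \<rightharpoonup> nat)" where
  "increment x B = (case B x of None \<Rightarrow> B(x \<mapsto> 1) | Some n \<Rightarrow> B(x \<mapsto> n + 1))"

definition pop_oldest :: "'a list list \<times> ('a \<rightharpoonup> nat) \<Rightarrow> 'a list list \<times> ('a \<rightharpoonup> nat)" where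
  "pop_oldest = (\<lambda>(b, B).
     case last b of [] \<Rightarrow> (b, B) | z # q \<Rightarrow> (butlast b @ [q], decrement z B))"

definition push_newest :: "'a \<Rightarrow> 'a list list \<times> ('a \<rightharpoonup> nat) \<Rightarrow> 'a list list \<times> ('a \<rightharpoonup> nat)" where
  "push_newest x = (\<lambda>(b, B). ((hd b @ [x]) # tl b, increment x B))"

context
  fixes W M :: nat and \<epsilon> \<phi> :: real
begin

definition wfast_init :: "'a wfast" where
  "wfast_init =
     \<lparr>inst = fast_init, offset = 0, queues = replicate (block_count \<epsilon> + 1) [],
      overflows = Map.empty\<rparr>"

text \<open>The quantity \<open>MW/k\<close>; the division is exact whenever \<open>k\<close> divides \<open>W\<close>.\<close>

definition overflow_unit :: nat where
  "overflow_unit = M * W div block_count \<epsilon>"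

definition wfast_fast_query :: "'a fast \<Rightarrow> 'a \<Rightarrow> nat" where
  "wfast_fast_query = fast_query M (1 / real (block_count \<epsilon>)) \<phi>"

definition wfast_fast_add :: "'a \<Rightarrow> nat \<Rightarrow> 'a fast \<Rightarrow> 'a fast \<Rightarrow> bool" where
  "wfast_fast_add = fast_add M (1 / real (block_count \<epsilon>)) \<phi>"

definition wfast_add :: "'a \<Rightarrow> nat \<Rightarrow> 'a wfast \<Rightarrow> 'a wfast \<Rightarrow> bool" where
  "wfast_add x w A A' \<longleftrightarrow>
     (let o1 = (offset A + 1) mod W;
          y1 = (if o1 = 0 then fast_init else inst A);
          b1 = (if o1 mod (W div block_count \<epsilon>) = 0
                then [] # butlast (queues A) else queues A);
          (b2, B2) = pop_oldest (b1, overflows A)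
      in \<exists>y2. wfast_fast_add x w y1 y2 \<and>
           (let (b3, B3) =
              (if wfast_fast_query y2 x div overflow_unit > wfast_fast_query y1 x div overflow_unit
               then push_newest x (b2, B2) else (b2, B2))
            in A' = \<lparr>inst = y2, offset = o1, queues = b3, overflows = B3\<rparr>))"

inductive wfast_run :: "('a \<times> nat) list \<Rightarrow> 'a wfast \<Rightarrow> bool" where
  "wfast_run [] wfast_init"
| "wfast_run p A \<Longrightarrow> wfast_add x w A A' \<Longrightarrow> wfast_run (p @ [(x, w)]) A'"

definition win_query :: "'a wfast \<Rightarrow> 'a \<Rightarrow> nat" where
  "win_query A x =
     (case overflows A x of
        Some n \<Rightarrow> overflow_unit * (n + 2) + wfast_fast_query (inst A) x mod overflow_unit
      | None \<Rightarrow> 2 * overflow_unit + wfast_fast_query (inst A) x)"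

definition reported :: "'a set \<Rightarrow> real \<Rightarrow> 'a wfast \<Rightarrow> 'a set" where
  "reported U \<theta> A = {x \<in> U. real (win_query A x) \<ge> real M * real W * \<theta>}"

end


section \<open>Memory and running time\<close>

text \<open>
  A program runs in the state monad over a memory and a step counter. Its only access to the
  memory is through the operations below, each of which reads or writes a single scalar, array
  cell, record or hash table entry and counts as one step; \<open>calc\<close> charges one step
  for the evaluation of a constant-size expression over values that have already been loaded.

  A hash table is a partial function from keys to entries. The node of an item is reached through
  its id, so a pointer to a node is an id. Groups live at addresses. Each group is a
  doubly linked list of items, and the groups form a doubly linked list with strictly increasing
  values. Address \<open>0\<close> holds the group of value \<open>0\<close>, which is first in this list and, unlike the
  other groups, is kept when it has no items. Nodes carry the epoch in which they were created,
  and a node of an earlier epoch counts as absent.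

  The block queues occupy the slots \<open>0..k\<close> of a ring. The queue in slot \<open>j\<close> consists of the cells
  \<open>(j, i)\<close> with \<open>front j \<le> i < back j\<close>.
\<close>

record 'a node =
  nrem :: nat
  ngrp :: nat
  nprev :: "'a option"
  nnext :: "'a option"
  nepoch :: nat

record 'a group =
  gval :: nat
  gprev :: nat
  gnext :: "nat option"
  gfirst :: "'a option"

record 'a mem =
  m_nodes :: "'a \<rightharpoonup> 'a node"
  m_groups :: "nat \<Rightarrow> 'a group"
  m_fresh :: nat
  m_size :: nat
  m_epoch :: nat
  m_offset :: nat
  m_head :: nat
  m_front :: "nat \<Rightarrow> nat"
  m_back :: "nat \<Rightarrow> nat"
  m_cell :: "nat \<times> nat \<Rightarrow> 'a"
  m_ovf :: "'a \<rightharpoonup> nat"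

type_synonym ('a, 'v) prog = "('a mem \<times> nat, 'v) state"

definition read_with :: "('a mem \<Rightarrow> 'v) \<Rightarrow> ('a, 'v) prog" where
  "read_with f = State (\<lambda>(m, t). (f m, (m, Suc t)))"

definition write_with :: "('a mem \<Rightarrow> 'a mem) \<Rightarrow> ('a, unit) prog" where
  "write_with f = State (\<lambda>(m, t). ((), (f m, Suc t)))"

definition calc :: "'v \<Rightarrow> ('a, 'v) prog" where
  "calc v = read_with (\<lambda>_. v)"

definition skip :: "('a, unit) prog" where
  "skip = State_Monad.return ()"

definition "get_node x = read_with (\<lambda>m. m_nodes m x)"
definition "set_node x n = write_with (\<lambda>m. m\<lparr>m_nodes := (m_nodes m)(x \<mapsto> n)\<rparr>)"
definition "del_node x = write_with (\<lambda>m. m\<lparr>m_nodes := (m_nodes m)(x := None)\<rparr>)"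
definition "get_group a = read_with (\<lambda>m. m_groups m a)"
definition "set_group a g = write_with (\<lambda>m. m\<lparr>m_groups := (m_groups m)(a := g)\<rparr>)"
definition "get_fresh = read_with m_fresh"
definition "set_fresh a = write_with (\<lambda>m. m\<lparr>m_fresh := a\<rparr>)"
definition "get_size = read_with m_size"
definition "set_size n = write_with (\<lambda>m. m\<lparr>m_size := n\<rparr>)"
definition "get_epoch = read_with m_epoch"
definition "set_epoch n = write_with (\<lambda>m. m\<lparr>m_epoch := n\<rparr>)"
definition "get_offset = read_with m_offset"
definition "set_offset n = write_with (\<lambda>m. m\<lparr>m_offset := n\<rparr>)"
definition "get_head = read_with m_head"
definition "set_head j = write_with (\<lambda>m. m\<lparr>m_head := j\<rparr>)"
definition "get_front j = read_with (\<lambda>m. m_front m j)"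
definition "set_front j i = write_with (\<lambda>m. m\<lparr>m_front := (m_front m)(j := i)\<rparr>)"
definition "get_back j = read_with (\<lambda>m. m_back m j)"
definition "set_back j i = write_with (\<lambda>m. m\<lparr>m_back := (m_back m)(j := i)\<rparr>)"
definition "get_cell j i = read_with (\<lambda>m. m_cell m (j, i))"
definition "set_cell j i x = write_with (\<lambda>m. m\<lparr>m_cell := (m_cell m)((j, i) := x)\<rparr>)"
definition "get_ovf x = read_with (\<lambda>m. m_ovf m x)"
definition "set_ovf x n = write_with (\<lambda>m. m\<lparr>m_ovf := (m_ovf m)(x \<mapsto> n)\<rparr>)"
definition "del_ovf x = write_with (\<lambda>m. m\<lparr>m_ovf := (m_ovf m)(x := None)\<rparr>)"

definition result_of :: "('a, 'v) prog \<Rightarrow> 'a mem \<Rightarrow> 'v" where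
  "result_of P m = fst (run_state P (m, 0))"

definition memory_after :: "('a, 'v) prog \<Rightarrow> 'a mem \<Rightarrow> 'a mem" where
  "memory_after P m = fst (snd (run_state P (m, 0)))"

definition running_time :: "('a, 'v) prog \<Rightarrow> 'a mem \<Rightarrow> nat" where
  "running_time P m = snd (snd (run_state P (m, 0)))"


section \<open>Implementation of FAST\<close>

definition zero_group :: "'a group" where
  "zero_group = \<lparr>gval = 0, gprev = 0, gnext = None, gfirst = None\<rparr>"

definition flush_prog :: "('a, unit) prog" where
  "flush_prog = do {
     e \<leftarrow> get_epoch;
     set_epoch (e + 1);
     set_group 0 zero_group;
     set_size 0
   }"

definition lookup_prog :: "'a \<Rightarrow> ('a, 'a node option) prog" where
  "lookup_prog x = do {
     e \<leftarrow> get_epoch;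
     t \<leftarrow> get_node x;
     calc (case t of None \<Rightarrow> None | Some n \<Rightarrow> if nepoch n = e then Some n else None)
   }"

text \<open>The first nonempty group.\<close>

definition min_group_prog :: "('a, nat) prog" where
  "min_group_prog = do {
     g \<leftarrow> get_group 0;
     calc (case gfirst g of Some _ \<Rightarrow> 0 | None \<Rightarrow> (case gnext g of Some a \<Rightarrow> a | None \<Rightarrow> 0))
   }"

text \<open>The last group, from address \<open>a\<close> onwards, whose value is at most \<open>c\<close>. Distinct groups have
  distinct values, so a search from a group of value \<open>c'\<close> needs at most \<open>c - c'\<close> hops; this is
  the loop bound given as first argument.\<close>

primrec walk_prog :: "nat \<Rightarrow> nat \<Rightarrow> nat \<Rightarrow> ('a, nat) prog" where
  "walk_prog 0 c a = State_Monad.return a"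
| "walk_prog (Suc n) c a = do {
     g \<leftarrow> get_group a;
     (case gnext g of
        None \<Rightarrow> State_Monad.return a
      | Some a' \<Rightarrow> do {
          g' \<leftarrow> get_group a';
          if gval g' \<le> c then walk_prog n c a' else State_Monad.return a
        })
   }"

text \<open>The group of value \<open>c\<close>, where \<open>a\<close> is the last group of value at most \<open>c\<close>; it is created
  after \<open>a\<close> if necessary.\<close>

definition place_prog :: "nat \<Rightarrow> nat \<Rightarrow> ('a, nat) prog" where
  "place_prog c a = do {
     g \<leftarrow> get_group a;
     if gval g = c then State_Monad.return a
     else do {
       q \<leftarrow> get_fresh;
       set_fresh (q + 1);
       set_group q \<lparr>gval = c, gprev = a, gnext = gnext g, gfirst = None\<rparr>;
       set_group a (g\<lparr>gnext := Some q\<rparr>);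
       (case gnext g of
          None \<Rightarrow> skip
        | Some a' \<Rightarrow> do {
            g' \<leftarrow> get_group a';
            set_group a' (g'\<lparr>gprev := q\<rparr>)
          });
       State_Monad.return q
     }
   }"

definition unlink_prog :: "'a node \<Rightarrow> ('a, unit) prog" where
  "unlink_prog n = do {
     (case nprev n of
        None \<Rightarrow> do {
          g \<leftarrow> get_group (ngrp n);
          set_group (ngrp n) (g\<lparr>gfirst := nnext n\<rparr>)
        }
      | Some y \<Rightarrow> do {
          t \<leftarrow> get_node y;
          set_node y ((the t)\<lparr>nnext := nnext n\<rparr>)
        });
     (case nnext n of
        None \<Rightarrow> skip
      | Some z \<Rightarrow> do {
          t \<leftarrow> get_node z;
          set_node z ((the t)\<lparr>nprev := nprev n\<rparr>)
        })
   }"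

definition link_prog :: "'a \<Rightarrow> nat \<Rightarrow> nat \<Rightarrow> ('a, unit) prog" where
  "link_prog x r a = do {
     e \<leftarrow> get_epoch;
     g \<leftarrow> get_group a;
     set_node x \<lparr>nrem = r, ngrp = a, nprev = None, nnext = gfirst g, nepoch = e\<rparr>;
     set_group a (g\<lparr>gfirst := Some x\<rparr>);
     (case gfirst g of
        None \<Rightarrow> skip
      | Some z \<Rightarrow> do {
          t \<leftarrow> get_node z;
          set_node z ((the t)\<lparr>nprev := Some x\<rparr>)
        })
   }"

definition drop_if_empty_prog :: "nat \<Rightarrow> ('a, unit) prog" where
  "drop_if_empty_prog a = do {
     g \<leftarrow> get_group a;
     if a = 0 \<or> gfirst g \<noteq> None then skip
     else do {
       g' \<leftarrow> get_group (gprev g);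
       set_group (gprev g) (g'\<lparr>gnext := gnext g\<rparr>);
       (case gnext g of
          None \<Rightarrow> skip
        | Some a'' \<Rightarrow> do {
            g'' \<leftarrow> get_group a'';
            set_group a'' (g''\<lparr>gprev := gprev g\<rparr>)
          })
     }
   }"

text \<open>Inserts \<open>x\<close> with remainder \<open>r\<close> into the group whose value exceeds that of group \<open>a\<close>
  by \<open>d\<close>.\<close>

definition insert_from_prog :: "nat \<Rightarrow> nat \<Rightarrow> 'a \<Rightarrow> nat \<Rightarrow> ('a, unit) prog" where
  "insert_from_prog a d x r = do {
     g \<leftarrow> get_group a;
     c \<leftarrow> calc (gval g + d);
     a' \<leftarrow> walk_prog d c a;
     q \<leftarrow> place_prog c a';
     link_prog x r q
   }"

context
  fixes M :: nat and \<delta> \<phi> :: real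
begin

text \<open>The parameters \<open>s\<close> and the capacity are computed once, at initialisation.\<close>

definition fast_query_prog :: "'a \<Rightarrow> ('a, nat) prog" where
  "fast_query_prog x = (let s = fast_step M \<phi> in do {
     t \<leftarrow> lookup_prog x;
     (case t of
        Some n \<Rightarrow> do {
          g \<leftarrow> get_group (ngrp n);
          calc (nrem n + s * gval g)
        }
      | None \<Rightarrow> do {
          l \<leftarrow> get_size;
          if l < fast_capacity \<delta> \<phi> then calc 0
          else do {
            a \<leftarrow> min_group_prog;
            g \<leftarrow> get_group a;
            calc (s - 1 + s * gval g)
          }
        })
   })"

definition fast_add_prog :: "'a \<Rightarrow> nat \<Rightarrow> ('a, unit) prog" where
  "fast_add_prog x w = (let s = fast_step M \<phi> in do {
     t \<leftarrow> lookup_prog x;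
     (case t of
        Some n \<Rightarrow> do {
          d \<leftarrow> calc ((nrem n + w) div s);
          r \<leftarrow> calc ((nrem n + w) mod s);
          if d = 0 then set_node x (n\<lparr>nrem := r\<rparr>)
          else do {
            unlink_prog n;
            insert_from_prog (ngrp n) d x r;
            drop_if_empty_prog (ngrp n)
          }
        }
      | None \<Rightarrow> do {
          l \<leftarrow> get_size;
          if l < fast_capacity \<delta> \<phi> then do {
            set_size (l + 1);
            d \<leftarrow> calc (w div s);
            r \<leftarrow> calc (w mod s);
            insert_from_prog 0 d x r
          }
          else do {
            a \<leftarrow> min_group_prog;
            g \<leftarrow> get_group a;
            t' \<leftarrow> get_node (the (gfirst g));
            unlink_prog (the t');
            del_node (the (gfirst g));
            d \<leftarrow> calc ((s - 1 + w) div s);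
            r \<leftarrow> calc ((s - 1 + w) mod s);
            insert_from_prog a d x r;
            drop_if_empty_prog a
          }
        })
   })"

end


section \<open>Implementation of WFAST\<close>

definition decrement_prog :: "'a \<Rightarrow> ('a, unit) prog" where
  "decrement_prog z = do {
     v \<leftarrow> get_ovf z;
     (case v of
        None \<Rightarrow> skip
      | Some n \<Rightarrow> if n \<le> 1 then del_ovf z else set_ovf z (n - 1))
   }"

definition increment_prog :: "'a \<Rightarrow> ('a, unit) prog" where
  "increment_prog x = do {
     v \<leftarrow> get_ovf x;
     (case v of None \<Rightarrow> set_ovf x 1 | Some n \<Rightarrow> set_ovf x (n + 1))
   }"

definition pop_prog :: "nat \<Rightarrow> ('a, unit) prog" where
  "pop_prog j = do {
     f \<leftarrow> get_front j;
     l \<leftarrow> get_back j;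
     if f < l then do {
       z \<leftarrow> get_cell j f;
       set_front j (f + 1);
       decrement_prog z
     }
     else skip
   }"

definition push_prog :: "nat \<Rightarrow> 'a \<Rightarrow> ('a, unit) prog" where
  "push_prog j x = do {
     l \<leftarrow> get_back j;
     set_cell j l x;
     set_back j (l + 1);
     increment_prog x
   }"

text \<open>The slot after the head of the ring is its tail, so removing the tail queue and appending
  an empty head queue empties that slot and makes it the head.\<close>

definition rotate_prog :: "nat \<Rightarrow> ('a, unit) prog" where
  "rotate_prog k = do {
     h \<leftarrow> get_head;
     h' \<leftarrow> calc ((h + 1) mod (k + 1));
     set_head h';
     set_front h' 0;
     set_back h' 0
   }"

context
  fixes W M :: nat and \<epsilon> \<phi> :: real
begin

definition wfast_mem_init :: "'a mem" where
  "wfast_mem_init =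
     \<lparr>m_nodes = Map.empty, m_groups = (\<lambda>_. zero_group), m_fresh = 1, m_size = 0, m_epoch = 0,
      m_offset = 0, m_head = 0, m_front = (\<lambda>_. 0), m_back = (\<lambda>_. 0),
      m_cell = (\<lambda>_. undefined), m_ovf = Map.empty\<rparr>"

definition wfast_fast_query_prog :: "'a \<Rightarrow> ('a, nat) prog" where
  "wfast_fast_query_prog = fast_query_prog M (1 / real (block_count \<epsilon>)) \<phi>"

definition wfast_fast_add_prog :: "'a \<Rightarrow> nat \<Rightarrow> ('a, unit) prog" where
  "wfast_fast_add_prog = fast_add_prog M (1 / real (block_count \<epsilon>)) \<phi>"

definition wfast_add_prog :: "'a \<Rightarrow> nat \<Rightarrow> ('a, unit) prog" where
  "wfast_add_prog x w = (let k = block_count \<epsilon>; u = overflow_unit W M \<epsilon> in do {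
     o0 \<leftarrow> get_offset;
     o1 \<leftarrow> calc ((o0 + 1) mod W);
     set_offset o1;
     (if o1 = 0 then flush_prog else skip);
     c \<leftarrow> calc (o1 mod (W div k) = 0);
     (if c then rotate_prog k else skip);
     h \<leftarrow> get_head;
     j \<leftarrow> calc ((h + 1) mod (k + 1));
     pop_prog j;
     q \<leftarrow> wfast_fast_query_prog x;
     wfast_fast_add_prog x w;
     q' \<leftarrow> wfast_fast_query_prog x;
     c' \<leftarrow> calc (q' div u > q div u);
     if c' then push_prog h x else skip
   })"

definition win_query_prog :: "'a \<Rightarrow> ('a, nat) prog" where
  "win_query_prog x = (let u = overflow_unit W M \<epsilon> in do {
     q \<leftarrow> wfast_fast_query_prog x;
     v \<leftarrow> get_ovf x;
     (case v of
        Some n \<Rightarrow> calc (u * (n + 2) + q mod u)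
      | None \<Rightarrow> calc (2 * u + q))
   })"

text \<open>The heavy hitters are searched among the ids in the block queues. The result is kept in a
  hash table, so that adding an id to it is one step. The loop over queue \<open>j\<close> visits \<open>n\<close> cells
  starting at \<open>i\<close>; the outer loop visits the slots below its first argument.\<close>

primrec scan_queue_prog :: "real \<Rightarrow> nat \<Rightarrow> nat \<Rightarrow> nat \<Rightarrow> 'a set \<Rightarrow> ('a, 'a set) prog" where
  "scan_queue_prog \<theta> j 0 i H = State_Monad.return H"
| "scan_queue_prog \<theta> j (Suc n) i H = do {
     x \<leftarrow> get_cell j i;
     v \<leftarrow> win_query_prog x;
     c \<leftarrow> calc (real v \<ge> real M * real W * \<theta>);
     H' \<leftarrow> calc (if c then insert x H else H);
     scan_queue_prog \<theta> j n (i + 1) H'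
   }"

primrec scan_slots_prog :: "real \<Rightarrow> nat \<Rightarrow> 'a set \<Rightarrow> ('a, 'a set) prog" where
  "scan_slots_prog \<theta> 0 H = State_Monad.return H"
| "scan_slots_prog \<theta> (Suc j) H = do {
     f \<leftarrow> get_front j;
     l \<leftarrow> get_back j;
     H' \<leftarrow> scan_queue_prog \<theta> j (l - f) f H;
     scan_slots_prog \<theta> j H'
   }"

definition heavy_hitters_prog :: "real \<Rightarrow> ('a, 'a set) prog" where
  "heavy_hitters_prog \<theta> = scan_slots_prog \<theta> (block_count \<epsilon> + 1) {}"

definition wfast_mem :: "('a \<times> nat) list \<Rightarrow> 'a mem" where
  "wfast_mem p = fold (\<lambda>(x, w). memory_after (wfast_add_prog x w)) p wfast_mem_init"

end

end

theory Submission
  imports Defs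
begin

text \<open>
  Adding \<open>x\<close> raises FAST's estimate of \<open>x\<close> by exactly its weight, and estimates never decrease
  within a frame. They increase otherwise only for items without a counter, and those have
  estimates below \<open>u = MW/k\<close>: an eviction wastes at most \<open>s - 1 \<le> M\<phi>/2\<close>, so the \<open>C \<ge> (1 + \<phi>)k\<close>
  counters sum to at most \<open>WM(1 + \<phi>/2)\<close>, and the smallest of them is too small to reach \<open>u\<close>. Hence
  the estimate exceeds the volume in the frame by at most \<open>u\<close>, and no multiple of \<open>u\<close> is passed
  unrecorded: the number of overflows of \<open>x\<close> in a frame is the estimate divided by \<open>u\<close>. The window
  meets two frames and the table \<open>B\<close> misses only overflows from a partial block, so the window query
  errs by at most \<open>4u \<le> MW\<epsilon>\<close>. The same sum bound limits the number of queued ids to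
  \<open>O(k)\<close>, and every heavy hitter is queued.

  For the running time, a search for the target group makes at most \<open>1 + 2/\<phi>\<close> hops because
  \<open>M/s < 2/\<phi>\<close>.
\<close>

section \<open>Invariants of FAST\<close>

text \<open>FAST may evict any item with a minimal counter, so WFAST is a relation. Accuracy is
  proved for every run of this relation; the memory program is then shown to follow one of the runs
  and inherits its answers and its queue lengths.

  The obstacle to accuracy is that only the current instance is kept. Of the previous frame nothing
  survives but recorded overflows, and these have to be compared with estimates that the instance
  had at earlier times.

  The obstacle to constant time is the flush, which cannot visit every node. It raises the epoch
  instead, so the memory invariant must tolerate garbage: nodes of earlier epochs and groups that
  are no longer linked.

  The search for heavy hitters inspects queued ids only. This is complete for
  \<open>\<epsilon> \<le> \<theta>\<close>, since an item without queued ids gets an answer below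
  \<open>4 * u\<close>. For smaller thresholds even an item that never occurred may belong to the
  reported set.\<close>

locale wfast_params =
  fixes W M :: nat and \<epsilon> \<phi> :: real
  assumes W_pos: "W > 0" and M_pos: "M > 0" and eps_pos: "\<epsilon> > 0" and phi_pos: "\<phi> > 0"
    and k_dvd_W: "block_count \<epsilon> dvd W"
begin

abbreviation "k \<equiv> block_count \<epsilon>"
abbreviation "s \<equiv> fast_step M \<phi>"
abbreviation "C \<equiv> fast_capacity (1 / real k) \<phi>"
abbreviation "L \<equiv> W div k"
abbreviation "u \<equiv> overflow_unit W M \<epsilon>"
abbreviation query :: "'a fast \<Rightarrow> 'a \<Rightarrow> nat" where
  "query \<equiv> wfast_fast_query M \<epsilon> \<phi>"
abbreviation add :: "'a \<Rightarrow> nat \<Rightarrow> 'a fast \<Rightarrow> 'a fast \<Rightarrow> bool" where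
  "add \<equiv> wfast_fast_add M \<epsilon> \<phi>"

section \<open>Arithmetic of the parameters\<close>

lemma k_ge: "real k \<ge> 4 / \<epsilon>"
  unfolding block_count_def using eps_pos by (simp add: of_nat_ceiling)

lemma k_pos: "k > 0"
proof -
  have "4 / \<epsilon> > 0" using eps_pos by simp
  then have "real k > 0" using k_ge by linarith
  then show ?thesis by simp
qed

lemma k_le: "real k \<le> 4 / \<epsilon> + 1"
proof -
  have "4 / \<epsilon> > 0" using eps_pos by simp
  then show ?thesis unfolding block_count_def by linarith
qed

lemma W_eq: "W = k * L"
  using k_dvd_W by simp

lemma L_pos: "L > 0"
  using W_eq W_pos by (metis gr0I mult_0_right)

lemma u_eq: "u = M * L"
  unfolding overflow_unit_def using k_dvd_W by (simp add: div_mult_swap)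

lemma u_pos: "u > 0"
  using u_eq L_pos M_pos by simp

lemma M_le_u: "M \<le> u"
  using u_eq L_pos by simp

lemma ku_eq: "k * u = M * W"
  using u_eq W_eq by (metis mult.left_commute)

text \<open>The \<open>4\<close> in the number of blocks is the error budget of a window query,
  counted in units \<open>u\<close>.\<close>

lemma four_u_le: "4 * real u \<le> real W * real M * \<epsilon>"
proof -
  have "4 \<le> real k * \<epsilon>" using k_ge eps_pos by (simp add: divide_le_eq)
  then have "4 * real u \<le> real k * \<epsilon> * real u" by (simp add: mult_right_mono)
  also have "\<dots> = real (k * u) * \<epsilon>" by simp
  also have "\<dots> = real W * real M * \<epsilon>" unfolding ku_eq by simp
  finally show ?thesis .
qed

lemma s_real: "real s \<le> real M * \<phi> / 2 + 1" "real M * \<phi> / 2 < real s"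
proof -
  have "real M * \<phi> / 2 > 0" using M_pos phi_pos by simp
  then show "real s \<le> real M * \<phi> / 2 + 1" "real M * \<phi> / 2 < real s"
    unfolding fast_step_def by linarith+
qed

lemma s_pos: "s > 0"
proof -
  have "real M * \<phi> / 2 > 0" using M_pos phi_pos by simp
  then show ?thesis using s_real by linarith
qed

lemma C_ge: "real C \<ge> (1 + \<phi>) * real k"
proof -
  have "(1 + \<phi>) / (1 / real k) = (1 + \<phi>) * real k" by simp
  then show ?thesis unfolding fast_capacity_def by (simp add: of_nat_ceiling)
qed

lemma C_pos: "C > 0"
proof -
  have "(1 + \<phi>) * real k > 0" using phi_pos k_pos by simp
  then have "real C > 0" using C_ge by linarith
  then show ?thesis by simp
qed

text \<open>\<open>n\<close> is the number of items added. Each adds at most \<open>M\<close> to the sum of the estimates, and at most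
  \<open>s - 1\<close> more if it evicts, which cannot happen among the first \<open>C\<close>.\<close>

definition fast_inv :: "nat \<Rightarrow> 'a fast \<Rightarrow> bool" where
  "fast_inv n y \<longleftrightarrow>
     finite (alloc y) \<and> card (alloc y) \<le> C \<and> card (alloc y) \<le> n \<and>
     (\<forall>z\<in>alloc y. rmd y z < s) \<and>
     (card (alloc y) < C \<longrightarrow> (\<forall>z. z \<notin> alloc y \<longrightarrow> cnt y z = 0 \<and> rmd y z = 0)) \<and>
     (\<Sum>z\<in>alloc y. rmd y z + s * cnt y z) \<le> M * n + (n - C) * (s - 1)"

lemma fast_inv_init: "fast_inv n fast_init"
  by (simp add: fast_inv_def fast_init_def)

section \<open>Estimates before and after one insertion\<close>

lemma query_alloc: "x \<in> alloc y \<Longrightarrow> query y x = rmd y x + s * cnt y x"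
  by (simp add: wfast_fast_query_def fast_query_def)

text \<open>While counters are free nothing has been evicted, so an item without a counter still has
  its initial zeros. Later this fails, because an eviction leaves the old values of
  \<open>cnt\<close> and \<open>rmd\<close> behind.\<close>

lemma query_free:
  "fast_inv n y \<Longrightarrow> x \<notin> alloc y \<Longrightarrow> card (alloc y) < C \<Longrightarrow> query y x = 0"
  by (simp add: wfast_fast_query_def fast_query_def fast_inv_def)

lemma query_full:
  "x \<notin> alloc y \<Longrightarrow> \<not> card (alloc y) < C \<Longrightarrow> query y x = s - 1 + s * Min (cnt y ` alloc y)"
  by (simp add: wfast_fast_query_def fast_query_def Let_def)

lemma query_init: "query fast_init x = 0"
  by (simp add: wfast_fast_query_def fast_query_def fast_init_def C_pos)

lemma add_cases [consumes 1, case_names increment evict]: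
  assumes "add x w y y'"
  obtains "x \<in> alloc y \<or> card (alloc y) < C"
    "alloc y' = insert x (alloc y)"
    "cnt y' = (cnt y)(x := cnt y x + (rmd y x + w) div s)"
    "rmd y' = (rmd y)(x := (rmd y x + w) mod s)"
  | m where "x \<notin> alloc y" "\<not> card (alloc y) < C" "m \<in> alloc y"
    "\<forall>z\<in>alloc y. cnt y m \<le> cnt y z"
    "alloc y' = insert x (alloc y - {m})"
    "cnt y' = (cnt y)(x := cnt y m + (s - 1 + w) div s)"
    "rmd y' = (rmd y)(x := (s - 1 + w) mod s)"
  using assms unfolding wfast_fast_add_def
  by (cases rule: fast_add.cases) auto

lemma Min_cnt_eq:
  assumes "finite A" "m \<in> A" "\<forall>z\<in>A. f m \<le> f z"
  shows "Min (f ` A) = (f m :: nat)"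
  using assms by (intro Min_eqI) auto

text \<open>An increment adds \<open>w\<close> to one summand. An eviction replaces the summand of
  the victim \<open>m\<close> by one that inherits \<open>s * cnt y m\<close>, so at most
  \<open>s - 1 + w\<close> is new.\<close>

lemma fast_inv_add:
  assumes inv: "fast_inv n y" and "add x w y y'" and w: "w \<le> M"
  shows "fast_inv (Suc n) y'"
  using assms(2)
proof (cases rule: add_cases)
  case increment
  have fin: "finite (alloc y)" using inv by (simp add: fast_inv_def)
  let ?q = "\<lambda>y z. rmd y z + s * cnt y z"
  have q_x: "?q y' x = ?q y x + w"
    using increment by (simp add: algebra_simps)
  have q_z: "?q y' z = ?q y z" if "z \<noteq> x" for z using that increment by simp
  have sum_le: "sum (?q y') (alloc y') \<le> sum (?q y) (alloc y) + w"
  proof (cases "x \<in> alloc y")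
    case True
    have "sum (?q y') (alloc y') = ?q y' x + sum (?q y') (alloc y - {x})"
      using fin increment True by (simp add: insert_absorb sum.remove[of _ x])
    also have "sum (?q y') (alloc y - {x}) = sum (?q y) (alloc y - {x})"
      by (rule sum.cong) (use q_z in auto)
    also have "?q y' x + sum (?q y) (alloc y - {x}) = sum (?q y) (alloc y) + w"
      using fin True q_x by (simp add: sum.remove[of _ x])
    finally show ?thesis by simp
  next
    case False
    then have "?q y x = 0" using increment(1) inv by (simp add: fast_inv_def)
    then have "?q y' x = w" using q_x by simp
    moreover have "sum (?q y') (alloc y) = sum (?q y) (alloc y)"
    proof (rule sum.cong)
      fix z assume "z \<in> alloc y"
      then show "?q y' z = ?q y z" using q_z[of z] False by blast
    qed simp
    ultimately show ?thesis using fin False increment(2) by simp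
  qed
  have "M * n + (n - C) * (s - 1) + w \<le> M * Suc n + (Suc n - C) * (s - 1)"
  proof -
    have "(n - C) * (s - 1) \<le> (Suc n - C) * (s - 1)" by (intro mult_right_mono) auto
    then show ?thesis using w unfolding mult_Suc_right by linarith
  qed
  then have "sum (?q y') (alloc y') \<le> M * Suc n + (Suc n - C) * (s - 1)"
    using sum_le inv unfolding fast_inv_def by linarith
  moreover have "card (alloc y') \<le> C" "card (alloc y') \<le> Suc n" "finite (alloc y')"
    using increment(1,2) inv by (auto simp: fast_inv_def card_insert_if)
  moreover have "\<forall>z\<in>alloc y'. rmd y' z < s"
    using increment inv s_pos by (auto simp: fast_inv_def)
  moreover have "card (alloc y) < C" if "card (alloc y') < C"
    using that increment(2) fin by (simp add: card_insert_if split: if_splits)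
  then have "card (alloc y') < C \<longrightarrow> (\<forall>z. z \<notin> alloc y' \<longrightarrow> cnt y' z = 0 \<and> rmd y' z = 0)"
    using increment inv by (auto simp: fast_inv_def)
  ultimately show ?thesis unfolding fast_inv_def by blast
next
  case (evict m)
  have fin: "finite (alloc y)" using inv by (simp add: fast_inv_def)
  let ?q = "\<lambda>y z. rmd y z + s * cnt y z"
  have q_x: "?q y' x = s * cnt y m + (s - 1 + w)"
    using evict by (simp add: algebra_simps)
  have xm: "x \<noteq> m" using evict by auto
  have "sum (?q y') (alloc y') = ?q y' x + sum (?q y') (alloc y - {m})"
    using fin evict by simp
  also have "sum (?q y') (alloc y - {m}) = sum (?q y) (alloc y - {m})"
    by (rule sum.cong) (use evict in auto)
  also have "?q y' x + sum (?q y) (alloc y - {m}) \<le> (s - 1 + w) + sum (?q y) (alloc y)"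
    using fin evict(3) q_x by (simp add: sum.remove[of _ m])
  finally have sum_le: "sum (?q y') (alloc y') \<le> (s - 1 + w) + sum (?q y) (alloc y)" .
  \<comment> \<open>Eviction requires a full table, hence \<open>C \<le> n\<close>: the truncated
    difference \<open>n - C\<close> really grows by one and pays for the
    \<open>s - 1\<close>.\<close>
  have n: "n \<ge> C" using evict(2) inv by (simp add: fast_inv_def)
  have "M * n + (n - C) * (s - 1) + (s - 1 + w) \<le> M * Suc n + (Suc n - C) * (s - 1)"
    using w n by (simp add: Suc_diff_le)
  then have "sum (?q y') (alloc y') \<le> M * Suc n + (Suc n - C) * (s - 1)"
    using sum_le inv unfolding fast_inv_def by linarith
  moreover have "card (alloc y') = card (alloc y)"
    using evict fin card_Suc_Diff1[of "alloc y" m] by simp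
  moreover have "\<forall>z\<in>alloc y'. rmd y' z < s"
    using evict inv s_pos by (auto simp: fast_inv_def)
  ultimately show ?thesis using inv evict(2,5) unfolding fast_inv_def by auto
qed

text \<open>The minimum is at most the average of \<open>C\<close> counters. \<open>C\<close>
  exceeds \<open>k\<close> by the factor \<open>1 + \<phi>\<close>, while waste inflates the total
  only by \<open>1 + \<phi> / 2\<close>; this gap makes the inequality strict.\<close>

lemma query_full_less:
  assumes inv: "fast_inv n y" and n: "n \<le> W" and full: "\<not> card (alloc y) < C"
  shows "s - 1 + s * Min (cnt y ` alloc y) < u"
proof -
  let ?m = "Min (cnt y ` alloc y)"
  have fin: "finite (alloc y)" and card: "card (alloc y) = C" and nC: "C \<le> n"
    and sum: "(\<Sum>z\<in>alloc y. rmd y z + s * cnt y z) \<le> M * n + (n - C) * (s - 1)"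
    using inv full by (auto simp: fast_inv_def)
  have "C * (s * ?m) = (\<Sum>z\<in>alloc y. s * ?m)" using card by simp
  also have "\<dots> \<le> (\<Sum>z\<in>alloc y. rmd y z + s * cnt y z)"
  proof (rule sum_mono)
    fix z assume "z \<in> alloc y"
    then have "?m \<le> cnt y z" using fin by simp
    then show "s * ?m \<le> rmd y z + s * cnt y z" by (simp add: trans_le_add2)
  qed
  also have "\<dots> \<le> M * n + (n - C) * (s - 1)" by (rule sum)
  finally have "C * (s * ?m) \<le> M * n + (n - C) * (s - 1)" .
  moreover have "C * (s - 1) + (n - C) * (s - 1) = n * (s - 1)"
    using nC by (simp flip: distrib_right)
  ultimately have "C * (s - 1 + s * ?m) \<le> M * n + n * (s - 1)"
    unfolding distrib_left by linarith
  also have "\<dots> \<le> W * (M + (s - 1))" using n by (metis distrib_left mult.commute mult_le_mono1)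
  finally have "C * (s - 1 + s * ?m) \<le> W * (M + (s - 1))" .
  then have "real (C * (s - 1 + s * ?m)) \<le> real (W * (M + (s - 1)))"
    unfolding of_nat_le_iff .
  then have 1: "real C * real (s - 1 + s * ?m) \<le> real W * (real M + real (s - 1))"
    by (simp only: of_nat_mult of_nat_add)
  have "real (s - 1) \<le> real M * \<phi> / 2" using s_real s_pos by (simp add: of_nat_diff)
  then have "real W * (real M + real (s - 1)) \<le> real W * (real M + real M * \<phi> / 2)"
    by (intro mult_left_mono) auto
  also have "\<dots> = real (M * W) * (1 + \<phi> / 2)" by (simp add: algebra_simps)
  also have "\<dots> < real (M * W) * (1 + \<phi>)"
    using M_pos W_pos phi_pos by (intro mult_strict_left_mono) auto
  also have "real (M * W) * (1 + \<phi>) = (1 + \<phi>) * real k * real u"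
    unfolding ku_eq[symmetric] by simp
  also have "\<dots> \<le> real C * real u" using C_ge by (intro mult_right_mono) auto
  finally have "real C * real (s - 1 + s * ?m) < real C * real u" using 1 by linarith
  then show ?thesis by (simp only: mult_less_cancel_left_pos[of "real C"] of_nat_0_less_iff of_nat_less_iff C_pos)
qed

lemma query_unalloc_less:
  assumes "fast_inv n y" "n \<le> W" "x \<notin> alloc y"
  shows "query y x < u"
  using assms query_full_less[of n y] query_free[of n y x] query_full[of x y] u_pos
  by (cases "card (alloc y) < C") auto

text \<open>On eviction the new counter starts from \<open>s - 1 + s * cnt y m\<close>, which is
  exactly what the query returned for \<open>x\<close> before; quotient and remainder by
  \<open>s\<close> lose nothing.\<close>

lemma query_add_self:
  assumes inv: "fast_inv n y" and "add x w y y'"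
  shows "query y' x = query y x + w"
  using assms(2)
proof (cases rule: add_cases)
  case increment
  then show ?thesis
    by (cases "x \<in> alloc y") (use inv in \<open>auto simp: query_alloc query_free algebra_simps fast_inv_def\<close>)
next
  case (evict m)
  then have "Min (cnt y ` alloc y) = cnt y m"
    using inv by (intro Min_cnt_eq) (auto simp: fast_inv_def)
  then show ?thesis using evict by (simp add: query_alloc query_full algebra_simps)
qed

text \<open>Another item that keeps its counter keeps its value. The victim of an eviction trades
  its remainder for \<open>s - 1\<close>, which is no smaller, and its count for the new minimum,
  which is no smaller because the victim was minimal.\<close>

lemma query_add_other:
  assumes inv: "fast_inv n y" and "add x w y y'" and w: "w \<le> M" and xz: "z \<noteq> x"
  shows "query y z \<le> query y' z" and "z \<in> alloc y' \<Longrightarrow> query y' z = query y z"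
proof -
  have inv': "fast_inv (Suc n) y'" by (rule fast_inv_add[OF assms(1,2,3)])
  have fin: "finite (alloc y)" "finite (alloc y')" and rmd: "\<forall>z\<in>alloc y. rmd y z < s"
    using inv inv' by (auto simp: fast_inv_def)
  show "query y' z = query y z" if "z \<in> alloc y'"
    using assms(2) by (cases rule: add_cases) (use that xz in \<open>auto simp: query_alloc\<close>)
  show "query y z \<le> query y' z"
    using assms(2)
  proof (cases rule: add_cases)
    case increment
    show ?thesis
    proof (cases "z \<in> alloc y")
      case True
      then show ?thesis using increment xz by (simp add: query_alloc)
    next
      case z: False
      show ?thesis
      proof (cases "card (alloc y) < C")
        case True
        then show ?thesis using z query_free[OF inv] by simp
      next
        case False
        then have x: "x \<in> alloc y" using increment by simp
        then have [simp]: "alloc y' = alloc y" using increment by auto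
        have "Min (cnt y ` alloc y) \<le> Min (cnt y' ` alloc y)"
        proof (rule Min.boundedI)
          fix v assume "v \<in> cnt y' ` alloc y"
          then obtain a where "a \<in> alloc y" "v = cnt y' a" by auto
          moreover have "cnt y a \<le> cnt y' a" using increment by simp
          moreover have "Min (cnt y ` alloc y) \<le> cnt y a" using fin \<open>a \<in> alloc y\<close> by simp
          ultimately show "Min (cnt y ` alloc y) \<le> v" by simp
        qed (use fin x in auto)
        then show ?thesis using False z by (simp add: query_full)
      qed
    qed
  next
    case (evict m)
    have Min: "Min (cnt y ` alloc y) = cnt y m"
      using evict inv by (intro Min_cnt_eq) (auto simp: fast_inv_def)
    have card: "\<not> card (alloc y') < C"
      using evict fin card_Suc_Diff1[of "alloc y" m] by simp
    have Min': "cnt y m \<le> Min (cnt y' ` alloc y')"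
    proof (rule Min.boundedI)
      fix v assume "v \<in> cnt y' ` alloc y'"
      then show "cnt y m \<le> v" using evict by auto
    qed (use fin evict in auto)
    have rm: "rmd y m \<le> s - 1" using rmd evict(3) by fastforce
    show ?thesis
    proof (cases "z \<in> alloc y'")
      case True
      then show ?thesis using evict xz by (simp add: query_alloc)
    next
      case False
      then have q': "query y' z = s - 1 + s * Min (cnt y' ` alloc y')"
        using card by (simp add: query_full)
      show ?thesis
      proof (cases "z = m")
        case True
        then show ?thesis using q' rm Min' evict(3) by (simp add: query_alloc add_mono)
      next
        case False
        then have "z \<notin> alloc y" using \<open>z \<notin> alloc y'\<close> evict by auto
        then show ?thesis using q' Min Min' evict(2) by (simp add: query_full)
      qed
    qed
  qed
qed

text \<open>Changes to items other than \<open>x\<close> start and end below \<open>u\<close>, where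
  neither the truncated excess over \<open>u\<close> nor the quotient by \<open>u\<close> sees
  them.\<close>

lemma query_add_excess:
  assumes "fast_inv n y" "n < W" "add x w y y'" "w \<le> M"
  shows "query y' z - u \<le> query y z - u + (if z = x then w else 0)"
    and "query y' z div u =
      query y z div u + (if z = x \<and> query y x div u < query y' x div u then 1 else 0)"
    and "query y z + (if z = x then w else 0) \<le> query y' z"
proof -
  have inv': "fast_inv (Suc n) y'" by (rule fast_inv_add[OF assms(1,3,4)])
  have other: "z = x \<or> query y' z = query y z \<or> query y' z < u"
    using query_add_other(2) query_unalloc_less[OF inv', of z] assms by fastforce
  show "query y z + (if z = x then w else 0) \<le> query y' z"
    using query_add_self[OF assms(1,3)] query_add_other(1)[OF assms(1,3,4)] by auto
  show "query y' z - u \<le> query y z - u + (if z = x then w else 0)"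
    using other query_add_self[OF assms(1,3)] by auto
  \<comment> \<open>\<open>w \<le> M \<le> u\<close>, so one insertion passes at most one multiple
    of \<open>u\<close>.\<close>
  have "(query y x + w) div u \<le> (query y x + u) div u"
    using assms(4) M_le_u by (intro div_le_mono) simp
  also have "\<dots> = query y x div u + 1" using u_pos by simp
  finally have 1: "query y' x div u \<le> query y x div u + 1"
    using query_add_self[OF assms(1,3)] by simp
  have 2: "query y x div u \<le> query y' x div u"
    using query_add_self[OF assms(1,3)] by (simp add: div_le_mono)
  have "query y' z div u = query y z div u" if "z \<noteq> x"
    using that other query_add_other(1)[OF assms(1,3,4) that] by auto
  then show "query y' z div u =
      query y z div u + (if z = x \<and> query y x div u < query y' x div u then 1 else 0)"
    using 1 2 by (cases "z = x") auto
qed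

section \<open>A potential for the number of overflows\<close>

definition overflow_total :: "'a fast \<Rightarrow> nat" where
  "overflow_total y = (\<Sum>z\<in>alloc y. query y z div u)"

text \<open>Every overflow raises the potential by at least one. Losing a counter costs nothing: the
  estimate of the loser does not fall and yet ends below \<open>u\<close>, so its summand was
  zero.\<close>

lemma overflow_total_add:
  assumes inv: "fast_inv n y" and n: "n < W" and add: "add x w y y'" and w: "w \<le> M"
  shows "overflow_total y + (if query y x div u < query y' x div u then 1 else 0)
    \<le> overflow_total y'"
proof -
  have inv': "fast_inv (Suc n) y'" by (rule fast_inv_add[OF assms(1,3,4)])
  have fin: "finite (alloc y)" "finite (alloc y')"
    using inv inv' by (auto simp: fast_inv_def)
  let ?d = "if query y x div u < query y' x div u then 1 else 0"
  have x: "x \<in> alloc y'" using add by (cases rule: add_cases) auto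
  have dropped: "query y z div u = 0" if "z \<in> alloc y - alloc y'" for z
  proof -
    have "query y z \<le> query y' z" using that x query_add_other(1)[OF inv add w, of z] by auto
    also have "\<dots> < u" using that query_unalloc_less[OF inv', of z] n by simp
    finally show ?thesis by simp
  qed
  have "overflow_total y = (\<Sum>z\<in>alloc y \<inter> alloc y'. query y z div u)"
    unfolding overflow_total_def using fin dropped by (intro sum.mono_neutral_right) auto
  also have "\<dots> \<le> (\<Sum>z\<in>alloc y'. query y z div u)"
    using fin by (intro sum_mono2) auto
  finally have "overflow_total y + ?d \<le> (\<Sum>z\<in>alloc y'. query y z div u) + ?d" by simp
  also have "\<dots> = (\<Sum>z\<in>alloc y'. query y z div u + (if z = x then ?d else 0))"
    using x fin by (simp add: sum.distrib)
  also have "\<dots> = overflow_total y'"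
    unfolding overflow_total_def
  proof (rule sum.cong)
    fix z
    show "query y z div u + (if z = x then ?d else 0) = query y' z div u"
      using query_add_excess(2)[OF inv n add w, of z] by (cases "z = x") simp_all
  qed simp
  finally show ?thesis .
qed

text \<open>Dividing the bound on the sum of estimates by \<open>u = MW / k\<close> leaves a bound
  of order \<open>k\<close>, independent of \<open>M\<close> and \<open>W\<close>.\<close>

lemma overflow_total_le:
  assumes inv: "fast_inv n y" and n: "n \<le> W"
  shows "real (overflow_total y) \<le> real k * (1 + \<phi> / 2)"
proof -
  have "u * overflow_total y \<le> (\<Sum>z\<in>alloc y. rmd y z + s * cnt y z)"
    unfolding overflow_total_def sum_distrib_left
    by (rule sum_mono) (simp add: query_alloc)
  also have "\<dots> \<le> M * n + (n - C) * (s - 1)" using inv by (simp add: fast_inv_def)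
  also have "\<dots> \<le> M * W + W * (s - 1)"
    using n by (intro add_mono mult_mono) auto
  finally have "real (u * overflow_total y) \<le> real (M * W + W * (s - 1))"
    unfolding of_nat_le_iff .
  also have "\<dots> = real (M * W) + real W * real (s - 1)" by simp
  also have "real (s - 1) \<le> real M * \<phi> / 2" using s_real s_pos by (simp add: of_nat_diff)
  then have "real (M * W) + real W * real (s - 1) \<le> real (M * W) + real W * (real M * \<phi> / 2)"
    by (intro add_left_mono mult_left_mono) auto
  also have "\<dots> = real (k * u) * (1 + \<phi> / 2)" unfolding ku_eq by (simp add: algebra_simps)
  finally have "real u * real (overflow_total y) \<le> real u * (real k * (1 + \<phi> / 2))"
    by (simp add: algebra_simps)
  then show ?thesis by (rule mult_left_le_imp_le) (simp add: u_pos)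
qed

end

section \<open>Accuracy of the window queries\<close>

text \<open>A table without zero entries: WFAST removes an id whose count reaches zero, so absence
  and count zero coincide.\<close>

definition count_map :: "('a \<Rightarrow> nat) \<Rightarrow> ('a \<rightharpoonup> nat)" where
  "count_map f x = (if f x = 0 then None else Some (f x))"

lemma decrement_count_map: "decrement z (count_map f) = count_map (f(z := f z - 1))"
  by (rule ext) (auto simp: decrement_def count_map_def)

lemma increment_count_map: "increment x (count_map f) = count_map (f(x := Suc (f x)))"
  by (rule ext) (auto simp: increment_def count_map_def)

lemma count_list_map_distinct:
  "distinct ps \<Longrightarrow> count_list (map f ps) x = card {a \<in> set ps. f a = x}"
proof (induction ps)
  case (Cons a ps)
  have "{b \<in> set (a # ps). f b = x} =
      (if f a = x then insert a {b \<in> set ps. f b = x} else {b \<in> set ps. f b = x})"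
    by auto
  then show ?case using Cons by auto
qed simp

text \<open>First in, first out: the earliest positions are popped first, so \<open>n\<close> pops
  clear all positions before \<open>b\<close> if there are at most \<open>n\<close> of them.\<close>

lemma set_drop_sorted_distinct:
  fixes ps :: "nat list"
  assumes "sorted ps" "distinct ps" and card: "card {a \<in> set ps. a < b} \<le> n"
  shows "set (drop n ps) \<subseteq> {a \<in> set ps. b \<le> a}"
proof
  fix a assume a: "a \<in> set (drop n ps)"
  then obtain d where d: "d < length (drop n ps)" "drop n ps ! d = a"
    unfolding in_set_conv_nth by blast
  define i where "i = n + d"
  then have i: "n \<le> i" "i < length ps" "a = ps ! i" using d by auto
  have "b \<le> a"
  proof (rule ccontr)
    assume "\<not> b \<le> a"
    then have "ps ! j \<in> {a \<in> set ps. a < b}" if "j \<le> i" for j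
      using i sorted_nth_mono[OF assms(1) that] that by simp
    then have "(\<lambda>j. ps ! j) ` {..i} \<subseteq> {a \<in> set ps. a < b}" by blast
    then have "card ((\<lambda>j. ps ! j) ` {..i}) \<le> card {a \<in> set ps. a < b}"
      by (intro card_mono) auto
    then have "card ((\<lambda>j. ps ! j) ` {..i}) \<le> n" using card by linarith
    moreover have "inj_on (\<lambda>j. ps ! j) {..i}"
      using i assms(2) by (auto simp: inj_on_def nth_eq_iff_index_eq)
    ultimately show False using i by (simp add: card_image)
  qed
  then show "a \<in> {a \<in> set ps. b \<le> a}" using i by simp
qed

text \<open>Writing the tail as \<open>drop n X\<close> also covers the empty queue: popping it
  changes nothing, and neither does one more \<open>drop\<close>.\<close>

lemma pop_oldest_append:
  "pop_oldest (qs @ [drop n X], count_map (count_list (concat (qs @ [drop n X])))) =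
   (qs @ [drop (Suc n) X], count_map (count_list (concat (qs @ [drop (Suc n) X]))))"
proof (cases "drop n X")
  case Nil
  then show ?thesis by (simp add: pop_oldest_def)
next
  case (Cons z q)
  then have [simp]: "drop (Suc n) X = q" by (metis drop_Suc list.sel(3) tl_drop)
  have "(count_list (concat (qs @ [z # q])))(z := count_list (concat (qs @ [z # q])) z - 1) =
      count_list (concat (qs @ [q]))"
    by (rule ext) auto
  then show ?thesis by (simp add: pop_oldest_def Cons decrement_count_map)
qed

lemma push_newest_Cons:
  "push_newest x (X # qs, count_map (count_list (concat (X # qs)))) =
   ((X @ [x]) # qs, count_map (count_list (concat ((X @ [x]) # qs))))"
proof -
  have "(count_list (concat (X # qs)))(x := Suc (count_list (concat (X # qs)) x)) =
      count_list (concat ((X @ [x]) # qs))"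
    by (rule ext) auto
  then show ?thesis by (simp add: push_newest_def increment_count_map)
qed

text \<open>Each \<open>a\<close> is counted for at most one \<open>i\<close>, namely
  \<open>T - f a\<close>. In the applications \<open>f\<close> gives the block of a position,
  \<open>T\<close> is the current block and \<open>i\<close> the age of a block.\<close>

lemma card_diagonal_sum:
  fixes f :: "nat \<Rightarrow> nat"
  assumes fin: "finite {a. P a}"
  shows "(\<Sum>i<n. card {a. P a \<and> f a + i = T}) = card {a. P a \<and> f a \<le> T \<and> T < f a + n}"
proof (induction n)
  case (Suc n)
  have "{a. P a \<and> f a \<le> T \<and> T < f a + Suc n} =
      {a. P a \<and> f a \<le> T \<and> T < f a + n} \<union> {a. P a \<and> f a + n = T}" by auto
  moreover have "card ({a. P a \<and> f a \<le> T \<and> T < f a + n} \<union> {a. P a \<and> f a + n = T}) =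
      card {a. P a \<and> f a \<le> T \<and> T < f a + n} + card {a. P a \<and> f a + n = T}"
    by (rule card_Un_disjoint) (auto intro: finite_subset[OF _ fin])
  ultimately show ?case using Suc by simp
next
  case 0
  have "{a. P a \<and> f a \<le> T \<and> T < f a + 0} = {}" by auto
  then show ?case by (simp only: card.empty lessThan_0 sum.empty)
qed

lemma Suc_mod_div_cases:
  assumes "(L::nat) > 0"
  obtains "Suc t mod L = 0" "Suc t div L = Suc (t div L)" "t mod L = L - 1"
  | "Suc t mod L = Suc (t mod L)" "Suc t div L = t div L" "Suc (t mod L) < L"
proof (cases "Suc (t mod L) = L")
  case True
  then show ?thesis using that(1) by (simp add: mod_Suc div_Suc)
next
  case False
  moreover have "t mod L < L" using assms by simp
  ultimately have "Suc (t mod L) < L" by linarith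
  then show ?thesis using that(2) False by (simp add: mod_Suc div_Suc)
qed

lemma window_volume_alt:
  "window_volume W p x = (\<Sum>i\<in>{length p - W..<length p}. if fst (p ! i) = x then snd (p ! i) else 0)"
proof -
  have "{i. i \<in> {length p - W..<length p} \<and> fst (p ! i) = x} =
     {length p - W..<length p} \<inter> {i. fst (p ! i) = x}" by auto
  then show ?thesis unfolding window_volume_def by (simp add: sum.inter_restrict)
qed

text \<open>Describes the components of the successor by separate equations, so that offset,
  instance and queues can be followed independently.\<close>

lemma wfast_add_iff:
  "wfast_add W M \<epsilon> \<phi> x w A A' \<longleftrightarrow>
    (let o1 = (offset A + 1) mod W; y1 = (if o1 = 0 then fast_init else inst A) in
      offset A' = o1 \<and> wfast_fast_add M \<epsilon> \<phi> x w y1 (inst A') \<and>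
      (queues A', overflows A') =
        (if wfast_fast_query M \<epsilon> \<phi> y1 x div overflow_unit W M \<epsilon> <
            wfast_fast_query M \<epsilon> \<phi> (inst A') x div overflow_unit W M \<epsilon>
         then push_newest x else id)
        (pop_oldest (if o1 mod (W div block_count \<epsilon>) = 0 then [] # butlast (queues A) else queues A,
          overflows A)))"
proof -
  define o1 where "o1 = (offset A + 1) mod W"
  define y1 where "y1 = (if o1 = 0 then fast_init else inst A)"
  define b1 where
    "b1 = (if o1 mod (W div block_count \<epsilon>) = 0 then [] # butlast (queues A) else queues A)"
  obtain b2 B2 where pop: "pop_oldest (b1, overflows A) = (b2, B2)" by fastforce
  obtain b3 B3 where push: "push_newest x (b2, B2) = (b3, B3)" by fastforce
  show ?thesis
    unfolding wfast_add_def Let_def o1_def[symmetric] y1_def[symmetric] b1_def[symmetric] pop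
    by (cases A') (auto simp: push)
qed

text \<open>A run is kept as the sequence of all its states, because bounds at the end of the stream
  refer to estimates at earlier times. \<open>As t\<close> has processed the positions below
  \<open>t\<close>.\<close>

locale wfast_trace = wfast_params W M \<epsilon> \<phi> for W M :: nat and \<epsilon> \<phi> :: real +
  fixes U :: "'a set" and p :: "('a \<times> nat) list" and As :: "nat \<Rightarrow> 'a wfast"
  assumes stream: "weighted_stream U M p"
    and As_0: "As 0 = wfast_init \<epsilon>"
    and As_Suc: "t < length p \<Longrightarrow>
      wfast_add W M \<epsilon> \<phi> (fst (p ! t)) (snd (p ! t)) (As t) (As (Suc t))"
begin

abbreviation "id_at t \<equiv> fst (p ! t)"
abbreviation "weight_at t \<equiv> snd (p ! t)"

text \<open>The instance met by the insertion at position \<open>t\<close>. The offset is raised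
  before the flush test, whence \<open>Suc t\<close>.\<close>

definition before :: "nat \<Rightarrow> 'a fast" where
  "before t = (if Suc t mod W = 0 then fast_init else inst (As t))"

definition overflow :: "nat \<Rightarrow> bool" where
  "overflow t \<longleftrightarrow>
     query (before t) (id_at t) div u < query (inst (As (Suc t))) (id_at t) div u"

lemma weight_le: "t < length p \<Longrightarrow> weight_at t \<le> M"
  using stream nth_mem[of t p] unfolding weighted_stream_def by fastforce

lemma id_in: "t < length p \<Longrightarrow> id_at t \<in> U"
  using stream nth_mem[of t p] unfolding weighted_stream_def by fastforce

lemma offset_eq: "t \<le> length p \<Longrightarrow> offset (As t) = t mod W"
proof (induction t)
  case 0
  then show ?case by (simp add: As_0 wfast_init_def)
next
  case (Suc t)
  then show ?case using As_Suc[of t] by (simp add: wfast_add_iff Let_def mod_Suc_eq)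
qed

lemma Suc_mod_W_mod_L: "Suc t mod W mod L = Suc t mod L"
  using W_eq by (intro mod_mod_cancel) (metis dvd_triv_right)

lemma step:
  assumes t: "t < length p"
  shows "add (id_at t) (weight_at t) (before t) (inst (As (Suc t)))"
    and "(queues (As (Suc t)), overflows (As (Suc t))) =
      (if overflow t then push_newest (id_at t) else id)
        (pop_oldest (if Suc t mod L = 0 then [] # butlast (queues (As t)) else queues (As t),
          overflows (As t)))"
proof -
  have o: "(offset (As t) + 1) mod W = Suc t mod W"
    using offset_eq t by (simp add: mod_Suc_eq)
  show "add (id_at t) (weight_at t) (before t) (inst (As (Suc t)))"
    "(queues (As (Suc t)), overflows (As (Suc t))) =
      (if overflow t then push_newest (id_at t) else id)
        (pop_oldest (if Suc t mod L = 0 then [] # butlast (queues (As t)) else queues (As t),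
          overflows (As t)))"
    using As_Suc[OF t]
    unfolding wfast_add_iff Let_def o Suc_mod_W_mod_L before_def[symmetric] overflow_def[symmetric]
    by blast+
qed

text \<open>Position \<open>j\<close> is processed at offset \<open>Suc j\<close> modulo
  \<open>W\<close> and thus belongs to block \<open>Suc j div L\<close>; \<open>i\<close> is the age
  of a block. The sum with \<open>i\<close>, in place of a truncated difference, makes blocks before
  the start of the stream empty.\<close>

definition block_overflows :: "nat \<Rightarrow> nat \<Rightarrow> nat list" where
  "block_overflows i t = filter (\<lambda>j. overflow j \<and> Suc j div L + i = t div L) [0..<t]"

lemma set_block_overflows:
  "set (block_overflows i t) = {j. (j < t \<and> overflow j) \<and> Suc j div L + i = t div L}"
  by (auto simp: block_overflows_def)

lemma distinct_block_overflows: "distinct (block_overflows i t)"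
  by (simp add: block_overflows_def)

lemma sorted_block_overflows: "sorted (block_overflows i t)"
  by (simp add: block_overflows_def sorted_wrt_filter)

lemma card_block_prefix:
  "finite {j. Suc j div L = d \<and> Suc j mod L < n}" "card {j. Suc j div L = d \<and> Suc j mod L < n} \<le> n"
proof -
  have inj: "inj_on (\<lambda>j. Suc j mod L) {j. Suc j div L = d \<and> Suc j mod L < n}"
    by (rule inj_onI) (metis (mono_tags, lifting) div_mult_mod_eq mem_Collect_eq nat.inject)
  have sub: "(\<lambda>j. Suc j mod L) ` {j. Suc j div L = d \<and> Suc j mod L < n} \<subseteq> {..<n}" by auto
  show "finite {j. Suc j div L = d \<and> Suc j mod L < n}"
    using inj sub by (meson finite_lessThan inj_on_finite)
  show "card {j. Suc j div L = d \<and> Suc j mod L < n} \<le> n"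
    using card_inj_on_le[OF inj sub] by simp
qed

text \<open>A block has at most \<open>L\<close> positions, each with at most one overflow. As every
  insertion pops one id, the oldest queue is drained within one block.\<close>

lemma length_block_overflows: "length (block_overflows i t) \<le> L"
proof -
  have "length (block_overflows i t) = card (set (block_overflows i t))"
    using distinct_card[OF distinct_block_overflows] by simp
  also have "\<dots> \<le> card {j. Suc j div L = t div L - i \<and> Suc j mod L < L}"
    using L_pos by (intro card_mono card_block_prefix) (auto simp: set_block_overflows)
  also have "\<dots> \<le> L" by (rule card_block_prefix)
  finally show ?thesis .
qed

definition block_queue :: "nat \<Rightarrow> nat \<Rightarrow> 'a list" where
  "block_queue i t = map id_at (block_overflows i t)"

text \<open>Every insertion pops once, including the one that rotates, so \<open>t mod L + 1\<close>
  ids have left the oldest queue. In block \<open>0\<close> this is one pop too many, but then the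
  queue of age \<open>k\<close> is empty.\<close>

lemma state_eq:
  assumes "t \<le> length p"
  shows "queues (As t) =
      map (\<lambda>i. block_queue i t) [0..<k] @ [drop (Suc (t mod L)) (block_queue k t)] \<and>
    overflows (As t) = count_map (count_list (concat (queues (As t))))"
  using assms
proof (induction t)
  case 0
  have q: "replicate (k + 1) [] = map (\<lambda>i. block_queue i 0) [0..<k] @ [drop (Suc (0 mod L)) (block_queue k 0)]"
    by (simp add: block_queue_def block_overflows_def map_replicate_const replicate_append_same)
  moreover have "Map.empty = count_map (count_list (concat (replicate (k + 1) [])))"
    by (rule ext) (simp add: count_map_def concat_replicate_trivial)
  ultimately show ?case unfolding As_0 wfast_init_def wfast.simps by blast
next
  case (Suc t)
  \<comment> \<open>\<open>Q\<close> describes the queues between rotation and push: ages already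
    refer to the block of \<open>Suc t\<close>, but position \<open>t\<close> is not recorded
    yet.\<close>
  define Q where "Q i = map id_at (filter (\<lambda>j. overflow j \<and> Suc j div L + i = Suc t div L) [0..<t])" for i
  define b1 where "b1 = (if Suc t mod L = 0 then [] # butlast (queues (As t)) else queues (As t))"
  define n where "n = Suc t mod L"
  have IH: "queues (As t) =
      map (\<lambda>i. block_queue i t) [0..<k] @ [drop (Suc (t mod L)) (block_queue k t)]"
    "overflows (As t) = count_map (count_list (concat (queues (As t))))"
    using Suc by auto
  have b1: "b1 = map Q [0..<k] @ [drop n (Q k)] \<and>
      count_list (concat (queues (As t))) = count_list (concat b1)"
    using L_pos
  proof (cases rule: Suc_mod_div_cases[of L t])
    case 1
    have "Q 0 = []"
    proof -
      have "Suc j div L \<noteq> Suc t div L" if "j < t" for j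
      proof -
        have "Suc j div L \<le> t div L" using that by (intro div_le_mono) simp
        then show ?thesis using 1 by simp
      qed
      then show ?thesis by (auto simp: Q_def filter_empty_conv)
    qed
    moreover have "Q (Suc i) = block_queue i t" for i
      using 1 by (simp add: Q_def block_queue_def block_overflows_def)
    \<comment> \<open>Here \<open>Suc (t mod L) = L\<close>, so the queue of at most
      \<open>L\<close> ids is drained. The rotation discards an empty queue, and the table needs no
      update.\<close>
    moreover have tail: "drop (Suc (t mod L)) (block_queue k t) = []"
      using length_block_overflows[of k t] 1 L_pos by (simp add: block_queue_def)
    moreover have "[0..<Suc k] = 0 # map Suc [0..<k]" by (simp add: map_Suc_upt upt_conv_Cons del: upt_Suc)
    ultimately have "[] # map (\<lambda>i. block_queue i t) [0..<k] = map Q [0..<Suc k]"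
      by simp
    moreover have "b1 = [] # map (\<lambda>i. block_queue i t) [0..<k]"
      using 1 by (simp add: b1_def IH(1) butlast_append)
    ultimately have "b1 = map Q [0..<k] @ [drop n (Q k)]"
      using 1 by (simp add: n_def)
    moreover have "concat (queues (As t)) = concat b1"
      using \<open>b1 = [] # _\<close> tail by (simp add: IH(1))
    ultimately show ?thesis by simp
  next
    case 2
    have "Q i = block_queue i t" for i
      using 2 by (simp add: Q_def block_queue_def block_overflows_def)
    then show ?thesis using 2 by (simp add: b1_def IH(1) n_def)
  qed
  have pop: "pop_oldest (b1, overflows (As t)) =
      (map Q [0..<k] @ [drop (Suc n) (Q k)],
       count_map (count_list (concat (map Q [0..<k] @ [drop (Suc n) (Q k)]))))"
    using b1 by (simp only: IH(2) pop_oldest_append)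
  have new: "block_queue i (Suc t) = Q i @ (if overflow t \<and> i = 0 then [id_at t] else [])" for i
    by (simp add: block_queue_def block_overflows_def Q_def)
  have k_upt: "[0..<k] = 0 # [1..<k]" using k_pos by (simp add: upt_conv_Cons)
  have Q_Cons: "map Q [0..<k] @ X = Q 0 # (map Q [1..<k] @ X)" for X
    by (simp add: k_upt)
  have new_Cons: "map (\<lambda>i. block_queue i (Suc t)) [0..<k] @ [drop (Suc n) (block_queue k (Suc t))] =
      (if overflow t then Q 0 @ [id_at t] else Q 0) # (map Q [1..<k] @ [drop (Suc n) (Q k)])"
    using k_pos by (simp add: k_upt new)
  have "t < length p" using Suc by simp
  note st = step(2)[OF this, folded b1_def, unfolded pop]
  show ?case
  proof (cases "overflow t")
    case True
    then show ?thesis using st unfolding new_Cons[folded n_def] n_def[symmetric]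
      by (simp only: Q_Cons if_True push_newest_Cons prod.inject)
  next
    case False
    then show ?thesis using st unfolding new_Cons n_def[symmetric]
      by (simp only: False if_False id_apply Q_Cons prod.inject)
  qed
qed

section \<open>Overflows and volumes of intervals of positions\<close>

definition overflow_count :: "'a \<Rightarrow> nat \<Rightarrow> nat \<Rightarrow> nat" where
  "overflow_count x a b = card {j \<in> {a..<b}. overflow j \<and> id_at j = x}"

definition volume :: "'a \<Rightarrow> nat \<Rightarrow> nat \<Rightarrow> nat" where
  "volume x a b = (\<Sum>j\<in>{a..<b}. if id_at j = x then weight_at j else 0)"

lemma overflow_count_Suc:
  assumes "a \<le> b"
  shows "overflow_count x a (Suc b) =
    overflow_count x a b + (if x = id_at b \<and> overflow b then 1 else 0)"
proof -
  have "{j \<in> {a..<Suc b}. overflow j \<and> id_at j = x} =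
    (if x = id_at b \<and> overflow b then insert b else id) {j \<in> {a..<b}. overflow j \<and> id_at j = x}"
    using assms by (auto simp: less_Suc_eq)
  then show ?thesis by (simp add: overflow_count_def)
qed

lemma volume_Suc:
  "a \<le> b \<Longrightarrow> volume x a (Suc b) = volume x a b + (if x = id_at b then weight_at b else 0)"
  by (auto simp: volume_def)

lemma overflow_count_trans:
  assumes "a \<le> b" "b \<le> c"
  shows "overflow_count x a c = overflow_count x a b + overflow_count x b c"
proof -
  have "{j \<in> {a..<c}. overflow j \<and> id_at j = x} =
    {j \<in> {a..<b}. overflow j \<and> id_at j = x} \<union> {j \<in> {b..<c}. overflow j \<and> id_at j = x}"
    using assms by auto
  then show ?thesis unfolding overflow_count_def by (simp add: card_Un_disjoint disjoint_iff)
qed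

lemma volume_trans: "a \<le> b \<Longrightarrow> b \<le> c \<Longrightarrow> volume x a c = volume x a b + volume x b c"
  unfolding volume_def by (simp add: sum.atLeastLessThan_concat)

lemma volume_le:
  assumes "b \<le> length p"
  shows "volume x a b \<le> (b - a) * M"
proof -
  have "volume x a b \<le> (\<Sum>j\<in>{a..<b}. M)"
    unfolding volume_def using assms weight_le by (intro sum_mono) auto
  then show ?thesis by simp
qed

lemma window_volume_eq: "window_volume W p x = volume x (length p - W) (length p)"
  by (simp add: window_volume_alt volume_def)

abbreviation tracked :: "nat \<Rightarrow> 'a \<Rightarrow> nat" where
  "tracked t x \<equiv> count_list (concat (queues (As t))) x"

lemma tracked_eq:
  assumes "t \<le> length p"
  shows "tracked t x =
    card {j. (j < t \<and> overflow j \<and> id_at j = x) \<and> Suc j div L \<le> t div L \<and> t div L < Suc j div L + k} +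
    count_list (drop (Suc (t mod L)) (block_queue k t)) x"
proof -
  have fin: "finite {j. j < t \<and> overflow j \<and> id_at j = x}" by simp
  have "count_list (block_queue i t) x =
      card {j. (j < t \<and> overflow j \<and> id_at j = x) \<and> Suc j div L + i = t div L}" for i
    unfolding block_queue_def count_list_map_distinct[OF distinct_block_overflows] set_block_overflows
    by (rule arg_cong[where f = card]) auto
  then have "(\<Sum>i<k. count_list (block_queue i t) x) =
    card {j. (j < t \<and> overflow j \<and> id_at j = x) \<and> Suc j div L \<le> t div L \<and> t div L < Suc j div L + k}"
    by (simp only: card_diagonal_sum[OF fin])
  moreover have "count_list (concat (map (\<lambda>i. block_queue i t) [0..<n])) x =
      (\<Sum>i<n. count_list (block_queue i t) x)" for n
    by (induction n) auto
  ultimately show ?thesis using state_eq[OF assms] by simp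
qed

text \<open>The youngest \<open>k\<close> blocks are complete in the queues. A block with index
  \<open>b > 0\<close> starts at position \<open>b * L - 1\<close>; if there are at most
  \<open>k\<close> blocks so far, truncation yields position \<open>0\<close>.\<close>

lemma tracked_ge:
  assumes "t \<le> length p"
  shows "overflow_count x ((Suc (t div L) - k) * L - 1) t \<le> tracked t x"
proof -
  have "{j \<in> {(Suc (t div L) - k) * L - 1..<t}. overflow j \<and> id_at j = x} \<subseteq>
    {j. (j < t \<and> overflow j \<and> id_at j = x) \<and> Suc j div L \<le> t div L \<and> t div L < Suc j div L + k}"
  proof
    fix j assume j: "j \<in> {j \<in> {(Suc (t div L) - k) * L - 1..<t}. overflow j \<and> id_at j = x}"
    then have "(Suc (t div L) - k) * L \<le> Suc j" by auto
    then have "Suc (t div L) - k \<le> Suc j div L" using L_pos by (simp add: less_eq_div_iff_mult_less_eq)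
    moreover have "Suc j div L \<le> t div L" using j by (intro div_le_mono) auto
    ultimately show "j \<in> {j. (j < t \<and> overflow j \<and> id_at j = x) \<and> Suc j div L \<le> t div L \<and> t div L < Suc j div L + k}"
      using j by auto
  qed
  then have "overflow_count x ((Suc (t div L) - k) * L - 1) t \<le>
    card {j. (j < t \<and> overflow j \<and> id_at j = x) \<and> Suc j div L \<le> t div L \<and> t div L < Suc j div L + k}"
    unfolding overflow_count_def by (intro card_mono) auto
  then show ?thesis using tracked_eq[OF assms] by simp
qed

text \<open>At most \<open>t mod L + 1\<close> positions of the oldest block precede the window, and
  as many pops have been made, earliest first. What is left in the oldest queue lies in the window,
  and younger blocks lie in it anyway.\<close>

lemma tracked_le:
  assumes t: "t \<le> length p"
  shows "tracked t x \<le> overflow_count x (t - W) t"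
proof -
  let ?T = "t div L" and ?r = "t mod L"
  let ?A = "{j. (j < t \<and> overflow j \<and> id_at j = x) \<and> Suc j div L \<le> ?T \<and> ?T < Suc j div L + k}"
  let ?D = "drop (Suc ?r) (block_overflows k t)"
  let ?B = "{j \<in> set ?D. id_at j = x}"
  have t_eq: "t = ?T * L + ?r" by (simp only: div_mult_mod_eq)
  have "count_list (drop (Suc ?r) (block_queue k t)) x = card ?B"
    unfolding block_queue_def drop_map
    by (rule count_list_map_distinct) (simp add: distinct_block_overflows)
  then have "tracked t x = card ?A + card ?B" using tracked_eq[OF t] by simp
  have D: "set ?D \<subseteq> {j \<in> set (block_overflows k t). t - W \<le> j}"
  proof (rule set_drop_sorted_distinct[OF sorted_block_overflows distinct_block_overflows])
    have "{j \<in> set (block_overflows k t). j < t - W} \<subseteq>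
      {j. Suc j div L = ?T - k \<and> Suc j mod L < Suc ?r}"
    proof
      fix j assume j: "j \<in> {j \<in> set (block_overflows k t). j < t - W}"
      then have d: "Suc j div L = ?T - k" and "k \<le> ?T" and "Suc j \<le> t - W"
        by (auto simp: set_block_overflows)
      moreover have "Suc j = Suc j div L * L + Suc j mod L" by (simp only: div_mult_mod_eq)
      \<comment> \<open>\<open>W\<close> is \<open>k\<close> whole blocks, so \<open>t - W\<close>
        has the same residue modulo \<open>L\<close> as \<open>t\<close>.\<close>
      moreover have "t - W = (?T - k) * L + ?r"
        using \<open>k \<le> ?T\<close> W_eq by (metis Nat.add_diff_assoc2 diff_mult_distrib mult_le_mono1 t_eq)
      ultimately have "Suc j mod L \<le> ?r" by simp
      then show "j \<in> {j. Suc j div L = ?T - k \<and> Suc j mod L < Suc ?r}" using d by auto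
    qed
    then have "card {j \<in> set (block_overflows k t). j < t - W} \<le>
      card {j. Suc j div L = ?T - k \<and> Suc j mod L < Suc ?r}"
      by (intro card_mono card_block_prefix)
    also have "\<dots> \<le> Suc ?r" by (rule card_block_prefix)
    finally show "card {j \<in> set (block_overflows k t). j < t - W} \<le> Suc ?r" .
  qed
  have B: "?B \<subseteq> {j \<in> {t - W..<t}. overflow j \<and> id_at j = x}"
    using D by (auto simp: set_block_overflows)
  have A: "?A \<subseteq> {j \<in> {t - W..<t}. overflow j \<and> id_at j = x}"
  proof
    fix j assume j: "j \<in> ?A"
    then have "Suc ?T - k \<le> Suc j div L" by auto
    then have "(Suc ?T - k) * L \<le> Suc j" using L_pos by (simp add: less_eq_div_iff_mult_less_eq)
    moreover have "t - W < (Suc ?T - k) * L \<or> t < W"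
    proof (cases "t < W")
      case False
      then have "k \<le> ?T" using L_pos W_eq by (simp add: less_eq_div_iff_mult_less_eq)
      then have "t - W = (?T - k) * L + ?r" using W_eq
        by (metis Nat.add_diff_assoc2 diff_mult_distrib mult_le_mono1 t_eq)
      also have "\<dots> < (?T - k) * L + L" using L_pos by simp
      also have "\<dots> = (Suc ?T - k) * L" using \<open>k \<le> ?T\<close> by (simp add: Suc_diff_le)
      finally show ?thesis by simp
    qed simp
    ultimately show "j \<in> {j \<in> {t - W..<t}. overflow j \<and> id_at j = x}" using j by auto
  qed
  have "?A \<inter> ?B = {}"
    using set_drop_subset[of "Suc ?r" "block_overflows k t"] by (auto simp: set_block_overflows)
  then have "card ?A + card ?B = card (?A \<union> ?B)" by (subst card_Un_disjoint) auto
  also have "\<dots> \<le> overflow_count x (t - W) t"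
    unfolding overflow_count_def using A B by (intro card_mono) auto
  finally show ?thesis using \<open>tracked t x = _\<close> by simp
qed

section \<open>Estimates within a frame\<close>

abbreviation query_at :: "nat \<Rightarrow> 'a \<Rightarrow> nat" where
  "query_at t \<equiv> query (inst (As t))"

text \<open>The insertion that triggers the flush already belongs to the new frame, whence
  \<open>Suc\<close>. The first frame lacks such an insertion, so the count is only bounded.\<close>

lemma inv_state:
  assumes "t \<le> length p"
  shows "\<exists>n \<le> Suc (t mod W). fast_inv n (inst (As t))"
  using assms
proof (induction t)
  case 0
  then show ?case by (auto simp: As_0 wfast_init_def intro: fast_inv_init)
next
  case (Suc t)
  then have t: "t < length p" by simp
  have "\<exists>n \<le> Suc t mod W. fast_inv n (before t)"
  proof (cases "Suc t mod W = 0")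
    case True
    then show ?thesis by (auto simp: before_def intro: fast_inv_init)
  next
    case False
    then have "Suc t mod W = Suc (t mod W)" by (simp add: mod_Suc split: if_splits)
    then show ?thesis using Suc False by (simp add: before_def)
  qed
  then obtain n where "n \<le> Suc t mod W" "fast_inv n (before t)" by blast
  then show ?case using fast_inv_add[OF _ step(1)[OF t] weight_le[OF t]] by blast
qed

text \<open>The insertion at \<open>t\<close> is itself one of the at most \<open>W\<close>
  insertions of its frame, so fewer than \<open>W\<close> precede it.\<close>

lemma inv_before:
  assumes t: "t < length p"
  obtains n where "n < W" "fast_inv n (before t)"
proof (cases "Suc t mod W = 0")
  case True
  then show ?thesis using that[OF W_pos] by (simp add: before_def fast_inv_init)
next
  case False
  have "Suc (t mod W) < W"
    by (rule Suc_mod_div_cases[OF W_pos, of t]) (use False in auto)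
  moreover obtain n where "n \<le> Suc (t mod W)" "fast_inv n (inst (As t))"
    using inv_state[of t] t by auto
  ultimately show ?thesis using that[of n] False by (simp add: before_def)
qed

lemma query_step:
  assumes t: "t < length p"
  shows "query_at (Suc t) x - u \<le> query (before t) x - u + (if x = id_at t then weight_at t else 0)"
    and "query_at (Suc t) x div u =
      query (before t) x div u + (if x = id_at t \<and> overflow t then 1 else 0)"
    and "query (before t) x + (if x = id_at t then weight_at t else 0) \<le> query_at (Suc t) x"
proof -
  obtain n where n: "n < W" "fast_inv n (before t)" using inv_before[OF t] .
  note q = query_add_excess[OF n(2,1) step(1)[OF t] weight_le[OF t], of x]
  show "query_at (Suc t) x - u \<le> query (before t) x - u + (if x = id_at t then weight_at t else 0)"
    by (rule q(1))
  show "query_at (Suc t) x div u =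
      query (before t) x div u + (if x = id_at t \<and> overflow t then 1 else 0)"
    using q(2) unfolding overflow_def .
  show "query (before t) x + (if x = id_at t then weight_at t else 0) \<le> query_at (Suc t) x"
    by (rule q(3))
qed

text \<open>No flush intervenes, so the one-step bounds add up. The first bound speaks of the excess
  over \<open>u\<close>, because below \<open>u\<close> an estimate may rise without any
  volume.\<close>

lemma query_same_frame:
  assumes "a \<le> b" "b \<le> length p" "a div W = b div W"
  shows "query_at b x - u \<le> query_at a x - u + volume x a b \<and>
    query_at b x div u = query_at a x div u + overflow_count x a b \<and>
    query_at a x + volume x a b \<le> query_at b x"
  using assms
proof (induction b rule: dec_induct)
  case base
  then show ?case by (simp add: volume_def overflow_count_def)
next
  case (step b)
  have "a div W \<le> b div W" "b div W \<le> Suc b div W"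
    using step(1) by (auto intro: div_le_mono)
  then have same: "a div W = b div W" "Suc b div W = b div W" using step by auto
  then have "Suc b mod W \<noteq> 0" by (metis div_Suc n_not_Suc_n)
  then have before: "before b = inst (As b)" by (simp add: before_def)
  have b: "b < length p" using step by simp
  show ?case
    using step.IH same(1) b query_step[OF b, of x] step(1)
    by (simp add: before overflow_count_Suc volume_Suc)
qed

text \<open>State \<open>t\<close> has seen the positions below \<open>t\<close>; those of its frame start at
  \<open>t - t mod W - 1\<close>, since the flush happens just before position \<open>j\<close> is processed if
  \<open>W dvd j + 1\<close>.\<close>

definition frame_start :: "nat \<Rightarrow> nat" where
  "frame_start t = t - t mod W - 1"

lemma frame_start_le: "frame_start t \<le> t"
  by (simp add: frame_start_def)

lemma frame_start_Suc:
  "frame_start (Suc t) = (if Suc t mod W = 0 then t else frame_start t)"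
  by (auto simp: frame_start_def mod_Suc)

lemma query_frame:
  assumes "t \<le> length p"
  shows "query_at t x - u \<le> volume x (frame_start t) t \<and>
    query_at t x div u = overflow_count x (frame_start t) t \<and>
    volume x (frame_start t) t \<le> query_at t x"
  using assms
proof (induction t)
  case 0
  then show ?case
    by (simp add: As_0 wfast_init_def query_init frame_start_def volume_def overflow_count_def)
next
  case (Suc t)
  then have t: "t < length p" by simp
  show ?case
  proof (cases "Suc t mod W = 0")
    case True
    then show ?thesis using query_step[OF t, of x]
      by (simp add: before_def query_init frame_start_Suc overflow_count_Suc volume_Suc)
        (auto simp: volume_def overflow_count_def)
  next
    case False
    then show ?thesis using query_step[OF t, of x] Suc frame_start_le[of t]
      by (simp add: before_def frame_start_Suc overflow_count_Suc volume_Suc)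
  qed
qed

text \<open>A flush resets the potential and restarts the count; between flushes each overflow
  raises the potential by at least as much as the count.\<close>

lemma card_overflows_frame:
  assumes "t \<le> length p"
  shows "card {j \<in> {frame_start t..<t}. overflow j} \<le> overflow_total (inst (As t))"
  using assms
proof (induction t)
  case 0
  then show ?case by simp
next
  case (Suc t)
  then have t: "t < length p" by simp
  obtain n where n: "n < W" "fast_inv n (before t)" using inv_before[OF t] .
  have total: "overflow_total (before t) + (if overflow t then 1 else 0)
    \<le> overflow_total (inst (As (Suc t)))"
    using overflow_total_add[OF n(2,1) step(1)[OF t] weight_le[OF t]] unfolding overflow_def .
  have Suc_eq: "{j \<in> {a..<Suc t}. overflow j} =
    (if overflow t then insert t else id) {j \<in> {a..<t}. overflow j}" if "a \<le> t" for a
    using that by (auto simp: less_Suc_eq)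
  show ?case
  proof (cases "Suc t mod W = 0")
    case True
    show ?thesis unfolding frame_start_Suc if_P[OF True] Suc_eq[OF order_refl] using total by auto
  next
    case False
    have "card {j \<in> {frame_start t..<t}. overflow j} \<le> overflow_total (before t)"
      using Suc False by (simp add: before_def)
    then show ?thesis
      unfolding frame_start_Suc if_not_P[OF False] Suc_eq[OF frame_start_le] using total by auto
  qed
qed

lemma card_overflows_frame_le:
  assumes "t \<le> length p"
  shows "real (card {j \<in> {frame_start t..<t}. overflow j}) \<le> real k * (1 + \<phi> / 2)"
proof -
  obtain n where "n \<le> Suc (t mod W)" "fast_inv n (inst (As t))"
    using inv_state[OF assms] by blast
  moreover have "Suc (t mod W) \<le> W" using W_pos by (simp add: Suc_leI)
  ultimately have "real (overflow_total (inst (As t))) \<le> real k * (1 + \<phi> / 2)"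
    using overflow_total_le[of n "inst (As t)"] by simp
  then show ?thesis using card_overflows_frame[OF assms] by linarith
qed

text \<open>Positions of the three boundaries: the start \<open>N - W\<close> of the window, the
  start \<open>m\<close> of the completely recorded blocks, and the flush. As state indices all
  three belong to one frame, so \<open>query_same_frame\<close> relates their estimates. The last
  claim says that even the oldest block does not reach back beyond the previous frame.\<close>

lemma previous_frame:
  assumes N: "N \<le> length p" "W \<le> N"
  defines "m \<equiv> (Suc (N div L) - k) * L - 1"
  shows "N - W \<le> m" "m \<le> frame_start N" "m - (N - W) \<le> L"
    "(N - W) div W = frame_start N div W" "m div W = frame_start N div W"
    "frame_start (frame_start N) \<le> (N div L - k) * L - 1"
proof -
  define e where "e = frame_start N"
  obtain F where F: "N div W = Suc F"
    using N(2) W_pos by (cases "N div W") (auto simp: div_eq_0_iff)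
  have N_eq: "N = Suc F * W + N mod W"
    using div_mult_mod_eq[of N W] unfolding F by simp
  have N_mod: "N mod W < W" using W_pos by simp
  \<comment> \<open>State \<open>e\<close> is the last one before the flush; its index is one below
    a multiple of \<open>W\<close>.\<close>
  have e_eq: "e = F * W + (W - 1)" using N_eq W_pos by (simp add: e_def frame_start_def)
  have T: "k \<le> N div L" using N(2) W_eq L_pos by (simp add: less_eq_div_iff_mult_less_eq)
  have NT: "N = N div L * L + N mod L" by (simp only: div_mult_mod_eq)
  have TW: "N div L * L \<ge> W" using T W_eq by (metis mult_le_mono1)
  have r: "N mod L < L" using L_pos by simp
  have "(Suc (N div L) - k) * L = N div L * L + L - W"
    using W_eq by (simp add: diff_mult_distrib)
  then have m_eq: "m = N div L * L + L - W - 1" by (simp add: m_def)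
  show le1: "N - W \<le> m" using m_eq NT TW r by linarith
  show "m - (N - W) \<le> L" using m_eq NT TW r by linarith
  have "N < Suc (Suc F) * k * L" using N_eq N_mod W_eq by (simp add: algebra_simps)
  then have "N div L < Suc (Suc F) * k" using L_pos by (simp add: div_less_iff_less_mult)
  then have "Suc (N div L) - k \<le> Suc F * k" by simp
  then have "(Suc (N div L) - k) * L \<le> Suc F * k * L" by (rule mult_le_mono1)
  also have "\<dots> = Suc F * W" using W_eq by (metis mult.assoc)
  finally show le2: "m \<le> frame_start N" using e_eq by (simp add: m_def flip: e_def)
  have e_div: "e div W = F"
    by (rule div_nat_eqI) (use e_eq W_pos in \<open>simp_all add: mult.commute\<close>)
  have "N - W = F * W + N mod W" using N_eq by (metis add.commute add.left_commute add_diff_cancel_left' mult_Suc)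
  then have a_div: "(N - W) div W = F" using W_pos by simp
  show "(N - W) div W = frame_start N div W" using e_div a_div by (simp add: e_def)
  show "m div W = frame_start N div W"
    using div_le_mono[OF le1, of W] div_le_mono[OF le2, of W] e_div a_div by (simp add: e_def)
  have "e mod W = W - 1"
    using minus_div_mult_eq_mod[of e W] e_eq unfolding e_div by simp
  then have fe: "frame_start e = F * W - 1" using e_eq by (simp add: frame_start_def)
  have "Suc F * k * L \<le> N" using N_eq W_eq by (metis le_add1 mult.assoc)
  then have "Suc F * k \<le> N div L" using L_pos by (simp only: less_eq_div_iff_mult_less_eq)
  then have "F * k \<le> N div L - k" by simp
  then have "F * k * L \<le> (N div L - k) * L" by (rule mult_le_mono1)
  moreover have "F * k * L = F * W" using W_eq by (metis mult.assoc)
  ultimately show "frame_start (frame_start N) \<le> (N div L - k) * L - 1"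
    using fe by (simp add: diff_le_mono flip: e_def)
qed

text \<open>The window consists of the current frame and the part of the previous one that starts at
  \<open>N - W\<close>. The overflows before \<open>m\<close>, the end of the oldest block, may have been popped; their
  weight is at most \<open>u\<close>.\<close>

lemma window_bounds:
  fixes N :: nat
  defines "N \<equiv> length p"
  shows "query_at N x div u \<le> tracked N x"
    and "volume x (N - W) N \<le> u * (tracked N x + 2) + query_at N x mod u"
    and "u * (tracked N x + 2) + query_at N x mod u \<le> volume x (N - W) N + 4 * u"
proof -
  let ?T = "N div L"
  define e where "e = frame_start N"
  define q where "q = query_at N x"
  define m where "m = (Suc ?T - k) * L - 1"
  have tr: "overflow_count x m N \<le> tracked N x" "tracked N x \<le> overflow_count x (N - W) N"
    unfolding m_def using tracked_ge[of N] tracked_le[of N] by (auto simp: N_def)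
  have cur: "q - u \<le> volume x e N" "q div u = overflow_count x e N" "volume x e N \<le> q"
    using query_frame[of N x] by (auto simp: N_def q_def e_def)
  have q_eq: "q = u * (q div u) + q mod u" by simp
  have q_mod: "q mod u < u" using u_pos by simp
  have "q div u \<le> tracked N x \<and> volume x (N - W) N \<le> u * (tracked N x + 2) + q mod u \<and>
    u * (tracked N x + 2) + q mod u \<le> volume x (N - W) N + 4 * u"
  proof (cases "N < W")
    case True
    then have f0: "e = 0" by (simp add: e_def frame_start_def)
    \<comment> \<open>In a stream shorter than the window every block is still among the
      \<open>k\<close> youngest, so \<open>tracked\<close> is exact.\<close>
    have "?T < k" using True W_eq L_pos by (simp add: div_less_iff_less_mult)
    then have "m = 0" by (simp add: m_def)
    then have tr_eq: "tracked N x = q div u" using True tr cur f0 by simp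
    show ?thesis unfolding tr_eq distrib_left using q_eq cur True f0 by simp
  next
    case False
    then have N: "N \<le> length p" "W \<le> N" by (auto simp: N_def)
    note le = previous_frame[OF N, folded e_def m_def]
    have eN: "e \<le> N" "e \<le> length p" using frame_start_le[of N] by (auto simp: e_def N_def)
    define ae am a0 where "ae = query_at e x" and "am = query_at m x" and "a0 = query_at (N - W) x"
    have am: "ae div u = am div u + overflow_count x m e" "am + volume x m e \<le> ae"
      using query_same_frame[OF le(2) eN(2) le(5), of x] by (auto simp: ae_def am_def)
    have a0: "ae - u \<le> a0 - u + volume x (N - W) e"
      "ae div u = a0 div u + overflow_count x (N - W) e"
      using query_same_frame[OF order_trans[OF le(1,2)] eN(2) le(4), of x]
      by (auto simp: ae_def a0_def)
    have "volume x (N - W) m \<le> (m - (N - W)) * M"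
      using le eN by (intro volume_le) simp
    also have "\<dots> \<le> L * M" using le(3) by (rule mult_le_mono1)
    finally have v1: "volume x (N - W) m \<le> u" using u_eq by (simp add: mult.commute)
    have v: "volume x (N - W) N = volume x (N - W) m + volume x m e + volume x e N"
      "volume x (N - W) N = volume x (N - W) e + volume x e N"
      using volume_trans[of "N - W" m e x] volume_trans[of "N - W" e N x] le eN by auto
    have oc: "overflow_count x m N = overflow_count x m e + q div u"
      "overflow_count x (N - W) N = overflow_count x (N - W) e + q div u"
      using overflow_count_trans[of m e N x] overflow_count_trans[of "N - W" e N x] le eN cur(2)
      by auto
    have bounds: "u * (ae div u) \<le> ae" "ae < u * (ae div u) + u"
      "u * (am div u) \<le> am" "a0 < u * (a0 div u) + u"
      using dividend_less_times_div[OF u_pos, of ae] dividend_less_times_div[OF u_pos, of a0]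
      by (auto simp: add.commute)
    have m_e: "u * (ae div u) = u * (am div u) + u * overflow_count x m e"
      unfolding am(1) by (simp add: distrib_left)
    have a_e: "u * (ae div u) = u * (a0 div u) + u * overflow_count x (N - W) e"
      unfolding a0(2) by (simp add: distrib_left)
    \<comment> \<open>The overflows between \<open>m\<close> and \<open>e\<close> count the
      multiples of \<open>u\<close> that the estimate passed; they undercount its rise by less than
      \<open>u\<close>.\<close>
    have "volume x m e \<le> u * overflow_count x m e + u"
      using am(2) bounds m_e by linarith
    moreover have "u * overflow_count x m e + u * (q div u) \<le> u * tracked N x"
      using tr(1) unfolding oc(1) by (metis distrib_left mult_le_mono2)
    \<comment> \<open>Origin of the two additional units of a window query: one covers the positions
      before \<open>m\<close>, the other the rounding between \<open>m\<close> and
      \<open>e\<close>.\<close>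
    ultimately have lower: "volume x (N - W) N \<le> u * tracked N x + u * 2 + q mod u"
      using v(1) v1 cur(3) q_eq by linarith
    \<comment> \<open>Without overflows the claim is trivial. Otherwise \<open>ae\<close> is at
      least \<open>u\<close>, so the subtraction \<open>ae - u\<close> is not truncated.\<close>
    have "u * overflow_count x (N - W) e \<le> volume x (N - W) e + u"
    proof (cases "overflow_count x (N - W) e = 0")
      case False
      then have "u \<le> u * overflow_count x (N - W) e" by simp
      then have "u \<le> ae" using a_e bounds(1) by linarith
      then show ?thesis using a0(1) bounds a_e by linarith
    qed simp
    moreover have "u * tracked N x \<le> u * overflow_count x (N - W) e + u * (q div u)"
      using tr(2) unfolding oc(2) by (metis distrib_left mult_le_mono2)
    \<comment> \<open>Four units: two added by the query, one from excess and rounding in the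
      previous frame, one from the excess of \<open>q\<close> over the volume of the current
      frame.\<close>
    ultimately have upper: "u * tracked N x + u * 2 + q mod u \<le> volume x (N - W) N + 4 * u"
      using v(2) cur(1) q_eq by linarith
    have "q div u \<le> tracked N x" using tr(1) oc(1) by linarith
    then show ?thesis using lower upper unfolding distrib_left by blast
  qed
  then show "query_at N x div u \<le> tracked N x"
    "volume x (N - W) N \<le> u * (tracked N x + 2) + query_at N x mod u"
    "u * (tracked N x + 2) + query_at N x mod u \<le> volume x (N - W) N + 4 * u"
    by (auto simp: q_def)
qed

text \<open>An id missing from the table has no queued overflow, hence none in the current frame, so
  its estimate is below \<open>u\<close> and equals its remainder. Both branches of the query thus
  obey one formula.\<close>

lemma win_query_eq:
  "win_query W M \<epsilon> \<phi> (As (length p)) x =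
    u * (tracked (length p) x + 2) + query_at (length p) x mod u"
proof -
  have "overflows (As (length p)) x = count_map (tracked (length p)) x"
    by (rule fun_cong[OF conjunct2[OF state_eq[OF order_refl]]])
  moreover have "query_at (length p) x mod u = query_at (length p) x"
    if "tracked (length p) x = 0"
    using window_bounds(1)[of x] that u_pos by (simp add: div_eq_0_iff)
  ultimately show ?thesis by (cases "tracked (length p) x") (auto simp: win_query_def count_map_def)
qed

lemma reported_solves:
  "solves_heavy_hitters U W \<theta> \<epsilon> M p (reported W M \<epsilon> \<phi> U \<theta> (As (length p)))"
proof -
  have lower: "real (window_volume W p x) \<le> real (win_query W M \<epsilon> \<phi> (As (length p)) x)" for x
    unfolding window_volume_eq win_query_eq of_nat_le_iff by (rule window_bounds)
  have upper: "real (win_query W M \<epsilon> \<phi> (As (length p)) x) \<le>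
    real (window_volume W p x) + real W * real M * \<epsilon>" for x
  proof -
    have "win_query W M \<epsilon> \<phi> (As (length p)) x \<le> window_volume W p x + 4 * u"
      unfolding window_volume_eq win_query_eq by (rule window_bounds)
    then have "real (win_query W M \<epsilon> \<phi> (As (length p)) x) \<le> real (window_volume W p x + 4 * u)"
      by (simp only: of_nat_le_iff)
    also have "\<dots> = real (window_volume W p x) + 4 * real u" by simp
    finally show ?thesis using four_u_le by linarith
  qed
  show ?thesis
    unfolding solves_heavy_hitters_def reported_def
  proof (intro conjI ballI impI)
    fix x assume "x \<in> U" and "real W * real M * \<theta> < real (window_volume W p x)"
    then show "x \<in> {x \<in> U. real M * real W * \<theta> \<le> real (win_query W M \<epsilon> \<phi> (As (length p)) x)}"
      using lower[of x] by (simp add: mult.commute mult.left_commute)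
  next
    fix x assume "x \<in> U" and *: "real (window_volume W p x) < real W * real M * (\<theta> - \<epsilon>)"
    have "real W * real M * (\<theta> - \<epsilon>) = real M * real W * \<theta> - real W * real M * \<epsilon>"
      by (simp add: algebra_simps)
    then have "real (win_query W M \<epsilon> \<phi> (As (length p)) x) < real M * real W * \<theta>"
      using upper[of x] * by linarith
    then show "x \<notin> {x \<in> U. real M * real W * \<theta> \<le> real (win_query W M \<epsilon> \<phi> (As (length p)) x)}"
      by simp
  qed auto
qed

lemma set_queues_subset: "set (concat (queues (As (length p)))) \<subseteq> U"
proof -
  have "set (block_queue i (length p)) \<subseteq> U" for i
    using id_in by (auto simp: block_queue_def set_block_overflows)
  then show ?thesis
    using state_eq[of "length p"] set_drop_subset[of _ "block_queue k (length p)"] by fastforce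
qed

text \<open>Without a queued id the answer consists of the two additional units and a remainder
  below \<open>u\<close>, too little for a threshold with
  \<open>\<epsilon> \<le> \<theta>\<close>.\<close>

lemma reported_subset_queues:
  assumes \<theta>: "\<epsilon> \<le> \<theta>"
  shows "reported W M \<epsilon> \<phi> U \<theta> (As (length p)) \<subseteq> set (concat (queues (As (length p))))"
proof
  fix x assume x: "x \<in> reported W M \<epsilon> \<phi> U \<theta> (As (length p))"
  show "x \<in> set (concat (queues (As (length p))))"
  proof (rule ccontr)
    assume "x \<notin> set (concat (queues (As (length p))))"
    then have "tracked (length p) x = 0" by (simp add: count_list_0_iff)
    moreover have "query_at (length p) x mod u < u" using u_pos by simp
    ultimately have "win_query W M \<epsilon> \<phi> (As (length p)) x < 4 * u"
      unfolding win_query_eq by simp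
    then have "real (win_query W M \<epsilon> \<phi> (As (length p)) x) < real (4 * u)"
      by (simp only: of_nat_less_iff)
    also have "\<dots> = 4 * real u" by simp
    also have "\<dots> \<le> real W * real M * \<epsilon>" by (rule four_u_le)
    also have "\<dots> \<le> real W * real M * \<theta>" using \<theta> by (intro mult_left_mono) auto
    finally show False using x by (simp add: reported_def mult.commute mult.left_commute)
  qed
qed

text \<open>Even with the popped ids of the oldest block counted again, the queues stem from the
  current and the previous frame, and each frame contributes at most
  \<open>k * (1 + \<phi> / 2)\<close> overflows.\<close>

lemma length_queues_le:
  "real (length (concat (queues (As (length p))))) \<le> real k * (2 + \<phi>)"
proof -
  define N where "N = length p"
  let ?T = "N div L"
  define e where "e = frame_start N"
  let ?S = "{j. (j < N \<and> overflow j) \<and> Suc j div L \<le> ?T \<and> ?T < Suc j div L + Suc k}"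
  have fin: "finite {j. j < N \<and> overflow j}" by simp
  have "length (concat (map (\<lambda>i. block_queue i N) [0..<n])) = (\<Sum>i<n. length (block_queue i N))" for n
    by (induction n) auto
  then have "length (concat (queues (As N))) \<le> (\<Sum>i<Suc k. length (block_queue i N))"
    using state_eq[of N] by (simp add: N_def)
  also have "length (block_queue i N) = card {j. (j < N \<and> overflow j) \<and> Suc j div L + i = ?T}" for i
    unfolding block_queue_def length_map distinct_card[OF distinct_block_overflows, symmetric]
      set_block_overflows ..
  then have "(\<Sum>i<Suc k. length (block_queue i N)) = card ?S"
    by (simp only: card_diagonal_sum[OF fin])
  also have "card ?S \<le> card ({j \<in> {frame_start e..<e}. overflow j} \<union> {j \<in> {e..<N}. overflow j})"
  proof (rule card_mono)
    show "?S \<subseteq> {j \<in> {frame_start e..<e}. overflow j} \<union> {j \<in> {e..<N}. overflow j}"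
    proof
      fix j assume j: "j \<in> ?S"
      have "frame_start e \<le> j"
      proof (cases "N < W")
        case True
        then show ?thesis by (simp add: e_def frame_start_def)
      next
        case False
        have "?T - k \<le> Suc j div L" using j by auto
        then have "(?T - k) * L \<le> Suc j" using L_pos by (simp only: less_eq_div_iff_mult_less_eq)
        moreover have "frame_start e \<le> (?T - k) * L - 1"
          using previous_frame(6)[of N] False by (simp add: N_def e_def)
        ultimately show ?thesis by linarith
      qed
      then show "j \<in> {j \<in> {frame_start e..<e}. overflow j} \<union> {j \<in> {e..<N}. overflow j}"
        using j by auto
    qed
  qed auto
  also have "\<dots> \<le> card {j \<in> {frame_start e..<e}. overflow j} + card {j \<in> {e..<N}. overflow j}"
    by (rule card_Un_le)
  finally have "real (length (concat (queues (As N)))) \<le>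
    real (card {j \<in> {frame_start e..<e}. overflow j}) + real (card {j \<in> {e..<N}. overflow j})"
    by linarith
  moreover have "e \<le> length p" using frame_start_le[of N] by (simp add: e_def N_def)
  then have "real (card {j \<in> {frame_start e..<e}. overflow j}) \<le> real k * (1 + \<phi> / 2)"
    by (rule card_overflows_frame_le)
  moreover have "real (card {j \<in> {e..<N}. overflow j}) \<le> real k * (1 + \<phi> / 2)"
    unfolding e_def by (rule card_overflows_frame_le) (simp add: N_def)
  moreover have "real k * (1 + \<phi> / 2) + real k * (1 + \<phi> / 2) = real k * (2 + \<phi>)"
    by (simp add: algebra_simps)
  ultimately show ?thesis unfolding N_def[symmetric] by linarith
qed

end

lemma wfast_run_states:
  assumes "wfast_run W M \<epsilon> \<phi> p A"
  shows "\<exists>As. As 0 = wfast_init \<epsilon> \<and> As (length p) = A \<and>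
    (\<forall>t<length p. wfast_add W M \<epsilon> \<phi> (fst (p ! t)) (snd (p ! t)) (As t) (As (Suc t)))"
  using assms
proof induction
  case 1
  then show ?case by auto
next
  case (2 p A x w A')
  then obtain As where "As 0 = wfast_init \<epsilon>" "As (length p) = A"
    "\<forall>t<length p. wfast_add W M \<epsilon> \<phi> (fst (p ! t)) (snd (p ! t)) (As t) (As (Suc t))" by blast
  then show ?case using 2(2)
    by (intro exI[of _ "As(Suc (length p) := A')"]) (auto simp: nth_append less_Suc_eq)
qed

context wfast_params
begin

lemma wfast_run_trace:
  assumes "weighted_stream U M p" "wfast_run W M \<epsilon> \<phi> p A"
  obtains As where "wfast_trace W M \<epsilon> \<phi> U p As" "As (length p) = A"
proof -
  obtain As where "As 0 = wfast_init \<epsilon>" "As (length p) = A"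
    "\<forall>t<length p. wfast_add W M \<epsilon> \<phi> (fst (p ! t)) (snd (p ! t)) (As t) (As (Suc t))"
    using wfast_run_states[OF assms(2)] by blast
  then show ?thesis using that[of As] assms(1)
    by (simp add: wfast_trace_def wfast_trace_axioms_def wfast_params_axioms)
qed

lemma wfast_run_solves:
  assumes "weighted_stream U M p" "wfast_run W M \<epsilon> \<phi> p A"
  shows "solves_heavy_hitters U W \<theta> \<epsilon> M p (reported W M \<epsilon> \<phi> U \<theta> A)"
  using wfast_run_trace[OF assms] wfast_trace.reported_solves by metis

lemma wfast_run_queues:
  assumes "weighted_stream U M p" "wfast_run W M \<epsilon> \<phi> p A"
  shows "set (concat (queues A)) \<subseteq> U"
    and "\<epsilon> \<le> \<theta> \<Longrightarrow> reported W M \<epsilon> \<phi> U \<theta> A \<subseteq> set (concat (queues A))"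
    and "real (length (concat (queues A))) \<le> real k * (2 + \<phi>)"
proof -
  obtain As where As: "wfast_trace W M \<epsilon> \<phi> U p As" "As (length p) = A"
    using wfast_run_trace[OF assms] .
  show "set (concat (queues A)) \<subseteq> U"
    "\<epsilon> \<le> \<theta> \<Longrightarrow> reported W M \<epsilon> \<phi> U \<theta> A \<subseteq> set (concat (queues A))"
    "real (length (concat (queues A))) \<le> real k * (2 + \<phi>)"
    using wfast_trace.set_queues_subset[OF As(1)] wfast_trace.reported_subset_queues[OF As(1)]
      wfast_trace.length_queues_le[OF As(1)] unfolding As(2) by auto
qed

end

section \<open>The linked lists\<close>

text \<open>The \<open>first\<close> items of the groups in \<open>A\<close> head doubly linked lists of the items in \<open>V\<close>. The rank
  decreases along these lists; it rules out cycles, so that a group with items has a first one.\<close>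

definition dll ::
    "'a set \<Rightarrow> nat set \<Rightarrow> ('a \<Rightarrow> 'a option) \<Rightarrow> ('a \<Rightarrow> 'a option) \<Rightarrow> ('a \<Rightarrow> nat) \<Rightarrow>
     (nat \<Rightarrow> 'a option) \<Rightarrow> ('a \<Rightarrow> nat) \<Rightarrow> bool" where
  "dll V A prv nxt grp first rk \<longleftrightarrow>
     finite V \<and> (\<forall>x\<in>V. grp x \<in> A) \<and>
     (\<forall>x\<in>V. prv x = None \<longrightarrow> first (grp x) = Some x) \<and>
     (\<forall>x\<in>V. \<forall>y. prv x = Some y \<longrightarrow> y \<in> V \<and> nxt y = Some x \<and> grp y = grp x \<and> rk x < rk y) \<and>
     (\<forall>x\<in>V. \<forall>y. nxt x = Some y \<longrightarrow> y \<in> V \<and> prv y = Some x) \<and>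
     (\<forall>a\<in>A. \<forall>x. first a = Some x \<longrightarrow> x \<in> V \<and> grp x = a \<and> prv x = None)"

lemma dllD:
  assumes "dll V A prv nxt grp first rk"
  shows "finite V"
    and "x \<in> V \<Longrightarrow> grp x \<in> A"
    and "x \<in> V \<Longrightarrow> prv x = None \<Longrightarrow> first (grp x) = Some x"
    and "x \<in> V \<Longrightarrow> prv x = Some y \<Longrightarrow> y \<in> V \<and> nxt y = Some x \<and> grp y = grp x \<and> rk x < rk y"
    and "x \<in> V \<Longrightarrow> nxt x = Some y \<Longrightarrow> y \<in> V \<and> prv y = Some x"
    and "a \<in> A \<Longrightarrow> first a = Some x \<Longrightarrow> x \<in> V \<and> grp x = a \<and> prv x = None"
  using assms unfolding dll_def by blast+

text \<open>The item of largest rank in the group has no predecessor, as that would rank higher;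
  hence it is the first item.\<close>

lemma dll_first_neq_None:
  assumes dll: "dll V A prv nxt grp first rk" and x: "x \<in> V"
  shows "first (grp x) \<noteq> None"
proof -
  have "finite (rk ` {y \<in> V. grp y = grp x})" "rk x \<in> rk ` {y \<in> V. grp y = grp x}"
    using dllD(1)[OF dll] x by auto
  then have "Max (rk ` {y \<in> V. grp y = grp x}) \<in> rk ` {y \<in> V. grp y = grp x}"
    by (intro Max_in) auto
  then obtain y where y: "y \<in> V" "grp y = grp x" "rk y = Max (rk ` {y \<in> V. grp y = grp x})"
    by auto
  have "prv y = None"
  proof (rule ccontr)
    assume "prv y \<noteq> None"
    then obtain z where "z \<in> V" "grp z = grp x" "rk y < rk z"
      using dllD(4)[OF dll y(1)] y by auto
    moreover from this have "rk z \<le> rk y"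
      using \<open>finite _\<close> unfolding y(3) by (intro Max_ge) auto
    ultimately show False by simp
  qed
  then show ?thesis using dllD(3)[OF dll y(1)] y by simp
qed

lemma dll_remove:
  assumes dll: "dll V A prv nxt grp first rk" and x: "x \<in> V"
  shows "dll (V - {x}) A
    (\<lambda>z. if nxt x = Some z then prv x else prv z)
    (\<lambda>z. if prv x = Some z then nxt x else nxt z) grp
    (\<lambda>a. if prv x = None \<and> a = grp x then nxt x else first a) rk"
    (is "dll _ _ ?prv ?nxt _ ?first _")
proof -
  note D = dllD[OF dll]
  have nx: "z \<in> V \<and> prv z = Some x \<and> grp z = grp x \<and> rk z < rk x" if "nxt x = Some z" for z
    using D(5)[OF x that] D(4)[of z x] by auto
  note px = D(4)[OF x]
  show ?thesis
    unfolding dll_def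
  proof (intro conjI ballI allI impI)
    show "finite (V - {x})" using D(1) by simp
  next
    fix z assume "z \<in> V - {x}"
    then have z: "z \<in> V" "z \<noteq> x" by auto
    show "grp z \<in> A" by (rule D(2)[OF z(1)])
    show "?first (grp z) = Some z" if "?prv z = None"
    proof (cases "nxt x = Some z")
      case True
      then show ?thesis using that nx[of z] by simp
    next
      case False
      then have "first (grp z) = Some z" using that D(3)[OF z(1)] by simp
      then show ?thesis using D(3)[OF x] z(2) by auto
    qed
    show "y \<in> V - {x}" "?nxt y = Some z" "grp y = grp z" "rk z < rk y" if "?prv z = Some y" for y
    proof -
      have "y \<in> V - {x} \<and> ?nxt y = Some z \<and> grp y = grp z \<and> rk z < rk y"
      proof (cases "nxt x = Some z")
        case True
        then show ?thesis using that nx[of z] px[of y] by auto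
      next
        case False
        then have "prv z = Some y" using that by simp
        then have y: "y \<in> V \<and> nxt y = Some z \<and> grp y = grp z \<and> rk z < rk y" by (rule D(4)[OF z(1)])
        moreover have "y \<noteq> x" using False y by auto
        moreover have "prv x \<noteq> Some y" using px[of y] y z(2) by auto
        ultimately show ?thesis by simp
      qed
      then show "y \<in> V - {x}" "?nxt y = Some z" "grp y = grp z" "rk z < rk y" by auto
    qed
    show "y \<in> V - {x}" "?prv y = Some z" if "?nxt z = Some y" for y
    proof -
      have "y \<in> V - {x} \<and> ?prv y = Some z"
      proof (cases "prv x = Some z")
        case True
        then show ?thesis using that nx[of y] by auto
      next
        case False
        then have y: "y \<in> V \<and> prv y = Some z" using that D(5)[OF z(1)] by simp
        moreover have "y \<noteq> x" using False y by auto
        moreover have "nxt x \<noteq> Some y" using nx[of y] y z(2) by auto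
        ultimately show ?thesis by simp
      qed
      then show "y \<in> V - {x}" "?prv y = Some z" by auto
    qed
  next
    fix a z assume a: "a \<in> A" "?first a = Some z"
    have "z \<in> V - {x} \<and> grp z = a \<and> ?prv z = None"
    proof (cases "prv x = None \<and> a = grp x")
      case True
      then show ?thesis using a nx[of z] by auto
    next
      case False
      then have z: "z \<in> V \<and> grp z = a \<and> prv z = None" using a D(6)[of a z] by metis
      moreover have "z \<noteq> x" using False z by auto
      moreover have "nxt x \<noteq> Some z" using nx[of z] z by auto
      ultimately show ?thesis by simp
    qed
    then show "z \<in> V - {x}" "grp z = a" "?prv z = None" by auto
  qed
qed

lemma dll_insert:
  assumes dll: "dll V A prv nxt grp first rk" and x: "x \<notin> V" and a: "a \<in> A"
  shows "\<exists>rk'. dll (insert x V) A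
    (\<lambda>z. if z = x then None else if first a = Some z then Some x else prv z)
    (nxt(x := first a)) (grp(x := a)) (first(a := Some x)) rk'"
proof
  note D = dllD[OF dll]
  let ?prv = "\<lambda>z. if z = x then None else if first a = Some z then Some x else prv z"
  let ?nxt = "nxt(x := first a)" and ?grp = "grp(x := a)" and ?first = "first(a := Some x)"
  \<comment> \<open>Insertion is at the front, so the new item must outrank all others.\<close>
  let ?rk = "rk(x := Suc (Max (rk ` V)))"
  have lt: "rk z < Suc (Max (rk ` V))" if "z \<in> V" for z
    using that D(1) by (simp add: less_Suc_eq_le)
  note fa = D(6)[OF a]
  show "dll (insert x V) A ?prv ?nxt ?grp ?first ?rk"
    unfolding dll_def
  proof (intro conjI ballI allI impI)
    show "finite (insert x V)" using D(1) by simp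
  next
    fix z assume z: "z \<in> insert x V"
    show "?grp z \<in> A" using z a D(2) by auto
    show "?first (?grp z) = Some z" if "?prv z = None"
      using z that fa D(3)[of z] by (auto split: if_splits)
    show "y \<in> insert x V" "?nxt y = Some z" "?grp y = ?grp z" "?rk z < ?rk y"
      if y: "?prv z = Some y" for y
    proof -
      have zx: "z \<noteq> x" "z \<in> V" using y z by auto
      have "y \<in> insert x V \<and> ?nxt y = Some z \<and> ?grp y = ?grp z \<and> ?rk z < ?rk y"
      proof (cases "first a = Some z")
        case True
        then show ?thesis using y zx fa[of z] lt by auto
      next
        case False
        then show ?thesis using y zx x D(4)[of z y] by auto
      qed
      then show "y \<in> insert x V" "?nxt y = Some z" "?grp y = ?grp z" "?rk z < ?rk y" by auto
    qed
    show "y \<in> insert x V" "?prv y = Some z" if y: "?nxt z = Some y" for y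
    proof -
      have "y \<in> insert x V \<and> ?prv y = Some z"
      proof (cases "z = x")
        case True
        then show ?thesis using y fa[of y] x by auto
      next
        case False
        then have "y \<in> V \<and> prv y = Some z" using y z D(5)[of z y] by simp
        then show ?thesis using x fa[of y] by auto
      qed
      then show "y \<in> insert x V" "?prv y = Some z" by auto
    qed
  next
    fix b z assume b: "b \<in> A" "?first b = Some z"
    have "z \<in> insert x V \<and> ?grp z = b \<and> ?prv z = None"
      using b x a fa D(6)[of b z] by (auto split: if_splits)
    then show "z \<in> insert x V" "?grp z = b" "?prv z = None" by auto
  qed
qed

lemma dllI:
  assumes "finite V"
    and "\<And>x. x \<in> V \<Longrightarrow> grp x \<in> A"
    and "\<And>x. x \<in> V \<Longrightarrow> prv x = None \<Longrightarrow> first (grp x) = Some x"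
    and "\<And>x y. x \<in> V \<Longrightarrow> prv x = Some y \<Longrightarrow> y \<in> V \<and> nxt y = Some x \<and> grp y = grp x \<and> rk x < rk y"
    and "\<And>x y. x \<in> V \<Longrightarrow> nxt x = Some y \<Longrightarrow> y \<in> V \<and> prv y = Some x"
    and "\<And>a x. a \<in> A \<Longrightarrow> first a = Some x \<Longrightarrow> x \<in> V \<and> grp x = a \<and> prv x = None"
  shows "dll V A prv nxt grp first rk"
  unfolding dll_def using assms by blast

lemma dll_insert_group:
  assumes "dll V A prv nxt grp first rk" "first a = None"
  shows "dll V (insert a A) prv nxt grp first rk"
proof (rule dllI)
  note D = dllD[OF assms(1)]
  fix b x assume "b \<in> insert a A" "first b = Some x"
  then show "x \<in> V \<and> grp x = b \<and> prv x = None" using D(6)[of b x] assms(2) by auto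
qed (use dllD[OF assms(1)] in blast)+

text \<open>A group without a first item has no items at all, so no node refers to the removed
  address.\<close>

lemma dll_remove_group:
  assumes "dll V A prv nxt grp first rk" "first a = None"
  shows "dll V (A - {a}) prv nxt grp first rk"
proof (rule dllI)
  fix x assume "x \<in> V"
  then show "grp x \<in> A - {a}"
    using dll_first_neq_None[OF assms(1), of x] dllD(2)[OF assms(1), of x] assms(2) by auto
qed (use dllD[OF assms(1)] in blast)+

text \<open>Only the links on \<open>V\<close> and \<open>A\<close> matter; elsewhere the memory may
  hold garbage.\<close>

lemma dll_cong:
  assumes dll: "dll V A prv nxt grp first rk"
    and eq: "\<And>x. x \<in> V \<Longrightarrow> prv' x = prv x \<and> nxt' x = nxt x \<and> grp' x = grp x"
    and eq': "\<And>a. a \<in> A \<Longrightarrow> first' a = first a"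
  shows "dll V A prv' nxt' grp' first' rk"
proof (rule dllI)
  note D = dllD[OF dll]
  show "finite V" by (rule D(1))
  show "grp' x \<in> A" if "x \<in> V" for x using D(2) eq that by simp
  show "first' (grp' x) = Some x" if "x \<in> V" "prv' x = None" for x
    using D(2,3)[of x] eq[of x] eq' that by simp
  show "y \<in> V \<and> nxt' y = Some x \<and> grp' y = grp' x \<and> rk x < rk y" if "x \<in> V" "prv' x = Some y" for x y
    using D(4)[of x y] eq[of x] eq[of y] that by simp
  show "y \<in> V \<and> prv' y = Some x" if "x \<in> V" "nxt' x = Some y" for x y
    using D(5)[of x y] eq[of x] eq[of y] that by simp
  show "x \<in> V \<and> grp' x = a \<and> prv' x = None" if "a \<in> A" "first' a = Some x" for a x
    using D(6)[of a x] eq[of x] eq'[of a] that by simp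
qed

text \<open>Links between groups are specified through their values: the next group is the one with the
  next larger value.\<close>

definition glist ::
    "nat set \<Rightarrow> (nat \<Rightarrow> nat) \<Rightarrow> (nat \<Rightarrow> nat) \<Rightarrow> (nat \<Rightarrow> nat option) \<Rightarrow> bool" where
  "glist A val prv nxt \<longleftrightarrow>
     0 \<in> A \<and> val 0 = 0 \<and> inj_on val A \<and>
     (\<forall>a\<in>A. nxt a = None \<longrightarrow> (\<forall>c\<in>A. val c \<le> val a)) \<and>
     (\<forall>a\<in>A. \<forall>b. nxt a = Some b \<longrightarrow>
        b \<in> A \<and> val a < val b \<and> prv b = a \<and> (\<forall>c\<in>A. val c \<le> val a \<or> val b \<le> val c)) \<and>
     (\<forall>a\<in>A. a \<noteq> 0 \<longrightarrow> prv a \<in> A \<and> nxt (prv a) = Some a)"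

lemma glistD:
  assumes "glist A val prv nxt"
  shows "0 \<in> A" "val 0 = 0"
    and "a \<in> A \<Longrightarrow> b \<in> A \<Longrightarrow> val a = val b \<Longrightarrow> a = b"
    and "a \<in> A \<Longrightarrow> nxt a = None \<Longrightarrow> c \<in> A \<Longrightarrow> val c \<le> val a"
    and "a \<in> A \<Longrightarrow> nxt a = Some b \<Longrightarrow> b \<in> A \<and> val a < val b \<and> prv b = a"
    and "a \<in> A \<Longrightarrow> nxt a = Some b \<Longrightarrow> c \<in> A \<Longrightarrow> val c \<le> val a \<or> val b \<le> val c"
    and "a \<in> A \<Longrightarrow> a \<noteq> 0 \<Longrightarrow> prv a \<in> A \<and> nxt (prv a) = Some a"
  using assms unfolding glist_def inj_on_def by blast+

lemma glistI:
  assumes "0 \<in> A" "val 0 = 0"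
    and "\<And>a b. a \<in> A \<Longrightarrow> b \<in> A \<Longrightarrow> val a = val b \<Longrightarrow> a = b"
    and "\<And>a c. a \<in> A \<Longrightarrow> nxt a = None \<Longrightarrow> c \<in> A \<Longrightarrow> val c \<le> val a"
    and "\<And>a b. a \<in> A \<Longrightarrow> nxt a = Some b \<Longrightarrow> b \<in> A \<and> val a < val b \<and> prv b = a"
    and "\<And>a b c. a \<in> A \<Longrightarrow> nxt a = Some b \<Longrightarrow> c \<in> A \<Longrightarrow> val c \<le> val a \<or> val b \<le> val c"
    and "\<And>a. a \<in> A \<Longrightarrow> a \<noteq> 0 \<Longrightarrow> prv a \<in> A \<and> nxt (prv a) = Some a"
  shows "glist A val prv nxt"
  unfolding glist_def inj_on_def using assms by blast

lemma glist_cong: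
  assumes gl: "glist A val prv nxt"
    and eq: "\<And>a. a \<in> A \<Longrightarrow> val' a = val a \<and> nxt' a = nxt a \<and> (a \<noteq> 0 \<longrightarrow> prv' a = prv a)"
  shows "glist A val' prv' nxt'"
proof (rule glistI)
  note D = glistD[OF gl]
  show "0 \<in> A" by (rule D(1))
  then show "val' 0 = 0" using D(2) eq by simp
  show "a = b" if "a \<in> A" "b \<in> A" "val' a = val' b" for a b
    using D(3)[of a b] eq that by simp
  show "val' c \<le> val' a" if "a \<in> A" "nxt' a = None" "c \<in> A" for a c
    using D(4)[of a c] eq that by simp
  show "b \<in> A \<and> val' a < val' b \<and> prv' b = a" if "a \<in> A" "nxt' a = Some b" for a b
  proof -
    have "b \<in> A \<and> val a < val b \<and> prv b = a" using D(5)[of a b] eq[of a] that by simp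
    \<comment> \<open>The back link of address \<open>0\<close> is unspecified, so the successor
      must be another group; its positive value shows this.\<close>
    moreover from this have "b \<noteq> 0" using D(2) by (metis not_less_zero)
    ultimately show ?thesis using eq[of a] eq[of b] that by simp
  qed
  show "val' c \<le> val' a \<or> val' b \<le> val' c" if "a \<in> A" "nxt' a = Some b" "c \<in> A" for a b c
    using D(5,6)[of a b] eq that by simp
  show "prv' a \<in> A \<and> nxt' (prv' a) = Some a" if "a \<in> A" "a \<noteq> 0" for a
    using D(7)[of a] eq that by simp
qed

text \<open>By \<open>c\<close> no value lies above that of \<open>a\<close> and up to
  \<open>c\<close>, so the new group fits directly behind \<open>a\<close>.\<close>

lemma glist_insert:
  assumes gl: "glist A val prv nxt" and q: "q \<notin> A" and a: "a \<in> A" "val a < c"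
    and c: "\<And>b. b \<in> A \<Longrightarrow> val b \<le> val a \<or> c < val b"
  shows "glist (insert q A) (val(q := c))
    (\<lambda>z. if z = q then a else if nxt a = Some z then q else prv z) (nxt(q := nxt a, a := Some q))"
    (is "glist _ ?val ?prv ?nxt")
proof (rule glistI)
  note D = glistD[OF gl]
  have qa: "q \<noteq> a" "q \<noteq> 0" using q a D(1) by metis+
  have ne: "val b \<noteq> c" if "b \<in> A" for b using c[OF that] a by auto
  have val: "?val b = val b" if "b \<in> A" for b using that q by auto
  show "0 \<in> insert q A" "?val 0 = 0" using D(1,2) qa by auto
  show "b = d" if "b \<in> insert q A" "d \<in> insert q A" "?val b = ?val d" for b d
  proof -
    have "b = q \<longleftrightarrow> d = q" using that ne[of b] ne[of d] by (auto split: if_splits)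
    then show ?thesis using that D(3)[of b d] by (cases "d = q") simp_all
  qed
  show "?val d \<le> ?val b" if b: "b \<in> insert q A" "?nxt b = None" and d: "d \<in> insert q A" for b d
  proof (cases "b = q")
    case True
    then have "nxt a = None" using b qa by simp
    then have "val d \<le> val a" if "d \<in> A" using D(4)[of a d] a that by simp
    then show ?thesis using True a d q by auto
  next
    case False
    then have bA: "b \<in> A" "b \<noteq> a" "nxt b = None" using b by (auto split: if_splits)
    then have "val a \<le> val b" "val b \<noteq> val a" using D(4)[of b a] D(3)[of a b] a by auto
    then have "c < val b" using c[OF bA(1)] by simp
    then show ?thesis using D(4)[of b d] bA d q False by auto
  qed
  have cases: "(b = a \<and> d = q) \<or> (b = q \<and> nxt a = Some d) \<or> (b \<in> A \<and> b \<noteq> a \<and> b \<noteq> q \<and> nxt b = Some d)"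
    if "b \<in> insert q A" "?nxt b = Some d" for b d
    using that q a by (auto split: if_splits)
  have na: "d \<in> A \<and> c < val d" if "nxt a = Some d" for d
    using D(5)[of a d] c[of d] a that by auto
  show "d \<in> insert q A \<and> ?val b < ?val d \<and> ?prv d = b"
    if bd: "b \<in> insert q A" "?nxt b = Some d" for b d
    using cases[OF bd]
  proof (elim disjE conjE)
    assume "b = a" "d = q"
    then show ?thesis using a qa by simp
  next
    assume "b = q" "nxt a = Some d"
    then show ?thesis using na[of d] q by auto
  next
    assume b: "b \<in> A" "b \<noteq> a" "b \<noteq> q" "nxt b = Some d"
    then have d: "d \<in> A \<and> val b < val d \<and> prv d = b" using D(5) by blast
    moreover have "nxt a \<noteq> Some d" using D(5)[of a d] a d b by auto
    ultimately show ?thesis using q b by auto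
  qed
  show "?val f \<le> ?val b \<or> ?val d \<le> ?val f"
    if bd: "b \<in> insert q A" "?nxt b = Some d" and f: "f \<in> insert q A" for b d f
    using cases[OF bd]
  proof (elim disjE conjE)
    assume "b = a" "d = q"
    then show ?thesis using c[of f] f q qa by auto
  next
    assume "b = q" "nxt a = Some d"
    then show ?thesis using na[of d] D(6)[of a d f] a f q by auto
  next
    assume b: "b \<in> A" "b \<noteq> a" "b \<noteq> q" "nxt b = Some d"
    then have d: "d \<in> A" "val b < val d" using D(5) by blast+
    have "val b \<noteq> val a" using D(3)[of b a] a b by auto
    then have "c < val b \<or> val d \<le> val a" using c[OF b(1)] D(6)[OF b(1,4) a(1)] by linarith
    then show ?thesis using D(6)[OF b(1,4), of f] d b f a q by auto
  qed
  show "?prv b \<in> insert q A \<and> ?nxt (?prv b) = Some b" if b: "b \<in> insert q A" "b \<noteq> 0" for b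
  proof -
    have "?prv b \<noteq> q \<and> ?prv b \<noteq> a" if "b \<noteq> q" "nxt a \<noteq> Some b"
      using that b D(7)[of b] q by auto
    then show ?thesis using b D(7)[of b] a qa by auto
  qed
qed

lemma glist_remove:
  assumes gl: "glist A val prv nxt" and a: "a \<in> A" "a \<noteq> 0"
  shows "glist (A - {a}) val (\<lambda>z. if nxt a = Some z then prv a else prv z) (nxt(prv a := nxt a))"
    (is "glist _ _ ?prv ?nxt")
proof (rule glistI)
  note D = glistD[OF gl]
  have pa: "prv a \<in> A" "nxt (prv a) = Some a" using D(7)[OF a] by auto
  then have va: "val (prv a) < val a" using D(5) by blast
  show "0 \<in> A - {a}" "val 0 = 0" using D(1,2) a by auto
  show "b = d" if "b \<in> A - {a}" "d \<in> A - {a}" "val b = val d" for b d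
    using that D(3) by simp
  \<comment> \<open>No value lies strictly between those of \<open>prv a\<close> and
    \<open>a\<close>, so \<open>prv a\<close> can take over the successor of
    \<open>a\<close>.\<close>
  have between: "val b \<le> val (prv a)" if "b \<in> A - {a}" "val b \<le> val a" for b
    using D(6)[OF pa, of b] D(3)[of a b] a that by auto
  show "val d \<le> val b" if b: "b \<in> A - {a}" "?nxt b = None" and d: "d \<in> A - {a}" for b d
  proof (cases "b = prv a")
    case True
    then have "val d \<le> val a" using b d a D(4)[of a d] by simp
    then show ?thesis using between[OF d] True by simp
  next
    case False
    then show ?thesis using D(4)[of b d] b d by simp
  qed
  have cases: "(b = prv a \<and> nxt a = Some d) \<or> (b \<noteq> prv a \<and> b \<in> A \<and> nxt b = Some d)"
    if "b \<in> A - {a}" "?nxt b = Some d" for b d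
    using that by (auto split: if_splits)
  show "d \<in> A - {a} \<and> val b < val d \<and> ?prv d = b" if bd: "b \<in> A - {a}" "?nxt b = Some d" for b d
    using cases[OF bd]
  proof (elim disjE conjE)
    assume "b = prv a" "nxt a = Some d"
    then show ?thesis using D(5)[of a d] a va by auto
  next
    assume b: "b \<noteq> prv a" "b \<in> A" "nxt b = Some d"
    then have "d \<in> A \<and> val b < val d \<and> prv d = b" using D(5) by blast
    moreover have "nxt a \<noteq> Some d" using D(5)[of a d] a(1) bd \<open>_ \<and> _ \<and> prv d = b\<close> by auto
    ultimately show ?thesis using b by auto
  qed
  show "val f \<le> val b \<or> val d \<le> val f"
    if bd: "b \<in> A - {a}" "?nxt b = Some d" and f: "f \<in> A - {a}" for b d f
    using cases[OF bd]
  proof (elim disjE conjE)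
    assume "b = prv a" "nxt a = Some d"
    then show ?thesis using D(6)[of a d f] between[OF f] f a(1) by auto
  next
    assume "b \<noteq> prv a" "b \<in> A" "nxt b = Some d"
    then show ?thesis using D(6)[of b d f] f by auto
  qed
  show "?prv b \<in> A - {a} \<and> ?nxt (?prv b) = Some b" if b: "b \<in> A - {a}" "b \<noteq> 0" for b
  proof (cases "nxt a = Some b")
    case True
    then show ?thesis using pa va by auto
  next
    case False
    then show ?thesis using D(7)[of b] b pa by auto
  qed
qed

section \<open>Simulation of FAST\<close>

text \<open>Programs are deterministic and total, so the weakest precondition is evaluated by
  running them; the postcondition also sees the step counter.\<close>

definition wp :: "('a, 'v) prog \<Rightarrow> ('v \<Rightarrow> 'a mem \<Rightarrow> nat \<Rightarrow> bool) \<Rightarrow> 'a mem \<Rightarrow> nat \<Rightarrow> bool" where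
  "wp P Q m t = (case run_state P (m, t) of (r, m', t') \<Rightarrow> Q r m' t')"

lemma wp_bind: "wp (State_Monad.bind P f) Q m t = wp P (\<lambda>r. wp (f r) Q) m t"
  by (simp add: wp_def State_Monad.bind_def split: prod.splits)

lemma wp_return: "wp (State_Monad.return v) Q m t = Q v m t"
  by (simp add: wp_def State_Monad.return_def)

lemma wp_read: "wp (read_with f) Q m t = Q (f m) m (Suc t)"
  by (simp add: wp_def read_with_def)

lemma wp_write: "wp (write_with f) Q m t = Q () (f m) (Suc t)"
  by (simp add: wp_def write_with_def)

lemma wp_calc: "wp (calc v) Q m t = Q v m (Suc t)"
  by (simp add: calc_def wp_read)

lemma wp_skip: "wp skip Q m t = Q () m t"
  by (simp add: skip_def wp_return)

lemma wp_if: "wp (if b then P else P') Q m t = (if b then wp P Q m t else wp P' Q m t)"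
  by simp

lemma wp_mono: "wp P R m t \<Longrightarrow> (\<And>r m' t'. R r m' t' \<Longrightarrow> Q r m' t') \<Longrightarrow> wp P Q m t"
  by (auto simp: wp_def split: prod.splits)

lemmas wp_simps = wp_bind wp_return wp_read wp_write wp_calc wp_skip wp_if

lemmas mem_ops = get_node_def set_node_def del_node_def get_group_def set_group_def
  get_fresh_def set_fresh_def get_size_def set_size_def get_epoch_def set_epoch_def
  get_offset_def set_offset_def get_head_def set_head_def get_front_def set_front_def
  get_back_def set_back_def get_cell_def set_cell_def get_ovf_def set_ovf_def del_ovf_def

text \<open>The bound is relative to an arbitrary initial counter, so that bounds of consecutive
  programs add up.\<close>

definition spec :: "('a, 'v) prog \<Rightarrow> 'a mem \<Rightarrow> nat \<Rightarrow> ('v \<Rightarrow> 'a mem \<Rightarrow> bool) \<Rightarrow> bool" where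
  "spec P m c Q \<longleftrightarrow> (\<forall>t. wp P (\<lambda>r m' t'. t' \<le> t + c \<and> Q r m') m t)"

lemma spec_bind:
  assumes "spec P m c R" "\<And>r m'. R r m' \<Longrightarrow> spec (f r) m' d Q"
  shows "spec (State_Monad.bind P f) m (c + d) Q"
  unfolding spec_def wp_bind
proof
  fix t
  show "wp P (\<lambda>r. wp (f r) (\<lambda>r m' t'. t' \<le> t + (c + d) \<and> Q r m')) m t"
  proof (rule wp_mono)
    show "wp P (\<lambda>r m' t'. t' \<le> t + c \<and> R r m') m t" using assms(1) by (simp add: spec_def)
    fix r m' t'
    assume "t' \<le> t + c \<and> R r m'"
    then have "wp (f r) (\<lambda>r m'' t''. t'' \<le> t' + d \<and> Q r m'') m' t'" "t' \<le> t + c"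
      using assms(2) by (auto simp: spec_def)
    then show "wp (f r) (\<lambda>r m' t'. t' \<le> t + (c + d) \<and> Q r m') m' t'"
      by (auto elim: wp_mono)
  qed
qed

lemma spec_mono:
  assumes "spec P m c R" "c \<le> d" "\<And>r m'. R r m' \<Longrightarrow> Q r m'"
  shows "spec P m d Q"
  unfolding spec_def
proof
  fix t
  have "wp P (\<lambda>r m' t'. t' \<le> t + c \<and> R r m') m t" using assms(1) by (simp add: spec_def)
  then show "wp P (\<lambda>r m' t'. t' \<le> t + d \<and> Q r m') m t"
    by (rule wp_mono) (use assms in auto)
qed

lemma spec_read_bind: "spec (g (f m)) m c Q \<Longrightarrow> spec (State_Monad.bind (read_with f) g) m (Suc c) Q"
  by (simp add: spec_def wp_bind wp_read) (metis add_Suc)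

lemma spec_write_bind:
  "spec (g ()) (f m) c Q \<Longrightarrow> spec (State_Monad.bind (write_with f) g) m (Suc c) Q"
  by (simp add: spec_def wp_bind wp_write) (metis add_Suc)

lemma spec_calc_bind: "spec (g v) m c Q \<Longrightarrow> spec (State_Monad.bind (calc v) g) m (Suc c) Q"
  unfolding calc_def by (rule spec_read_bind)

lemma spec_return: "Q v m \<Longrightarrow> spec (State_Monad.return v) m c Q"
  by (simp add: spec_def wp_return)

section \<open>List operations on the memory\<close>

abbreviation node :: "'a mem \<Rightarrow> 'a \<Rightarrow> 'a node" where
  "node m x \<equiv> the (m_nodes m x)"

abbreviation item_lists :: "'a mem \<Rightarrow> 'a set \<Rightarrow> nat set \<Rightarrow> ('a \<Rightarrow> nat) \<Rightarrow> bool" where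
  "item_lists m V A \<equiv> dll V A (\<lambda>x. nprev (node m x)) (\<lambda>x. nnext (node m x)) (\<lambda>x. ngrp (node m x))
     (\<lambda>a. gfirst (m_groups m a))"

abbreviation group_list :: "'a mem \<Rightarrow> nat set \<Rightarrow> bool" where
  "group_list m A \<equiv>
     glist A (\<lambda>a. gval (m_groups m a)) (\<lambda>a. gprev (m_groups m a)) (\<lambda>a. gnext (m_groups m a))"

text \<open>\<open>V\<close> are the live items and \<open>A\<close> the linked group addresses;
  other groups are unrestricted. All of \<open>A\<close> lies below \<open>m_fresh\<close>, so a new
  group overwrites no linked one. Ranks are not stored, hence the quantifier.\<close>

definition heap :: "'a mem \<Rightarrow> 'a set \<Rightarrow> nat set \<Rightarrow> bool" where
  "heap m V A \<longleftrightarrow> (\<exists>rk. item_lists m V A rk) \<and> group_list m A \<and> (\<forall>a\<in>A. a < m_fresh m) \<and>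
     (\<forall>x\<in>V. m_nodes m x \<noteq> None \<and> nepoch (node m x) = m_epoch m)"

definition same_rest :: "'a mem \<Rightarrow> 'a mem \<Rightarrow> bool" where
  "same_rest m m' \<longleftrightarrow>
     m' = m\<lparr>m_nodes := m_nodes m', m_groups := m_groups m', m_fresh := m_fresh m'\<rparr>"

lemma same_rest_refl: "same_rest m m"
  by (simp add: same_rest_def)

lemma same_rest_trans: "same_rest m m' \<Longrightarrow> same_rest m' m'' \<Longrightarrow> same_rest m m''"
  unfolding same_rest_def by (cases m; cases m'; cases m'') simp

text \<open>Items in \<open>V\<close> may be relinked but keep group and remainder, nodes outside
  \<open>V'\<close> are untouched, and groups in \<open>A\<close> keep their values. The sets differ
  because an operation may write the node of a new item or create a group.\<close>

definition frame :: "'a set \<Rightarrow> 'a set \<Rightarrow> nat set \<Rightarrow> 'a mem \<Rightarrow> 'a mem \<Rightarrow> bool" where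
  "frame V V' A m m' \<longleftrightarrow> same_rest m m' \<and>
     (\<forall>x\<in>V. ngrp (node m' x) = ngrp (node m x) \<and> nrem (node m' x) = nrem (node m x)) \<and>
     (\<forall>x. x \<notin> V' \<longrightarrow> m_nodes m' x = m_nodes m x) \<and>
     (\<forall>a\<in>A. gval (m_groups m' a) = gval (m_groups m a))"

text \<open>The node of \<open>x\<close> stays as it was, with the current epoch, until the caller
  overwrites or deletes it. Only the group of \<open>x\<close> can become empty.\<close>

lemma unlink_spec:
  assumes heap: "heap m V A" and x: "x \<in> V"
  shows "spec (unlink_prog (node m x)) m 4 (\<lambda>_ m'.
    heap m' (V - {x}) A \<and> frame (V - {x}) (V - {x}) UNIV m m' \<and>
    (\<forall>a. a \<noteq> ngrp (node m x) \<longrightarrow> gfirst (m_groups m' a) = gfirst (m_groups m a)))"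
proof -
  define n where "n = node m x"
  define N where "N = (\<lambda>z. if nprev n = Some z then Some ((node m z)\<lparr>nnext := nnext n\<rparr>)
    else if nnext n = Some z then Some ((node m z)\<lparr>nprev := nprev n\<rparr>) else m_nodes m z)"
  define G where "G = (\<lambda>a. if nprev n = None \<and> a = ngrp n then (m_groups m a)\<lparr>gfirst := nnext n\<rparr>
    else m_groups m a)"
  define m' where "m' = m\<lparr>m_nodes := N, m_groups := G\<rparr>"
  obtain rk where dll: "item_lists m V A rk"
    and gl: "group_list m A"
    and fresh: "\<forall>a\<in>A. a < m_fresh m"
    and epoch: "\<forall>x\<in>V. m_nodes m x \<noteq> None \<and> nepoch (node m x) = m_epoch m"
    using heap unfolding heap_def by blast
  note D = dllD[OF dll]
  have px: "y \<in> V \<and> nnext (node m y) = Some x \<and> rk x < rk y" if "nprev n = Some y" for y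
    using D(4)[OF x, of y] that by (simp add: n_def)
  have nx: "z \<in> V \<and> nprev (node m z) = Some x \<and> rk z < rk x" if "nnext n = Some z" for z
    using D(5)[OF x, of z] D(4)[of z x] that by (simp add: n_def)
  \<comment> \<open>One neighbour ranks above \<open>x\<close> and the other below, so they differ
    and the two writes do not interfere.\<close>
  have neq: "y \<noteq> z" if "nprev n = Some y" "nnext n = Some z" for y z
    using px[OF that(1)] nx[OF that(2)] by auto
  have run: "spec (unlink_prog n) m 4 (\<lambda>_ m2. m2 = m')"
  proof (cases "nprev n"; cases "nnext n")
    assume "nprev n = None" "nnext n = None"
    then show ?thesis
      by (auto simp: spec_def unlink_prog_def wp_simps mem_ops m'_def N_def G_def fun_eq_iff)
  next
    fix z assume "nprev n = None" "nnext n = Some z"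
    then show ?thesis
      by (auto simp: spec_def unlink_prog_def wp_simps mem_ops m'_def N_def G_def fun_eq_iff)
  next
    fix y assume "nprev n = Some y" "nnext n = None"
    then show ?thesis
      by (auto simp: spec_def unlink_prog_def wp_simps mem_ops m'_def N_def G_def fun_eq_iff)
  next
    fix y z assume "nprev n = Some y" "nnext n = Some z"
    then show ?thesis using neq
      by (auto simp: spec_def unlink_prog_def wp_simps mem_ops m'_def N_def G_def fun_eq_iff)
  qed
  have nodes: "m_nodes m' = N" "m_groups m' = G" by (simp_all add: m'_def)
  have node: "nprev (node m' z) = (if nnext n = Some z then nprev n else nprev (node m z))"
    "nnext (node m' z) = (if nprev n = Some z then nnext n else nnext (node m z))"
    "ngrp (node m' z) = ngrp (node m z)" "nrem (node m' z) = nrem (node m z)"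
    "nepoch (node m' z) = nepoch (node m z)" for z
    using neq by (auto simp: nodes N_def)
  have group: "gfirst (m_groups m' a) =
      (if nprev n = None \<and> a = ngrp n then nnext n else gfirst (m_groups m a))"
    "gval (m_groups m' a) = gval (m_groups m a)" "gprev (m_groups m' a) = gprev (m_groups m a)"
    "gnext (m_groups m' a) = gnext (m_groups m a)" for a
    by (auto simp: nodes G_def)
  have "item_lists m' (V - {x}) A rk"
    using dll_remove[OF dll x] unfolding node group n_def .
  moreover have "m_nodes m' z \<noteq> None" if "z \<in> V" for z
    using epoch that by (auto simp: nodes N_def)
  ultimately have "heap m' (V - {x}) A"
    unfolding heap_def group node using gl fresh epoch by (auto simp: m'_def)
  moreover have "m_nodes m' z = m_nodes m z" if "z \<notin> V - {x}" for z
    using that px nx by (auto simp: nodes N_def)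
  then have "frame (V - {x}) (V - {x}) UNIV m m'"
    unfolding frame_def group node by (simp add: same_rest_def m'_def)
  ultimately show ?thesis
    using run unfolding n_def[symmetric] by (elim spec_mono) (auto simp: group)
qed

text \<open>Every hop raises the value by at least one, so the distance to \<open>c\<close> bounds
  the hops; once it is used up, the value is exactly \<open>c\<close>. A hop reads two
  groups.\<close>

lemma walk_spec:
  assumes "heap m V A" "a \<in> A" "gval (m_groups m a) \<le> c" "c \<le> gval (m_groups m a) + n"
  shows "spec (walk_prog n c a) m (2 * n) (\<lambda>b m'. m' = m \<and> b \<in> A \<and> gval (m_groups m b) \<le> c \<and>
    (\<forall>d\<in>A. gval (m_groups m d) \<le> gval (m_groups m b) \<or> c < gval (m_groups m d)))"
  using assms(2-)
proof (induction n arbitrary: a)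
  case 0
  then show ?case by (auto intro: spec_return)
next
  case (Suc n)
  have gl: "group_list m A"
    using assms(1) by (simp add: heap_def)
  let ?Q = "\<lambda>b m'. m' = m \<and> b \<in> A \<and> gval (m_groups m b) \<le> c \<and>
    (\<forall>d\<in>A. gval (m_groups m d) \<le> gval (m_groups m b) \<or> c < gval (m_groups m d))"
  show ?case
  proof (cases "gnext (m_groups m a)")
    case None
    then have "?Q a m" using glistD(4)[OF gl \<open>a \<in> A\<close>] Suc.prems by auto
    then show ?thesis using None
      by (auto simp: spec_def wp_simps mem_ops)
  next
    case (Some b)
    have b: "b \<in> A" "gval (m_groups m a) < gval (m_groups m b)"
      using glistD(5)[OF gl \<open>a \<in> A\<close> Some] by auto
    show ?thesis
    proof (cases "gval (m_groups m b) \<le> c")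
      case True
      then have "spec (walk_prog n c b) m (2 * n) ?Q" using b Suc.prems by (intro Suc.IH) auto
      then have "spec (walk_prog (Suc n) c a) m (Suc (Suc (2 * n))) ?Q"
        using Some True by (auto simp: mem_ops intro!: spec_read_bind)
      then show ?thesis by simp
    next
      case False
      then have "?Q a m" using glistD(6)[OF gl \<open>a \<in> A\<close> Some] Suc.prems by fastforce
      then show ?thesis using Some False
        by (auto simp: spec_def wp_simps mem_ops)
    qed
  qed
qed

lemma place_spec:
  assumes heap: "heap m V A" and a: "a \<in> A" "gval (m_groups m a) \<le> c"
    and c: "\<forall>d\<in>A. gval (m_groups m d) \<le> gval (m_groups m a) \<or> c < gval (m_groups m d)"
  shows "spec (place_prog c a) m 7 (\<lambda>q m'. heap m' V (insert q A) \<and>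
    gval (m_groups m' q) = c \<and> frame V {} A m m' \<and>
    (\<forall>b\<in>A. gfirst (m_groups m' b) = gfirst (m_groups m b)))"
proof (cases "gval (m_groups m a) = c")
  case True
  then show ?thesis using heap a
    by (auto simp: spec_def place_prog_def wp_simps mem_ops insert_absorb frame_def same_rest_refl)
next
  case False
  then have ac: "gval (m_groups m a) < c" using a by simp
  define q where "q = m_fresh m"
  define G where "G = (\<lambda>z. if z = q then \<lparr>gval = c, gprev = a, gnext = gnext (m_groups m a), gfirst = None\<rparr>
    else if z = a then (m_groups m a)\<lparr>gnext := Some q\<rparr>
    else if gnext (m_groups m a) = Some z then (m_groups m z)\<lparr>gprev := q\<rparr> else m_groups m z)"
  define m' where "m' = m\<lparr>m_groups := G, m_fresh := Suc q\<rparr>"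
  obtain rk where dll: "item_lists m V A rk"
    and gl: "group_list m A"
    and fresh: "\<forall>a\<in>A. a < m_fresh m"
    and epoch: "\<forall>x\<in>V. m_nodes m x \<noteq> None \<and> nepoch (node m x) = m_epoch m"
    using heap unfolding heap_def by blast
  have q: "q \<notin> A" "q \<noteq> a" using fresh a by (auto simp: q_def)
  have nx: "b \<noteq> q \<and> b \<noteq> a" if "gnext (m_groups m a) = Some b" for b
    using glistD(5)[OF gl a(1) that] q by auto
  have run: "spec (place_prog c a) m 7 (\<lambda>r m2. r = q \<and> m2 = m')"
    using False q nx
    by (cases "gnext (m_groups m a)")
      (auto simp: spec_def place_prog_def wp_simps mem_ops m'_def G_def fun_eq_iff simp flip: q_def)
  have G: "m_groups m' = G" "m_nodes m' = m_nodes m" "m_fresh m' = Suc q" "m_epoch m' = m_epoch m"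
    by (simp_all add: m'_def)
  have first: "gfirst (m_groups m' b) = gfirst (m_groups m b)" if "b \<in> A" for b
    using that q by (auto simp: G G_def)
  have "item_lists m' V A rk"
    using dll by (rule dll_cong) (auto simp: first G(2))
  then have "item_lists m' V (insert q A) rk"
    by (rule dll_insert_group) (simp add: G G_def)
  moreover have "group_list m' (insert q A)"
    by (rule glist_cong[OF glist_insert[OF gl q(1) a(1) ac]]) (use c nx q in \<open>auto simp: G G_def\<close>)
  moreover have "\<forall>a\<in>insert q A. a < m_fresh m'" using fresh by (auto simp: G q_def)
  ultimately have "heap m' V (insert q A)" unfolding heap_def using epoch by (auto simp: G)
  moreover have "frame V {} A m m'"
    using q by (auto simp: frame_def same_rest_def m'_def G_def)
  moreover have "gval (m_groups m' q) = c" by (simp add: G G_def)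
  ultimately show ?thesis using run first by (elim spec_mono) auto
qed

lemma link_spec:
  assumes heap: "heap m V A" and a: "a \<in> A" and x: "x \<notin> V"
  shows "spec (link_prog x r a) m 6 (\<lambda>_ m'. heap m' (insert x V) A \<and>
    ngrp (node m' x) = a \<and> nrem (node m' x) = r \<and> frame V (insert x V) UNIV m m' \<and>
    (\<forall>b. gfirst (m_groups m' b) = (if b = a then Some x else gfirst (m_groups m b))))"
proof -
  define f where "f = gfirst (m_groups m a)"
  define N where "N = (\<lambda>z. if z = x then
      Some \<lparr>nrem = r, ngrp = a, nprev = None, nnext = f, nepoch = m_epoch m\<rparr>
    else if f = Some z then Some ((node m z)\<lparr>nprev := Some x\<rparr>) else m_nodes m z)"
  define m' where "m' = m\<lparr>m_nodes := N, m_groups := (m_groups m)(a := (m_groups m a)\<lparr>gfirst := Some x\<rparr>)\<rparr>"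
  obtain rk where dll: "item_lists m V A rk"
    and gl: "group_list m A"
    and fresh: "\<forall>a\<in>A. a < m_fresh m"
    and epoch: "\<forall>x\<in>V. m_nodes m x \<noteq> None \<and> nepoch (node m x) = m_epoch m"
    using heap unfolding heap_def by blast
  have f: "z \<in> V \<and> z \<noteq> x" if "f = Some z" for z
    using dllD(6)[OF dll a, of z] that x by (auto simp: f_def)
  have run: "spec (link_prog x r a) m 6 (\<lambda>_ m2. m2 = m')"
    using f
    by (cases f) (auto simp: spec_def link_prog_def wp_simps mem_ops m'_def N_def fun_eq_iff simp flip: f_def)
  have G: "m_nodes m' = N" "m_fresh m' = m_fresh m" "m_epoch m' = m_epoch m"
    by (simp_all add: m'_def)
  have group: "gfirst (m_groups m' b) = (if b = a then Some x else gfirst (m_groups m b))"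
    "gval (m_groups m' b) = gval (m_groups m b)" "gprev (m_groups m' b) = gprev (m_groups m b)"
    "gnext (m_groups m' b) = gnext (m_groups m b)" for b
    by (auto simp: m'_def)
  obtain rk' where "dll (insert x V) A
    (\<lambda>z. if z = x then None else if f = Some z then Some x else nprev (node m z))
    ((\<lambda>x. nnext (node m x))(x := f)) ((\<lambda>x. ngrp (node m x))(x := a))
    ((\<lambda>a. gfirst (m_groups m a))(a := Some x)) rk'"
    using dll_insert[OF dll x a] unfolding f_def by blast
  then have "item_lists m' (insert x V) A rk'"
    by (rule dll_cong) (auto simp: group G N_def)
  moreover have "m_nodes m' z \<noteq> None \<and> nepoch (node m' z) = m_epoch m'" if "z \<in> insert x V" for z
    using that epoch by (auto simp: G N_def)
  ultimately have "heap m' (insert x V) A"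
    unfolding heap_def group G(2) using gl fresh by blast
  moreover have "frame V (insert x V) UNIV m m'"
    using x f by (auto simp: frame_def same_rest_def m'_def N_def)
  moreover have "ngrp (node m' x) = a" "nrem (node m' x) = r" by (simp_all add: G N_def)
  ultimately show ?thesis using run group(1) by (elim spec_mono) auto
qed

text \<open>\<open>A'\<close> is \<open>A\<close> or \<open>A - {a}\<close>. A dropped group keeps
  its record in memory and merely stops being linked, so no value or first item changes.\<close>

lemma drop_spec:
  assumes heap: "heap m V A" and a: "a \<in> A"
  shows "spec (drop_if_empty_prog a) m 5 (\<lambda>_ m'. \<exists>A' \<subseteq> A. heap m' V A' \<and> frame V {} UNIV m m' \<and>
    (\<forall>b. gfirst (m_groups m' b) = gfirst (m_groups m b)) \<and>
    (a \<in> A' \<longrightarrow> a = 0 \<or> gfirst (m_groups m a) \<noteq> None))"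
proof (cases "a = 0 \<or> gfirst (m_groups m a) \<noteq> None")
  case True
  then show ?thesis using heap
    by (auto simp: spec_def drop_if_empty_prog_def wp_simps mem_ops frame_def same_rest_refl)
next
  case False
  then have a0: "a \<noteq> 0" and empty: "gfirst (m_groups m a) = None" by auto
  define p where "p = gprev (m_groups m a)"
  define G where "G = (\<lambda>z. if z = p then (m_groups m z)\<lparr>gnext := gnext (m_groups m a)\<rparr>
    else if gnext (m_groups m a) = Some z then (m_groups m z)\<lparr>gprev := p\<rparr> else m_groups m z)"
  define m' where "m' = m\<lparr>m_groups := G\<rparr>"
  obtain rk where dll: "item_lists m V A rk"
    and gl: "group_list m A"
    and fresh: "\<forall>a\<in>A. a < m_fresh m"
    and epoch: "\<forall>x\<in>V. m_nodes m x \<noteq> None \<and> nepoch (node m x) = m_epoch m"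
    using heap unfolding heap_def by blast
  have p: "p \<in> A" "gnext (m_groups m p) = Some a" using glistD(7)[OF gl a a0] by (auto simp: p_def)
  then have vp: "gval (m_groups m p) < gval (m_groups m a)" using glistD(5)[OF gl] by blast
  have nx: "b \<noteq> p \<and> b \<noteq> a" if "gnext (m_groups m a) = Some b" for b
    using glistD(5)[OF gl a that] vp by auto
  have run: "spec (drop_if_empty_prog a) m 5 (\<lambda>_ m2. m2 = m')"
    using a0 empty nx vp
    by (cases "gnext (m_groups m a)")
      (auto simp: spec_def drop_if_empty_prog_def wp_simps mem_ops m'_def G_def fun_eq_iff simp flip: p_def)
  have group: "gfirst (m_groups m' b) = gfirst (m_groups m b)"
    "gval (m_groups m' b) = gval (m_groups m b)"
    "gprev (m_groups m' b) = (if gnext (m_groups m a) = Some b then p else gprev (m_groups m b))"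
    "gnext (m_groups m' b) = ((\<lambda>b. gnext (m_groups m b))(p := gnext (m_groups m a))) b" for b
    using nx by (auto simp: m'_def G_def)
  have "dll V (A - {a}) (\<lambda>x. nprev (node m x)) (\<lambda>x. nnext (node m x)) (\<lambda>x. ngrp (node m x))
      (\<lambda>a. gfirst (m_groups m' a)) rk"
    unfolding group by (rule dll_remove_group[OF dll empty])
  moreover have "group_list m' (A - {a})"
    using glist_remove[OF gl a a0] unfolding group p_def .
  ultimately have "heap m' V (A - {a})"
    unfolding heap_def using fresh epoch by (auto simp: m'_def)
  moreover have "frame V {} UNIV m m'"
    unfolding frame_def group by (simp add: same_rest_def m'_def)
  ultimately show ?thesis using run group(1) by (elim spec_mono) (auto intro!: exI[of _ "A - {a}"])
qed

lemma frame_trans: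
  "frame V1 V1' A1 m m' \<Longrightarrow> frame V2 V2' A2 m' m'' \<Longrightarrow>
   V \<subseteq> V1 \<inter> V2 \<Longrightarrow> V1' \<union> V2' \<subseteq> V' \<Longrightarrow> A \<subseteq> A1 \<inter> A2 \<Longrightarrow> frame V V' A m m''"
  unfolding frame_def by (fastforce intro: same_rest_trans)

text \<open>The \<open>15\<close> consists of two steps to find the target value, seven to place the
  group and six to link the item. By the last clause no new empty group is left behind: a created
  group receives \<open>x\<close>.\<close>

lemma insert_from_spec:
  assumes heap: "heap m V A" and a: "a \<in> A" and x: "x \<notin> V"
  shows "spec (insert_from_prog a d x r) m (2 * d + 15) (\<lambda>_ m'. \<exists>A'. A \<subseteq> A' \<and>
    heap m' (insert x V) A' \<and> frame V (insert x V) A m m' \<and>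
    gval (m_groups m' (ngrp (node m' x))) = gval (m_groups m a) + d \<and> nrem (node m' x) = r \<and>
    (\<forall>b\<in>A'. gfirst (m_groups m' b) = None \<longrightarrow> b \<in> A \<and> gfirst (m_groups m b) = None))"
    (is "spec _ _ _ ?Q")
proof -
  let ?c = "gval (m_groups m a) + d"
  have "spec (walk_prog d ?c a \<bind> (\<lambda>a'. place_prog ?c a' \<bind> (\<lambda>q. link_prog x r q))) m
      (2 * d + (7 + 6)) ?Q"
  proof (rule spec_bind)
    show "spec (walk_prog d ?c a) m (2 * d) (\<lambda>b m'. m' = m \<and> b \<in> A \<and> gval (m_groups m b) \<le> ?c \<and>
      (\<forall>d\<in>A. gval (m_groups m d) \<le> gval (m_groups m b) \<or> ?c < gval (m_groups m d)))"
      by (rule walk_spec[OF heap a]) auto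
  next
    fix a' m0
    assume "m0 = m \<and> a' \<in> A \<and> gval (m_groups m a') \<le> ?c \<and>
      (\<forall>d\<in>A. gval (m_groups m d) \<le> gval (m_groups m a') \<or> ?c < gval (m_groups m d))"
    then have m0: "m0 = m" and a': "a' \<in> A" "gval (m_groups m a') \<le> ?c"
      "\<forall>d\<in>A. gval (m_groups m d) \<le> gval (m_groups m a') \<or> ?c < gval (m_groups m d)" by auto
    show "spec (place_prog ?c a' \<bind> (\<lambda>q. link_prog x r q)) m0 (7 + 6) ?Q"
      unfolding m0
    proof (rule spec_bind)
      show "spec (place_prog ?c a') m 7 (\<lambda>q m'. heap m' V (insert q A) \<and>
        gval (m_groups m' q) = ?c \<and> frame V {} A m m' \<and>
        (\<forall>b\<in>A. gfirst (m_groups m' b) = gfirst (m_groups m b)))"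
        by (rule place_spec[OF heap a'])
    next
      fix q m1
      assume "heap m1 V (insert q A) \<and> gval (m_groups m1 q) = ?c \<and> frame V {} A m m1 \<and>
        (\<forall>b\<in>A. gfirst (m_groups m1 b) = gfirst (m_groups m b))"
      then have m1: "heap m1 V (insert q A)" "gval (m_groups m1 q) = ?c" "frame V {} A m m1"
        "\<forall>b\<in>A. gfirst (m_groups m1 b) = gfirst (m_groups m b)" by auto
      show "spec (link_prog x r q) m1 6 ?Q"
      proof (rule spec_mono[OF link_spec[OF m1(1) insertI1 x]])
        fix m'
        assume m': "heap m' (insert x V) (insert q A) \<and> ngrp (node m' x) = q \<and> nrem (node m' x) = r \<and>
          frame V (insert x V) UNIV m1 m' \<and>
          (\<forall>b. gfirst (m_groups m' b) = (if b = q then Some x else gfirst (m_groups m1 b)))"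
        then have "frame V (insert x V) A m m'" using m1(3) by (auto intro: frame_trans)
        moreover have "gval (m_groups m' q) = ?c" using m' m1(2) by (simp add: frame_def)
        ultimately show "?Q () m'"
          using m' m1(4) by (intro exI[of _ "insert q A"]) auto
      qed simp
    qed
  qed
  then have "spec (insert_from_prog a d x r) m (Suc (Suc (2 * d + (7 + 6)))) ?Q"
    unfolding insert_from_prog_def get_group_def by (intro spec_read_bind spec_calc_bind)
  then show ?thesis by (elim spec_mono) auto
qed

text \<open>The nodes of the items in \<open>X\<close> may be left over from before they were unlinked, and the
  groups in \<open>E\<close> may be empty.\<close>

definition partial_refines ::
    "'a mem \<Rightarrow> 'a set \<Rightarrow> nat set \<Rightarrow> ('a \<Rightarrow> nat) \<Rightarrow> ('a \<Rightarrow> nat) \<Rightarrow> nat set \<Rightarrow> 'a set \<Rightarrow> bool" where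
  "partial_refines m V A f g E X \<longleftrightarrow> heap m V A \<and>
     (\<forall>b\<in>A. gfirst (m_groups m b) = None \<longrightarrow> b \<in> E) \<and>
     (\<forall>z n. m_nodes m z = Some n \<longrightarrow> nepoch n \<le> m_epoch m) \<and>
     (\<forall>z n. m_nodes m z = Some n \<longrightarrow> nepoch n = m_epoch m \<longrightarrow> z \<in> V \<union> X) \<and>
     (\<forall>z\<in>V. f z = gval (m_groups m (ngrp (node m z))) \<and> g z = nrem (node m z))"

lemma heap_ngrp: "heap m V A \<Longrightarrow> x \<in> V \<Longrightarrow> ngrp (node m x) \<in> A"
  unfolding heap_def by (auto dest: dllD(2))

lemma heap_node: "heap m V A \<Longrightarrow> x \<in> V \<Longrightarrow> m_nodes m x = Some (node m x) \<and> nepoch (node m x) = m_epoch m"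
  unfolding heap_def by auto

lemma same_rest_epoch: "same_rest m m' \<Longrightarrow> m_epoch m' = m_epoch m"
  unfolding same_rest_def by (cases m; cases m') simp

lemma partial_refines_unlink:
  assumes R: "partial_refines m V A f g E X" and x: "x \<in> V"
  shows "spec (unlink_prog (node m x)) m 4 (\<lambda>_ m'.
    partial_refines m' (V - {x}) A f g (insert (ngrp (node m x)) E) (insert x X) \<and> same_rest m m' \<and>
    (\<forall>a. gval (m_groups m' a) = gval (m_groups m a)))"
proof -
  have heap: "heap m V A" using R by (simp add: partial_refines_def)
  show ?thesis
  proof (rule spec_mono[OF unlink_spec[OF heap x]])
    fix m'
    assume "heap m' (V - {x}) A \<and> frame (V - {x}) (V - {x}) UNIV m m' \<and>
      (\<forall>a. a \<noteq> ngrp (node m x) \<longrightarrow> gfirst (m_groups m' a) = gfirst (m_groups m a))"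
    then have m': "heap m' (V - {x}) A" "frame (V - {x}) (V - {x}) UNIV m m'"
      "\<forall>a. a \<noteq> ngrp (node m x) \<longrightarrow> gfirst (m_groups m' a) = gfirst (m_groups m a)" by auto
    have epoch: "m_epoch m' = m_epoch m"
      using m'(2) by (simp add: frame_def same_rest_epoch)
    have nodes: "nepoch n \<le> m_epoch m \<and> (nepoch n = m_epoch m \<longrightarrow> z \<in> V \<union> X)"
      if "m_nodes m' z = Some n" for z n
    proof (cases "z \<in> V - {x}")
      case True
      then show ?thesis using heap_node[OF m'(1) True] that epoch by simp
    next
      case False
      then have "m_nodes m z = Some n" using m'(2) that by (simp add: frame_def)
      then show ?thesis using R by (auto simp: partial_refines_def)
    qed
    show "partial_refines m' (V - {x}) A f g (insert (ngrp (node m x)) E) (insert x X) \<and>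
      same_rest m m' \<and> (\<forall>a. gval (m_groups m' a) = gval (m_groups m a))"
      using R m' nodes unfolding partial_refines_def frame_def epoch by auto
  qed simp
qed

lemma partial_refines_insert_from:
  assumes R: "partial_refines m V A f g E X" and a: "a \<in> A" and x: "x \<notin> V"
  shows "spec (insert_from_prog a d x r) m (2 * d + 15) (\<lambda>_ m'. \<exists>A'. A \<subseteq> A' \<and>
    partial_refines m' (insert x V) A' (f(x := gval (m_groups m a) + d)) (g(x := r)) E (X - {x}) \<and>
    same_rest m m')"
proof -
  have heap: "heap m V A" using R by (simp add: partial_refines_def)
  show ?thesis
  proof (rule spec_mono[OF insert_from_spec[OF heap a x]])
    fix m'
    assume "\<exists>A'. A \<subseteq> A' \<and> heap m' (insert x V) A' \<and> frame V (insert x V) A m m' \<and>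
      gval (m_groups m' (ngrp (node m' x))) = gval (m_groups m a) + d \<and> nrem (node m' x) = r \<and>
      (\<forall>b\<in>A'. gfirst (m_groups m' b) = None \<longrightarrow> b \<in> A \<and> gfirst (m_groups m b) = None)"
    then obtain A' where A': "A \<subseteq> A'" and m': "heap m' (insert x V) A'" "frame V (insert x V) A m m'"
      "gval (m_groups m' (ngrp (node m' x))) = gval (m_groups m a) + d" "nrem (node m' x) = r"
      "\<forall>b\<in>A'. gfirst (m_groups m' b) = None \<longrightarrow> b \<in> A \<and> gfirst (m_groups m b) = None" by blast
    have epoch: "m_epoch m' = m_epoch m"
      using m'(2) by (simp add: frame_def same_rest_epoch)
    have nodes: "nepoch n \<le> m_epoch m \<and> (nepoch n = m_epoch m \<longrightarrow> z \<in> insert x V \<union> (X - {x}))"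
      if "m_nodes m' z = Some n" for z n
    proof (cases "z \<in> insert x V")
      case True
      then show ?thesis using heap_node[OF m'(1) True] that epoch by auto
    next
      case False
      then have "m_nodes m z = Some n" using m'(2) that by (simp add: frame_def)
      then show ?thesis using R False by (auto simp: partial_refines_def)
    qed
    have counts: "f z = gval (m_groups m' (ngrp (node m' z))) \<and> g z = nrem (node m' z)" if "z \<in> V" for z
      using that R m'(2) heap_ngrp[OF heap that] by (simp add: partial_refines_def frame_def)
    have "partial_refines m' (insert x V) A' (f(x := gval (m_groups m a) + d)) (g(x := r)) E (X - {x})"
      unfolding partial_refines_def epoch
    proof (intro conjI ballI allI impI)
      show "heap m' (insert x V) A'" by (rule m'(1))
      show "b \<in> E" if "b \<in> A'" "gfirst (m_groups m' b) = None" for b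
        using that m'(5) R by (simp add: partial_refines_def)
      show "nepoch n \<le> m_epoch m" if "m_nodes m' z = Some n" for z n using nodes[OF that] by simp
      show "z \<in> insert x V \<union> (X - {x})" if "m_nodes m' z = Some n" "nepoch n = m_epoch m" for z n
        using nodes[OF that(1)] that(2) by simp
      fix z assume z: "z \<in> insert x V"
      show "(f(x := gval (m_groups m a) + d)) z = gval (m_groups m' (ngrp (node m' z)))"
        using z m'(3) counts[of z] by (cases "z = x") simp_all
      show "(g(x := r)) z = nrem (node m' z)"
        using z m'(4) counts[of z] by (cases "z = x") simp_all
    qed
    then show "\<exists>A'. A \<subseteq> A' \<and> partial_refines m' (insert x V) A' (f(x := gval (m_groups m a) + d)) (g(x := r)) E (X - {x}) \<and>
      same_rest m m'" using A' m'(2) by (auto simp: frame_def)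
  qed simp
qed

text \<open>\<open>a\<close> leaves the possibly empty groups because it has items or is unlinked;
  the permanent group \<open>0\<close> remains covered by \<open>0 \<in> E\<close>.\<close>

lemma partial_refines_drop:
  assumes R: "partial_refines m V A f g (insert a E) X" and a: "a \<in> A" and E: "0 \<in> E"
  shows "spec (drop_if_empty_prog a) m 5 (\<lambda>_ m'. \<exists>A'. partial_refines m' V A' f g E X \<and> same_rest m m')"
proof -
  have heap: "heap m V A" using R by (simp add: partial_refines_def)
  show ?thesis
  proof (rule spec_mono[OF drop_spec[OF heap a]])
    fix m'
    assume "\<exists>A' \<subseteq> A. heap m' V A' \<and> frame V {} UNIV m m' \<and>
      (\<forall>b. gfirst (m_groups m' b) = gfirst (m_groups m b)) \<and>
      (a \<in> A' \<longrightarrow> a = 0 \<or> gfirst (m_groups m a) \<noteq> None)"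
    then obtain A' where A': "A' \<subseteq> A" and m': "heap m' V A'" "frame V {} UNIV m m'"
      "\<forall>b. gfirst (m_groups m' b) = gfirst (m_groups m b)"
      "a \<in> A' \<longrightarrow> a = 0 \<or> gfirst (m_groups m a) \<noteq> None" by blast
    have epoch: "m_epoch m' = m_epoch m"
      using m'(2) by (simp add: frame_def same_rest_epoch)
    have nodes: "m_nodes m' = m_nodes m" using m'(2) by (auto simp: frame_def)
    have "b \<in> E" if "b \<in> A'" "gfirst (m_groups m' b) = None" for b
    proof -
      have "b = a \<or> b \<in> E" using that m'(3) A' R by (auto simp: partial_refines_def)
      then show ?thesis using that m'(3,4) E by auto
    qed
    then have "partial_refines m' V A' f g E X"
      using R m'(1,2) unfolding partial_refines_def epoch nodes frame_def by simp
    then show "\<exists>A'. partial_refines m' V A' f g E X \<and> same_rest m m'"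
      using m'(2) by (auto simp: frame_def)
  qed simp
qed

section \<open>Memory images of FAST states\<close>

definition same_queues :: "'a mem \<Rightarrow> 'a mem \<Rightarrow> bool" where
  "same_queues m m' \<longleftrightarrow> m_offset m' = m_offset m \<and> m_head m' = m_head m \<and> m_front m' = m_front m \<and>
     m_back m' = m_back m \<and> m_cell m' = m_cell m \<and> m_ovf m' = m_ovf m"

lemma same_rest_imp: "same_rest m m' \<Longrightarrow> same_queues m m' \<and> m_size m' = m_size m"
  unfolding same_rest_def same_queues_def by (cases m; cases m') simp

definition refines :: "'a mem \<Rightarrow> 'a fast \<Rightarrow> bool" where
  "refines m y \<longleftrightarrow> (\<exists>A. partial_refines m (alloc y) A (cnt y) (rmd y) {0} {}) \<and> m_size m = card (alloc y)"

lemma refines_cong: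
  assumes "refines m y" "m_nodes m' = m_nodes m" "m_groups m' = m_groups m"
    "m_fresh m' = m_fresh m" "m_epoch m' = m_epoch m" "m_size m' = m_size m"
  shows "refines m' y"
  using assms unfolding refines_def partial_refines_def heap_def by simp

text \<open>No node is newer than the old epoch, so raising the epoch makes all of them stale at
  once. Only address \<open>0\<close> stays linked; \<open>m_fresh\<close> is not reset, and
  abandoned groups remain as garbage.\<close>

lemma flush_spec:
  assumes "refines m y"
  shows "spec flush_prog m 4 (\<lambda>_ m'. refines m' fast_init \<and> same_queues m m')"
proof -
  define m' where "m' = m\<lparr>m_epoch := m_epoch m + 1, m_groups := (m_groups m)(0 := zero_group), m_size := 0\<rparr>"
  obtain A where R: "partial_refines m (alloc y) A (cnt y) (rmd y) {0} {}"
    using assms by (auto simp: refines_def)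
  then have "0 < m_fresh m" unfolding partial_refines_def heap_def glist_def by blast
  then have "heap m' {} {0}"
    unfolding heap_def by (auto simp: dll_def glist_def m'_def zero_group_def)
  moreover have "nepoch n < m_epoch m'" if "m_nodes m' z = Some n" for z n
    using R that by (auto simp: partial_refines_def m'_def less_Suc_eq_le)
  ultimately have "partial_refines m' {} {0} f g {0} {}" for f g
    unfolding partial_refines_def by (auto simp: less_imp_le dest: less_imp_neq)
  then have "refines m' fast_init" by (auto simp: refines_def fast_init_def m'_def)
  moreover have "same_queues m m'" by (simp add: same_queues_def m'_def)
  ultimately show ?thesis
    by (auto simp: spec_def flush_prog_def wp_simps mem_ops m'_def)
qed

lemma lookup_spec:
  assumes "refines m y"
  shows "spec (lookup_prog x) m 3
    (\<lambda>r m'. m' = m \<and> r = (if x \<in> alloc y then Some (node m x) else None))"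
proof -
  obtain A where R: "partial_refines m (alloc y) A (cnt y) (rmd y) {0} {}"
    using assms by (auto simp: refines_def)
  then have heap: "heap m (alloc y) A" by (simp add: partial_refines_def)
  have "(case m_nodes m x of None \<Rightarrow> None | Some n \<Rightarrow> if nepoch n = m_epoch m then Some n else None) =
    (if x \<in> alloc y then Some (node m x) else None)"
    using heap_node[OF heap, of x] R by (auto simp: partial_refines_def split: option.splits)
  then show ?thesis by (simp add: spec_def lookup_prog_def wp_simps mem_ops)
qed

text \<open>Only group \<open>0\<close> may be empty, so the first nonempty group is the first or
  second of the list, and the list is ordered by value.\<close>

lemma min_group_spec:
  assumes R: "partial_refines m V A f g {0} X" and V: "V \<noteq> {}"
  shows "spec min_group_prog m 2 (\<lambda>a m'. m' = m \<and> a \<in> A \<and>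
    (\<exists>x\<in>V. gfirst (m_groups m a) = Some x \<and> ngrp (node m x) = a) \<and>
    (\<forall>z\<in>V. gval (m_groups m a) \<le> f z))"
proof -
  define a where "a = (case gfirst (m_groups m 0) of Some _ \<Rightarrow> 0
    | None \<Rightarrow> (case gnext (m_groups m 0) of Some a \<Rightarrow> a | None \<Rightarrow> 0))"
  have heap: "heap m V A" using R by (simp add: partial_refines_def)
  then obtain rk where dll: "item_lists m V A rk"
    and gl: "group_list m A"
    unfolding heap_def by blast
  have f: "f z = gval (m_groups m (ngrp (node m z)))" if "z \<in> V" for z
    using R that by (simp add: partial_refines_def)
  have first: "\<exists>x\<in>V. gfirst (m_groups m b) = Some x \<and> ngrp (node m x) = b"
    if "b \<in> A" "gfirst (m_groups m b) \<noteq> None" for b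
    using dllD(6)[OF dll that(1)] that(2) by blast
  have A0: "0 \<in> A" "gval (m_groups m 0) = 0" using glistD(1,2)[OF gl] by auto
  have "a \<in> A \<and> gfirst (m_groups m a) \<noteq> None \<and> (\<forall>z\<in>V. gval (m_groups m a) \<le> f z)"
  proof (cases "gfirst (m_groups m 0)")
    case (Some x)
    then show ?thesis using A0 by (simp add: a_def)
  next
    case None
    have grp: "ngrp (node m z) \<noteq> 0 \<and> ngrp (node m z) \<in> A" if "z \<in> V" for z
      using dll_first_neq_None[OF dll that] dllD(2)[OF dll that] None by metis
    have pos: "0 < f z" if "z \<in> V" for z
      using glistD(3)[OF gl, of "ngrp (node m z)" 0] grp[OF that] A0 f[OF that] by auto
    obtain z where z: "z \<in> V" using V by blast
    have "gnext (m_groups m 0) \<noteq> None"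
    proof
      assume "gnext (m_groups m 0) = None"
      then show False using glistD(4)[OF gl A0(1), of "ngrp (node m z)"] grp[OF z] pos[OF z] f[OF z] A0
        by simp
    qed
    then obtain b where b: "gnext (m_groups m 0) = Some b" by blast
    then have a: "a = b" using None by (simp add: a_def)
    have bA: "b \<in> A" "0 < gval (m_groups m b)" using glistD(5)[OF gl A0(1) b] A0 by auto
    then have "b \<noteq> 0" using A0 by (metis not_less_zero)
    then have "gfirst (m_groups m b) \<noteq> None" using R bA by (auto simp: partial_refines_def)
    moreover have "gval (m_groups m b) \<le> f z" if "z \<in> V" for z
      using glistD(6)[OF gl A0(1) b, of "ngrp (node m z)"] grp[OF that] pos[OF that] f[OF that] A0 by simp
    ultimately show ?thesis using bA a by simp
  qed
  then have "a \<in> A \<and> (\<exists>x\<in>V. gfirst (m_groups m a) = Some x \<and> ngrp (node m x) = a) \<and>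
    (\<forall>z\<in>V. gval (m_groups m a) \<le> f z)" using first by blast
  then show ?thesis
    by (simp add: spec_def min_group_prog_def wp_simps mem_ops flip: a_def)
qed

context wfast_params
begin

lemma fast_query_spec:
  assumes R: "refines m y" and inv: "fast_inv n y"
  shows "spec (wfast_fast_query_prog M \<epsilon> \<phi> x) m 8 (\<lambda>r m'. m' = m \<and> r = query y x)"
    (is "spec _ _ _ ?Q")
proof -
  obtain A where pR: "partial_refines m (alloc y) A (cnt y) (rmd y) {0} {}"
    and size: "m_size m = card (alloc y)"
    using R by (auto simp: refines_def)
  have counts: "cnt y z = gval (m_groups m (ngrp (node m z))) \<and> rmd y z = nrem (node m z)"
    if "z \<in> alloc y" for z
    using pR that by (simp add: partial_refines_def)
  have "spec (wfast_fast_query_prog M \<epsilon> \<phi> x) m (3 + 5) ?Q"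
    unfolding wfast_fast_query_prog_def fast_query_prog_def Let_def
  proof (rule spec_bind[OF lookup_spec[OF R]])
    fix t m0
    assume t: "m0 = m \<and> t = (if x \<in> alloc y then Some (node m x) else None)"
    show "spec (case t of
        None \<Rightarrow> get_size \<bind> (\<lambda>l. if l < C then calc 0
          else min_group_prog \<bind> (\<lambda>a. get_group a \<bind> (\<lambda>g. calc (s - 1 + s * gval g))))
      | Some n \<Rightarrow> get_group (ngrp n) \<bind> (\<lambda>g. calc (nrem n + s * gval g))) m0 5 ?Q"
    proof (cases "x \<in> alloc y")
      case True
      then show ?thesis using t counts[OF True]
        by (simp add: spec_def wp_simps mem_ops query_alloc)
    next
      case False
      have "spec (get_size \<bind> (\<lambda>l. if l < C then calc 0
          else min_group_prog \<bind> (\<lambda>a. get_group a \<bind> (\<lambda>g. calc (s - 1 + s * gval g))))) m (Suc 4) ?Q"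
        unfolding get_size_def
      proof (rule spec_read_bind)
        show "spec (if m_size m < C then calc 0
          else min_group_prog \<bind> (\<lambda>a. get_group a \<bind> (\<lambda>g. calc (s - 1 + s * gval g)))) m 4 ?Q"
        proof (cases "card (alloc y) < C")
          case True
          then show ?thesis using size query_free[OF inv False True]
            by (simp add: spec_def wp_simps)
        next
          case full: False
          then have ne: "alloc y \<noteq> {}" using C_pos by auto
          have fin: "finite (alloc y)" using inv by (simp add: fast_inv_def)
          have "spec (min_group_prog \<bind> (\<lambda>a. get_group a \<bind> (\<lambda>g. calc (s - 1 + s * gval g)))) m (2 + 2) ?Q"
          proof (rule spec_bind[OF min_group_spec[OF pR ne]])
            fix a m1
            assume a: "m1 = m \<and> a \<in> A \<and>
              (\<exists>x\<in>alloc y. gfirst (m_groups m a) = Some x \<and> ngrp (node m x) = a) \<and>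
              (\<forall>z\<in>alloc y. gval (m_groups m a) \<le> cnt y z)"
            then obtain z where z: "z \<in> alloc y" "ngrp (node m z) = a" by blast
            then have "Min (cnt y ` alloc y) = cnt y z"
              using a counts[OF z(1)] fin by (intro Min_cnt_eq) auto
            then have "Min (cnt y ` alloc y) = gval (m_groups m a)" using counts[OF z(1)] z(2) by simp
            then show "spec (get_group a \<bind> (\<lambda>g. calc (s - 1 + s * gval g))) m1 2 ?Q"
              using a query_full[OF False full] by (simp add: spec_def wp_simps mem_ops)
          qed
          then show ?thesis using full size by simp
        qed
      qed
      then show ?thesis using t False by simp
    qed
  qed
  then show ?thesis by simp
qed

lemma add_incrementI:
  assumes "x \<in> alloc y \<or> card (alloc y) < C"
  shows "add x w y \<lparr>alloc = insert x (alloc y), cnt = (cnt y)(x := cnt y x + (rmd y x + w) div s),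
    rmd = (rmd y)(x := (rmd y x + w) mod s)\<rparr>"
  unfolding wfast_fast_add_def using assms by (rule fast_add.increment) simp

lemma add_evictI:
  assumes "x \<notin> alloc y" "\<not> card (alloc y) < C" "z \<in> alloc y" "\<forall>v\<in>alloc y. cnt y z \<le> cnt y v"
  shows "add x w y \<lparr>alloc = insert x (alloc y - {z}),
    cnt = (cnt y)(x := cnt y z + (s - 1 + w) div s),
    rmd = (rmd y)(x := (s - 1 + w) mod s)\<rparr>"
  unfolding wfast_fast_add_def using assms(1,2) refl assms(3,4) by (rule fast_add.evict)

lemma refinesI:
  assumes "partial_refines m (alloc y) A (cnt y) (rmd y) {0} {}" "m_size m = card (alloc y)"
  shows "refines m y"
  using assms by (auto simp: refines_def)

lemma refines_set_remainder:
  assumes R: "refines m y" and x: "x \<in> alloc y"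
  shows "refines (m\<lparr>m_nodes := (m_nodes m)(x \<mapsto> (node m x)\<lparr>nrem := r\<rparr>)\<rparr>) (y\<lparr>rmd := (rmd y)(x := r)\<rparr>)"
proof -
  let ?m = "m\<lparr>m_nodes := (m_nodes m)(x \<mapsto> (node m x)\<lparr>nrem := r\<rparr>)\<rparr>"
  obtain A where pR: "partial_refines m (alloc y) A (cnt y) (rmd y) {0} {}"
    and size: "m_size m = card (alloc y)"
    using R by (auto simp: refines_def)
  then have heap: "heap m (alloc y) A" by (simp add: partial_refines_def)
  have node: "nprev (node ?m z) = nprev (node m z)" "nnext (node ?m z) = nnext (node m z)"
    "ngrp (node ?m z) = ngrp (node m z)" "nepoch (node ?m z) = nepoch (node m z)"
    "nrem (node ?m z) = (if z = x then r else nrem (node m z))" for z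
    by auto
  have "heap ?m (alloc y) A"
    using heap unfolding heap_def node by simp
  moreover have "\<exists>n'. m_nodes m z = Some n' \<and> nepoch n' = nepoch n" if "m_nodes ?m z = Some n" for z n
    using that heap_node[OF heap x] by (auto split: if_splits)
  ultimately have "partial_refines ?m (alloc y) A (cnt y) ((rmd y)(x := r)) {0} {}"
    using pR unfolding partial_refines_def node by fastforce
  then show ?thesis using size by (intro refinesI) auto
qed

text \<open>A remainder is at most \<open>s - 1\<close>, so \<open>(s - 1 + M) div s\<close> bounds
  the hops in all three cases. An item is inserted before its old group, or that of the victim, is
  dropped, because the search starts there. The victim is the first item of the group of minimal
  value, one of the choices that the relation allows.\<close>

lemma fast_add_spec:
  assumes R: "refines m y" and inv: "fast_inv n y" and w: "w \<le> M"
  shows "spec (wfast_fast_add_prog M \<epsilon> \<phi> x w) m (2 * ((s - 1 + M) div s) + 40)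
    (\<lambda>_ m'. \<exists>y'. add x w y y' \<and> refines m' y' \<and> same_queues m m')"
    (is "spec _ _ _ ?Q")
proof -
  let ?D = "(s - 1 + M) div s"
  obtain A where pR: "partial_refines m (alloc y) A (cnt y) (rmd y) {0} {}"
    and size: "m_size m = card (alloc y)"
    using R by (auto simp: refines_def)
  then have heap: "heap m (alloc y) A" by (simp add: partial_refines_def)
  have fin: "finite (alloc y)" using inv by (simp add: fast_inv_def)
  have counts: "cnt y z = gval (m_groups m (ngrp (node m z))) \<and> rmd y z = nrem (node m z)"
    if "z \<in> alloc y" for z
    using pR that by (simp add: partial_refines_def)
  have A0: "0 \<in> A" "gval (m_groups m 0) = 0" using heap by (auto simp: heap_def glist_def)
  have "spec (wfast_fast_add_prog M \<epsilon> \<phi> x w) m (3 + (2 * ?D + 37)) ?Q"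
    unfolding wfast_fast_add_prog_def fast_add_prog_def Let_def
  proof (rule spec_bind[OF lookup_spec[OF R]])
    fix t m0
    assume t: "m0 = m \<and> t = (if x \<in> alloc y then Some (node m x) else None)"
    let ?some = "\<lambda>n. calc ((nrem n + w) div s) \<bind> (\<lambda>d. calc ((nrem n + w) mod s) \<bind> (\<lambda>r.
      if d = 0 then set_node x (n\<lparr>nrem := r\<rparr>)
      else unlink_prog n \<bind> (\<lambda>_. insert_from_prog (ngrp n) d x r \<bind> (\<lambda>_. drop_if_empty_prog (ngrp n)))))"
    let ?evict = "min_group_prog \<bind> (\<lambda>a. get_group a \<bind> (\<lambda>g. get_node (the (gfirst g)) \<bind> (\<lambda>t'.
      unlink_prog (the t') \<bind> (\<lambda>_. del_node (the (gfirst g)) \<bind> (\<lambda>_. calc ((s - 1 + w) div s) \<bind> (\<lambda>d.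
      calc ((s - 1 + w) mod s) \<bind> (\<lambda>r. insert_from_prog a d x r \<bind> (\<lambda>_. drop_if_empty_prog a))))))))"
    let ?new = "\<lambda>l. set_size (l + 1) \<bind> (\<lambda>_. calc (w div s) \<bind> (\<lambda>d. calc (w mod s) \<bind> (\<lambda>r.
      insert_from_prog 0 d x r)))"
    let ?none = "get_size \<bind> (\<lambda>l. if l < C then ?new l else ?evict)"
    show "spec (case t of None \<Rightarrow> ?none | Some n \<Rightarrow> ?some n) m0 (2 * ?D + 37) ?Q"
    proof (cases "x \<in> alloc y")
      case x: True
      let ?n = "node m x"
      let ?d = "(nrem ?n + w) div s" and ?r = "(nrem ?n + w) mod s"
      let ?y = "\<lparr>alloc = insert x (alloc y), cnt = (cnt y)(x := cnt y x + (rmd y x + w) div s),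
        rmd = (rmd y)(x := (rmd y x + w) mod s)\<rparr>"
      have add: "add x w y ?y" using x by (intro add_incrementI) simp
      have "spec (if ?d = 0 then set_node x (?n\<lparr>nrem := ?r\<rparr>)
          else unlink_prog ?n \<bind> (\<lambda>_. insert_from_prog (ngrp ?n) ?d x ?r \<bind> (\<lambda>_. drop_if_empty_prog (ngrp ?n))))
        m (2 * ?D + 24) ?Q"
      proof (cases "?d = 0")
        case True
        then have "?y = y\<lparr>rmd := (rmd y)(x := ?r)\<rparr>"
          using x counts[OF x] by (intro fast.equality) (auto simp: insert_absorb)
        then have "refines (m\<lparr>m_nodes := (m_nodes m)(x \<mapsto> ?n\<lparr>nrem := ?r\<rparr>)\<rparr>) ?y"
          using refines_set_remainder[OF R x, of ?r] by simp
        moreover have "same_queues m (m\<lparr>m_nodes := (m_nodes m)(x \<mapsto> ?n\<lparr>nrem := ?r\<rparr>)\<rparr>)"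
          by (simp add: same_queues_def)
        ultimately show ?thesis using True add
          by (auto simp: spec_def wp_simps mem_ops)
      next
        case False
        have "nrem ?n \<le> s - 1" using inv x counts[OF x] by (auto simp: fast_inv_def)
        then have dD: "?d \<le> ?D" using w by (intro div_le_mono) simp
        have "spec (unlink_prog ?n \<bind> (\<lambda>_. insert_from_prog (ngrp ?n) ?d x ?r \<bind>
          (\<lambda>_. drop_if_empty_prog (ngrp ?n)))) m (4 + ((2 * ?d + 15) + 5)) ?Q"
        proof (rule spec_bind[OF partial_refines_unlink[OF pR x]])
          fix m1
          assume "partial_refines m1 (alloc y - {x}) A (cnt y) (rmd y) (insert (ngrp ?n) {0}) (insert x {}) \<and>
            same_rest m m1 \<and> (\<forall>a. gval (m_groups m1 a) = gval (m_groups m a))"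
          then have m1: "partial_refines m1 (alloc y - {x}) A (cnt y) (rmd y) (insert (ngrp ?n) {0}) {x}"
            "same_rest m m1" "gval (m_groups m1 (ngrp ?n)) = cnt y x" using counts[OF x] by auto
          show "spec (insert_from_prog (ngrp ?n) ?d x ?r \<bind> (\<lambda>_. drop_if_empty_prog (ngrp ?n))) m1
            ((2 * ?d + 15) + 5) ?Q"
          proof (rule spec_bind[OF partial_refines_insert_from[OF m1(1) heap_ngrp[OF heap x]]])
            fix m2
            assume "\<exists>A'. A \<subseteq> A' \<and> partial_refines m2 (insert x (alloc y - {x})) A'
              ((cnt y)(x := gval (m_groups m1 (ngrp ?n)) + ?d)) ((rmd y)(x := ?r))
              (insert (ngrp ?n) {0}) ({x} - {x}) \<and> same_rest m1 m2"
            then obtain A' where A': "A \<subseteq> A'" and m2: "partial_refines m2 (alloc ?y) A' (cnt ?y) (rmd ?y)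
                (insert (ngrp ?n) {0}) {}" "same_rest m1 m2"
              using counts[OF x] m1(3) by auto
            have "ngrp ?n \<in> A'" using A' heap_ngrp[OF heap x] by auto
            then show "spec (drop_if_empty_prog (ngrp ?n)) m2 5 ?Q"
            proof (rule spec_mono[OF partial_refines_drop[OF m2(1)]])
              fix m3
              assume "\<exists>A'. partial_refines m3 (alloc ?y) A' (cnt ?y) (rmd ?y) {0} {} \<and> same_rest m2 m3"
              then obtain A'' where m3: "partial_refines m3 (alloc ?y) A'' (cnt ?y) (rmd ?y) {0} {}"
                "same_rest m2 m3" by blast
              have sr: "same_rest m m3" using m1(2) m2(2) m3(2) by (blast intro: same_rest_trans)
              have "refines m3 ?y"
                using m3(1) same_rest_imp[OF sr] size x by (intro refinesI) (auto simp: insert_absorb)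
              then show "?Q () m3" using add same_rest_imp[OF sr] by blast
            qed auto
          qed simp
        qed
        then have "spec (unlink_prog ?n \<bind> (\<lambda>_. insert_from_prog (ngrp ?n) ?d x ?r \<bind>
          (\<lambda>_. drop_if_empty_prog (ngrp ?n)))) m (2 * ?D + 24) ?Q"
          by (elim spec_mono) (use dD in auto)
        then show ?thesis using False by simp
      qed
      then have "spec (?some ?n) m (Suc (Suc (2 * ?D + 24))) ?Q"
        by (intro spec_calc_bind)
      then have "spec (?some ?n) m (2 * ?D + 37) ?Q" by (elim spec_mono) auto
      then show ?thesis using t x by simp
    next
      case x: False
      have "spec (if m_size m < C then ?new (m_size m) else ?evict) m (2 * ?D + 36) ?Q"
      proof (cases "card (alloc y) < C")
        case True
        let ?y = "\<lparr>alloc = insert x (alloc y), cnt = (cnt y)(x := cnt y x + (rmd y x + w) div s),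
          rmd = (rmd y)(x := (rmd y x + w) mod s)\<rparr>"
        let ?m1 = "m\<lparr>m_size := m_size m + 1\<rparr>"
        have add: "add x w y ?y" using True by (intro add_incrementI) simp
        \<comment> \<open>With free counters a new item starts from zeros, so the search from group
          \<open>0\<close> by \<open>w div s\<close> agrees with the increment rule.\<close>
        have zero: "cnt y x = 0" "rmd y x = 0" using inv x True by (auto simp: fast_inv_def)
        have m1: "partial_refines ?m1 (alloc y) A (cnt y) (rmd y) {0} {}"
          using pR by (simp add: partial_refines_def heap_def)
        have dD: "w div s \<le> ?D" using w by (intro div_le_mono) simp
        have ins: "spec (insert_from_prog 0 (w div s) x (w mod s)) ?m1 (2 * (w div s) + 15) ?Q"
        proof (rule spec_mono[OF partial_refines_insert_from[OF m1 A0(1) x]])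
          fix m2
          assume "\<exists>A'. A \<subseteq> A' \<and> partial_refines m2 (insert x (alloc y)) A'
            ((cnt y)(x := gval (m_groups ?m1 0) + w div s)) ((rmd y)(x := w mod s)) {0} ({} - {x}) \<and>
            same_rest ?m1 m2"
          then obtain A' where m2: "partial_refines m2 (alloc ?y) A' (cnt ?y) (rmd ?y) {0} {}"
            "same_rest ?m1 m2" using A0 zero by auto
          have "refines m2 ?y"
            using m2(1) same_rest_imp[OF m2(2)] size x fin by (intro refinesI) auto
          moreover have "same_queues m m2"
            using same_rest_imp[OF m2(2)] by (simp add: same_queues_def)
          ultimately show "?Q () m2" using add by blast
        qed simp
        have "spec (?new (m_size m)) m (Suc (Suc (Suc (2 * (w div s) + 15)))) ?Q"
          unfolding set_size_def by (intro spec_write_bind spec_calc_bind ins)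
        then have "spec (?new (m_size m)) m (2 * ?D + 36) ?Q"
          by (elim spec_mono) (use dD in auto)
        then show ?thesis using True size by simp
      next
        case full: False
        let ?d = "(s - 1 + w) div s" and ?r = "(s - 1 + w) mod s"
        have ne: "alloc y \<noteq> {}" using full C_pos by auto
        have dD: "?d \<le> ?D" using w by (intro div_le_mono) simp
        have "spec ?evict m (2 + Suc (Suc (4 + Suc (Suc (Suc ((2 * ?d + 15) + 5)))))) ?Q"
        proof (rule spec_bind[OF min_group_spec[OF pR ne]])
          fix a m1
          assume a: "m1 = m \<and> a \<in> A \<and>
            (\<exists>x\<in>alloc y. gfirst (m_groups m a) = Some x \<and> ngrp (node m x) = a) \<and>
            (\<forall>z\<in>alloc y. gval (m_groups m a) \<le> cnt y z)"
          then obtain z where z: "z \<in> alloc y" "gfirst (m_groups m a) = Some z" "ngrp (node m z) = a"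
            by blast
          have cz: "cnt y z = gval (m_groups m a)" using counts[OF z(1)] z(3) by simp
          let ?y = "\<lparr>alloc = insert x (alloc y - {z}), cnt = (cnt y)(x := cnt y z + ?d),
            rmd = (rmd y)(x := ?r)\<rparr>"
          have add: "add x w y ?y" using x full z(1) a cz by (intro add_evictI) auto
          have xz: "x \<noteq> z" using x z by auto
          have card: "card (alloc ?y) = card (alloc y)"
            using x z(1) fin card_Suc_Diff1[OF fin z(1)] by simp
          have body: "spec (unlink_prog (node m z) \<bind> (\<lambda>_. del_node z \<bind> (\<lambda>_. calc ?d \<bind> (\<lambda>d.
              calc ?r \<bind> (\<lambda>r. insert_from_prog a d x r \<bind> (\<lambda>_. drop_if_empty_prog a)))))) m
            (4 + Suc (Suc (Suc ((2 * ?d + 15) + 5)))) ?Q"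
          proof (rule spec_bind[OF partial_refines_unlink[OF pR z(1)]])
            fix m2
            assume "partial_refines m2 (alloc y - {z}) A (cnt y) (rmd y) (insert (ngrp (node m z)) {0}) (insert z {}) \<and>
              same_rest m m2 \<and> (\<forall>a. gval (m_groups m2 a) = gval (m_groups m a))"
            then have m2: "partial_refines m2 (alloc y - {z}) A (cnt y) (rmd y) (insert a {0}) {z}"
              "same_rest m m2" "gval (m_groups m2 a) = cnt y z" using cz z(3) by auto
            \<comment> \<open>The node of the victim still carries the current epoch and would be
              found by a lookup; deleting it empties the set of leftover nodes.\<close>
            let ?m3 = "m2\<lparr>m_nodes := (m_nodes m2)(z := None)\<rparr>"
            have heap2: "heap m2 (alloc y - {z}) A" using m2(1) by (simp add: partial_refines_def)
            have node3: "m_nodes ?m3 v = m_nodes m2 v" if "v \<noteq> z" for v using that by simp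
            have heap3: "heap ?m3 (alloc y - {z}) A"
            proof -
              obtain rk where "item_lists m2 (alloc y - {z}) A rk"
                using heap2 by (auto simp: heap_def)
              then have "item_lists ?m3 (alloc y - {z}) A rk"
                by (rule dll_cong) auto
              then show ?thesis using heap2 unfolding heap_def by auto
            qed
            have m3: "partial_refines ?m3 (alloc y - {z}) A (cnt y) (rmd y) (insert a {0}) {}"
              using m2(1) heap3 unfolding partial_refines_def by auto
            have xn: "x \<notin> alloc y - {z}" using x by simp
            have "a \<in> A" using a by simp
            have "spec (insert_from_prog a ?d x ?r \<bind> (\<lambda>_. drop_if_empty_prog a)) ?m3
              ((2 * ?d + 15) + 5) ?Q"
            proof (rule spec_bind[OF partial_refines_insert_from[OF m3 \<open>a \<in> A\<close> xn]])
              fix m4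
              assume "\<exists>A'. A \<subseteq> A' \<and> partial_refines m4 (insert x (alloc y - {z})) A'
                ((cnt y)(x := gval (m_groups ?m3 a) + ?d)) ((rmd y)(x := ?r)) (insert a {0}) ({} - {x}) \<and>
                same_rest ?m3 m4"
              then obtain A' where A': "A \<subseteq> A'" and m4: "partial_refines m4 (alloc ?y) A' (cnt ?y) (rmd ?y)
                (insert a {0}) {}" "same_rest ?m3 m4" using m2(3) by auto
              have "a \<in> A'" using A' \<open>a \<in> A\<close> by auto
              then show "spec (drop_if_empty_prog a) m4 5 ?Q"
              proof (rule spec_mono[OF partial_refines_drop[OF m4(1)]])
                fix m5
                assume "\<exists>A'. partial_refines m5 (alloc ?y) A' (cnt ?y) (rmd ?y) {0} {} \<and> same_rest m4 m5"
                then obtain A'' where m5: "partial_refines m5 (alloc ?y) A'' (cnt ?y) (rmd ?y) {0} {}"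
                  "same_rest m4 m5" by blast
                have sr: "same_rest ?m3 m5" using m4(2) m5(2) by (rule same_rest_trans)
                have sq: "same_queues m m5" "m_size m5 = m_size m"
                  using same_rest_imp[OF sr] same_rest_imp[OF m2(2)] by (auto simp: same_queues_def)
                then have "refines m5 ?y" using m5(1) size card by (intro refinesI) auto
                then show "?Q () m5" using add sq by blast
              qed auto
            qed
            then show "spec (del_node z \<bind> (\<lambda>_. calc ?d \<bind> (\<lambda>d. calc ?r \<bind> (\<lambda>r.
                insert_from_prog a d x r \<bind> (\<lambda>_. drop_if_empty_prog a))))) m2
              (Suc (Suc (Suc ((2 * ?d + 15) + 5)))) ?Q"
              unfolding del_node_def by (intro spec_write_bind spec_calc_bind)
          qed
          show "spec (get_group a \<bind> (\<lambda>g. get_node (the (gfirst g)) \<bind> (\<lambda>t'.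
              unlink_prog (the t') \<bind> (\<lambda>_. del_node (the (gfirst g)) \<bind> (\<lambda>_. calc ?d \<bind> (\<lambda>d.
              calc ?r \<bind> (\<lambda>r. insert_from_prog a d x r \<bind> (\<lambda>_. drop_if_empty_prog a)))))))) m1
            (Suc (Suc (4 + Suc (Suc (Suc ((2 * ?d + 15) + 5)))))) ?Q"
            unfolding get_group_def get_node_def conjunct1[OF a]
            by (intro spec_read_bind, unfold z(2) option.sel) (rule body)
        qed
        then have "spec ?evict m (2 * ?D + 36) ?Q"
          by (elim spec_mono) (use dD in auto)
        then show ?thesis using full size by simp
      qed
      then have "spec ?none m (Suc (2 * ?D + 36)) ?Q"
        unfolding get_size_def by (intro spec_read_bind)
      then have "spec ?none m (2 * ?D + 37) ?Q" by (elim spec_mono) auto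
      then show ?thesis using t x by simp
    qed
  qed
  then show ?thesis by (simp add: algebra_simps)
qed

end

section \<open>Simulation of WFAST\<close>

lemma spec_run:
  assumes "spec P m c Q"
  shows "Q (result_of P m) (memory_after P m)" "running_time P m \<le> c"
  using assms[unfolded spec_def wp_def, rule_format, of 0]
  by (auto simp: result_of_def memory_after_def running_time_def split: prod.splits)

section \<open>The ring of block queues\<close>

definition slot :: "'a mem \<Rightarrow> nat \<Rightarrow> 'a list" where
  "slot m j = map (\<lambda>i. m_cell m (j, i)) [m_front m j..<m_back m j]"

text \<open>The slot of the queue of age \<open>i\<close> when the head is in slot \<open>h\<close>:
  the residue of \<open>h - i\<close> modulo \<open>k + 1\<close>, written without negative
  numbers.\<close>

definition slot_index :: "nat \<Rightarrow> nat \<Rightarrow> nat \<Rightarrow> nat" where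
  "slot_index k h i = (if i \<le> h then h - i else h + k + 1 - i)"

definition ring :: "nat \<Rightarrow> 'a mem \<Rightarrow> 'a list list \<Rightarrow> bool" where
  "ring k m qs \<longleftrightarrow> m_head m \<le> k \<and> length qs = k + 1 \<and> (\<forall>j. m_front m j \<le> m_back m j) \<and>
     (\<forall>i\<le>k. qs ! i = slot m (slot_index k (m_head m) i))"

lemma slot_index_inj:
  "h \<le> k \<Longrightarrow> i \<le> k \<Longrightarrow> j \<le> k \<Longrightarrow> slot_index k h i = slot_index k h j \<longleftrightarrow> i = j"
  by (auto simp: slot_index_def)

lemma slot_index_last: "h \<le> k \<Longrightarrow> (h + 1) mod (k + 1) = slot_index k h k"
  by (cases "h = k") (simp_all add: slot_index_def mod_less)

lemma bij_betw_slot_index: "h \<le> k \<Longrightarrow> bij_betw (slot_index k h) {..<Suc k} {..<Suc k}"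
  unfolding bij_betw_def
proof (intro conjI)
  assume h: "h \<le> k"
  show "inj_on (slot_index k h) {..<Suc k}"
    using h by (auto simp: inj_on_def slot_index_inj)
  then show "slot_index k h ` {..<Suc k} = {..<Suc k}"
    using h by (intro endo_inj_surj) (auto simp: slot_index_def)
qed

lemma same_queues_ring: "same_queues m m' \<Longrightarrow> ring k m qs \<Longrightarrow> ring k m' qs"
  by (simp add: same_queues_def ring_def slot_def)

text \<open>Instance, offset and queues are separate arguments, so that the moments between flush,
  rotation, pop and push can be described as well as complete states.\<close>

definition simulates :: "nat \<Rightarrow> 'a mem \<Rightarrow> 'a fast \<Rightarrow> nat \<Rightarrow> 'a list list \<times> ('a \<rightharpoonup> nat) \<Rightarrow> bool" where
  "simulates k m y p bB \<longleftrightarrow> refines m y \<and> m_offset m = p \<and> ring k m (fst bB) \<and> m_ovf m = snd bB"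

lemma rotate_spec:
  assumes S: "simulates k m y p (qs, B)" and k: "k > 0"
  shows "spec (rotate_prog k) m 5 (\<lambda>_ m'. simulates k m' y p ([] # butlast qs, B))"
proof -
  define h where "h = m_head m"
  define h' where "h' = (h + 1) mod (k + 1)"
  define m' where "m' = m\<lparr>m_head := h', m_front := (m_front m)(h' := 0), m_back := (m_back m)(h' := 0)\<rparr>"
  have ring: "h \<le> k" "length qs = k + 1" "\<forall>j. m_front m j \<le> m_back m j"
    "\<And>i. i \<le> k \<Longrightarrow> qs ! i = slot m (slot_index k h i)"
    using S by (auto simp: simulates_def ring_def h_def)
  have h': "h' = slot_index k h k" "h' = (if h = k then 0 else h + 1)"
  proof -
    show "h' = slot_index k h k" unfolding h'_def by (rule slot_index_last[OF ring(1)])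
    then show "h' = (if h = k then 0 else h + 1)" using ring(1) by (simp add: slot_index_def)
  qed
  have "([] # butlast qs) ! i = slot m' (slot_index k h' i)" if "i \<le> k" for i
  proof (cases i)
    case 0
    then show ?thesis by (simp add: slot_def m'_def slot_index_def)
  next
    case (Suc j)
    \<comment> \<open>Advancing the head and raising the age by one leads to the same slot, so the
      surviving queues are not moved.\<close>
    then have "slot_index k h' i = slot_index k h j" "j < k"
      using that ring(1) by (auto simp: h'(2) slot_index_def)
    moreover have "slot_index k h j \<noteq> h'"
      using slot_index_inj[of h k j k] ring(1) \<open>j < k\<close> by (simp add: h'(1))
    ultimately show ?thesis using Suc ring(2) ring(4)[of j]
      by (simp add: nth_butlast slot_def m'_def)
  qed
  moreover have "h' \<le> k" using h'(2) ring(1) by simp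
  ultimately have "ring k m' ([] # butlast qs)"
    using ring by (auto simp: ring_def m'_def)
  moreover have "refines m' y"
    by (rule refines_cong[of m]) (use S in \<open>auto simp: simulates_def m'_def\<close>)
  ultimately have "simulates k m' y p ([] # butlast qs, B)"
    using S by (simp add: simulates_def m'_def)
  then show ?thesis
    by (simp add: spec_def rotate_prog_def wp_simps mem_ops h_def h'_def m'_def)
qed

lemma decrement_spec:
  "spec (decrement_prog z) m 2 (\<lambda>_ m'. m' = m\<lparr>m_ovf := decrement z (m_ovf m)\<rparr>)"
  by (auto simp: spec_def decrement_prog_def wp_simps mem_ops decrement_def split: option.splits)

lemma increment_spec:
  "spec (increment_prog z) m 2 (\<lambda>_ m'. m' = m\<lparr>m_ovf := increment z (m_ovf m)\<rparr>)"
  by (auto simp: spec_def increment_prog_def wp_simps mem_ops increment_def split: option.splits)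

lemma pop_spec:
  assumes S: "simulates k m y p (qs, B)"
  shows "spec (pop_prog (slot_index k (m_head m) k)) m 6
    (\<lambda>_ m'. simulates k m' y p (pop_oldest (qs, B)) \<and> m_head m' = m_head m)"
    (is "spec _ _ _ ?Q")
proof -
  define h where "h = m_head m"
  define j where "j = slot_index k h k"
  have ring: "h \<le> k" "length qs = k + 1" "\<forall>j. m_front m j \<le> m_back m j"
    "\<And>i. i \<le> k \<Longrightarrow> qs ! i = slot m (slot_index k h i)"
    using S by (auto simp: simulates_def ring_def h_def)
  have last: "last qs = slot m j"
    using ring(2) ring(4)[of k] by (subst last_conv_nth) (auto simp: j_def)
  show ?thesis
  proof (cases "m_front m j < m_back m j")
    case True
    let ?z = "m_cell m (j, m_front m j)"
    define m1 where "m1 = m\<lparr>m_front := (m_front m)(j := m_front m j + 1)\<rparr>"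
    define m' where "m' = m1\<lparr>m_ovf := decrement ?z (m_ovf m1)\<rparr>"
    have "slot m j = ?z # slot m1 j"
      using True by (simp add: slot_def m1_def upt_conv_Cons)
    moreover have "slot m' j = slot m1 j" by (simp add: slot_def m'_def)
    ultimately have pop: "pop_oldest (qs, B) = (butlast qs @ [slot m' j], decrement ?z B)"
      using last by (simp add: pop_oldest_def)
    have "(butlast qs @ [slot m' j]) ! i = slot m' (slot_index k h i)" if "i \<le> k" for i
    proof (cases "i = k")
      case True
      then show ?thesis using ring(2) by (simp add: nth_append j_def)
    next
      case False
      then have "slot_index k h i \<noteq> j"
        using that ring(1) by (simp add: j_def slot_index_inj)
      then have "slot m' (slot_index k h i) = slot m (slot_index k h i)"
        by (simp add: slot_def m'_def m1_def)
      then show ?thesis using that False ring(2) ring(4)[of i] by (simp add: nth_append nth_butlast)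
    qed
    then have "ring k m' (butlast qs @ [slot m' j])"
      using ring True by (auto simp: ring_def m'_def m1_def h_def Suc_leI)
    moreover have "refines m' y"
      by (rule refines_cong[of m]) (use S in \<open>auto simp: simulates_def m'_def m1_def\<close>)
    ultimately have "simulates k m' y p (pop_oldest (qs, B))"
      using S by (simp add: simulates_def pop m'_def m1_def)
    then have Q: "?Q () m'" by (simp add: m'_def m1_def)
    have "spec (decrement_prog ?z) m1 2 ?Q"
      by (rule spec_mono[OF decrement_spec]) (use Q in \<open>auto simp: m'_def\<close>)
    then have "spec (get_cell j (m_front m j) \<bind> (\<lambda>z. set_front j (m_front m j + 1) \<bind>
      (\<lambda>_. decrement_prog z))) m (Suc (Suc 2)) ?Q"
      unfolding get_cell_def set_front_def m1_def by (intro spec_read_bind spec_write_bind)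
    then have "spec (if m_front m j < m_back m j then get_cell j (m_front m j) \<bind>
      (\<lambda>z. set_front j (m_front m j + 1) \<bind> (\<lambda>_. decrement_prog z)) else skip) m (Suc (Suc 2)) ?Q"
      using True by simp
    then have "spec (pop_prog j) m (Suc (Suc (Suc (Suc 2)))) ?Q"
      unfolding pop_prog_def get_front_def get_back_def by (intro spec_read_bind)
    then show ?thesis unfolding j_def h_def by (elim spec_mono) auto
  next
    case False
    then have "pop_oldest (qs, B) = (qs, B)"
      using last by (simp add: pop_oldest_def slot_def)
    then show ?thesis using False S
      by (simp add: spec_def pop_prog_def wp_simps mem_ops flip: j_def h_def)
  qed
qed

lemma push_spec:
  assumes S: "simulates k m y p bB"
  shows "spec (push_prog (m_head m) x) m 5 (\<lambda>_ m'. simulates k m' y p (push_newest x bB))"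
    (is "spec _ _ _ ?Q")
proof -
  define h where "h = m_head m"
  obtain qs B where bB: "bB = (qs, B)" by fastforce
  have ring: "h \<le> k" "length qs = k + 1" "\<forall>j. m_front m j \<le> m_back m j"
    "\<And>i. i \<le> k \<Longrightarrow> qs ! i = slot m (slot_index k h i)"
    using S by (auto simp: simulates_def ring_def h_def bB)
  define m1 where "m1 = m\<lparr>m_cell := (m_cell m)((h, m_back m h) := x),
    m_back := (m_back m)(h := m_back m h + 1)\<rparr>"
  define m' where "m' = m1\<lparr>m_ovf := increment x (m_ovf m1)\<rparr>"
  obtain q qs' where qs: "qs = q # qs'" using ring(2) by (cases qs) auto
  have "q = slot m h" using ring(4)[of 0] by (simp add: qs slot_index_def)
  then have slot_h: "slot m' h = q @ [x]"
    using ring(3) by (simp add: slot_def m'_def m1_def)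
  have "((q @ [x]) # qs') ! i = slot m' (slot_index k h i)" if "i \<le> k" for i
  proof (cases i)
    case 0
    then show ?thesis using slot_h by (simp add: slot_index_def)
  next
    case (Suc j)
    then have "slot_index k h i \<noteq> h"
      using slot_index_inj[of h k i 0] that ring(1) by (simp add: slot_index_def)
    then have "slot m' (slot_index k h i) = slot m (slot_index k h i)"
      by (simp add: slot_def m'_def m1_def)
    then show ?thesis using that Suc ring(4)[of i] by (simp add: qs)
  qed
  then have "ring k m' ((q @ [x]) # qs')"
    using ring by (auto simp: ring_def m'_def m1_def h_def qs le_SucI)
  moreover have "refines m' y"
    by (rule refines_cong[of m]) (use S in \<open>auto simp: simulates_def m'_def m1_def\<close>)
  ultimately have Q: "?Q () m'"
    using S by (simp add: simulates_def bB qs push_newest_def m'_def m1_def)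
  have "spec (increment_prog x) m1 2 ?Q"
    by (rule spec_mono[OF increment_spec]) (use Q in \<open>auto simp: m'_def\<close>)
  then have "spec (push_prog h x) m (Suc (Suc (Suc 2))) ?Q"
    unfolding push_prog_def mem_ops
    by (intro spec_read_bind spec_write_bind) (simp add: m1_def)
  then show ?thesis unfolding h_def by (elim spec_mono) auto
qed

section \<open>Verification of the WFAST programs\<close>

context wfast_params
begin

abbreviation represents :: "'a mem \<Rightarrow> 'a wfast \<Rightarrow> bool" where
  "represents m A \<equiv> simulates k m (inst A) (offset A) (queues A, overflows A)"

lemma simulates_same_queues:
  "simulates k m y p bB \<Longrightarrow> same_queues m m' \<Longrightarrow> refines m' y' \<Longrightarrow> simulates k m' y' p bB"
  by (auto simp: simulates_def same_queues_ring) (auto simp: same_queues_def)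

text \<open>The program is cut into continuations that are verified from the last to the first, each
  for every memory that simulates the state at its start.\<close>

lemma wfast_add_spec:
  assumes S: "represents m A" and inv: "fast_inv n (inst A)" and w: "w \<le> M"
  shows "spec (wfast_add_prog W M \<epsilon> \<phi> x w) m (2 * ((s - 1 + M) div s) + 100)
    (\<lambda>_ m'. \<exists>A'. wfast_add W M \<epsilon> \<phi> x w A A' \<and> represents m' A')"
    (is "spec _ _ _ ?Q")
proof -
  let ?D = "(s - 1 + M) div s"
  define o1 where "o1 = (offset A + 1) mod W"
  define y1 where "y1 = (if o1 = 0 then fast_init else inst A)"
  define b1 where "b1 = (if o1 mod L = 0 then [] # butlast (queues A) else queues A)"
  define P where "P = pop_oldest (b1, overflows A)"
  \<comment> \<open>A flush may keep \<open>n\<close>, since the initial instance satisfies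
    \<open>fast_inv\<close> for every \<open>n\<close>.\<close>
  have inv1: "fast_inv n y1" using inv by (simp add: y1_def fast_inv_init)
  have off: "m_offset m = offset A" using S by (simp add: simulates_def)
  let ?m1 = "m\<lparr>m_offset := o1\<rparr>"
  have "refines ?m1 (inst A)"
    by (rule refines_cong[of m]) (use S in \<open>auto simp: simulates_def\<close>)
  then have S1: "simulates k ?m1 (inst A) o1 (queues A, overflows A)"
    using S by (simp add: simulates_def ring_def slot_def)
  define last_part where "last_part h q q' = calc (q' div u > q div u) \<bind> (\<lambda>c'. if c' then push_prog h x else skip)" for h q q'
  have part5: "spec (last_part (m_head m') (query y1 x) (query y2 x)) m' (Suc 5) ?Q"
    if S': "simulates k m' y2 o1 P" and add: "add x w y1 y2" for m' y2
  proof -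
    define bB where "bB = (if query y2 x div u > query y1 x div u then push_newest x P else P)"
    define A' where "A' = \<lparr>inst = y2, offset = o1, queues = fst bB, overflows = snd bB\<rparr>"
    have "wfast_add W M \<epsilon> \<phi> x w A A'"
      unfolding wfast_add_def Let_def o1_def[symmetric] y1_def[symmetric] b1_def[symmetric] P_def[symmetric]
      using add by (auto simp: A'_def bB_def split: prod.splits)
    then have Q: "?Q () m''" if "simulates k m'' y2 o1 bB" for m''
      using that by (intro exI[of _ A']) (simp add: A'_def)
    show ?thesis
      unfolding last_part_def
    proof (rule spec_calc_bind)
      show "spec (if query y1 x div u < query y2 x div u then push_prog (m_head m') x else skip) m' 5 ?Q"
      proof (cases "query y1 x div u < query y2 x div u")
        case True
        have "spec (push_prog (m_head m') x) m' 5 ?Q"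
          by (rule spec_mono[OF push_spec[OF S']]) (use True Q in \<open>auto simp: bB_def\<close>)
        then show ?thesis using True by simp
      next
        case False
        then have "?Q () m'" using Q S' by (simp add: bB_def)
        then show ?thesis using False by (simp add: spec_def wp_simps)
      qed
    qed
  qed
  define fast_part where "fast_part h = wfast_fast_query_prog M \<epsilon> \<phi> x \<bind> (\<lambda>q.
    wfast_fast_add_prog M \<epsilon> \<phi> x w \<bind> (\<lambda>_. wfast_fast_query_prog M \<epsilon> \<phi> x \<bind> (\<lambda>q'. last_part h q q')))" for h
  have part4: "spec (fast_part (m_head m')) m' (8 + ((2 * ?D + 40) + (8 + Suc 5))) ?Q"
    if S': "simulates k m' y1 o1 P" for m'
    unfolding fast_part_def
  proof (rule spec_bind[OF fast_query_spec[OF _ inv1]])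
    show R: "refines m' y1" using S' by (simp add: simulates_def)
    fix q m2
    assume q: "m2 = m' \<and> q = query y1 x"
    have "spec (wfast_fast_add_prog M \<epsilon> \<phi> x w \<bind> (\<lambda>_. wfast_fast_query_prog M \<epsilon> \<phi> x \<bind>
      (\<lambda>q'. last_part (m_head m') (query y1 x) q'))) m' ((2 * ?D + 40) + (8 + Suc 5)) ?Q"
    proof (rule spec_bind[OF fast_add_spec[OF R inv1 w]])
      fix m3
      assume "\<exists>y'. add x w y1 y' \<and> refines m3 y' \<and> same_queues m' m3"
      then obtain y2 where y2: "add x w y1 y2" "refines m3 y2" "same_queues m' m3" by blast
      have S3: "simulates k m3 y2 o1 P" by (rule simulates_same_queues[OF S' y2(3,2)])
      have inv2: "fast_inv (Suc n) y2" by (rule fast_inv_add[OF inv1 y2(1) w])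
      have head: "m_head m3 = m_head m'" using y2(3) by (simp add: same_queues_def)
      show "spec (wfast_fast_query_prog M \<epsilon> \<phi> x \<bind> (\<lambda>q'. last_part (m_head m') (query y1 x) q')) m3
        (8 + Suc 5) ?Q"
      proof (rule spec_bind[OF fast_query_spec[OF y2(2) inv2]])
        fix q' m4
        assume "m4 = m3 \<and> q' = query y2 x"
        then show "spec (last_part (m_head m') (query y1 x) q') m4 (Suc 5) ?Q"
          using part5[OF S3 y2(1)] head by simp
      qed
    qed
    then show "spec (wfast_fast_add_prog M \<epsilon> \<phi> x w \<bind> (\<lambda>_. wfast_fast_query_prog M \<epsilon> \<phi> x \<bind>
      (\<lambda>q'. last_part (m_head m') q q'))) m2 ((2 * ?D + 40) + (8 + Suc 5)) ?Q"
      using q by simp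
  qed
  define pop_part where "pop_part = get_head \<bind> (\<lambda>h. calc ((h + 1) mod (k + 1)) \<bind> (\<lambda>j.
    pop_prog j \<bind> (\<lambda>_. fast_part h)))"
  have part3: "spec pop_part m' (Suc (Suc (6 + (8 + ((2 * ?D + 40) + (8 + Suc 5)))))) ?Q"
    if S': "simulates k m' y1 o1 (b1, overflows A)" for m'
  proof -
    have "m_head m' \<le> k" using S' by (simp add: simulates_def ring_def)
    then have j: "(m_head m' + 1) mod (k + 1) = slot_index k (m_head m') k"
      by (rule slot_index_last)
    show ?thesis
      unfolding pop_part_def get_head_def
    proof (rule spec_read_bind, rule spec_calc_bind, unfold j, rule spec_bind[OF pop_spec[OF S']])
      fix m2
      assume "simulates k m2 y1 o1 (pop_oldest (b1, overflows A)) \<and> m_head m2 = m_head m'"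
      then show "spec (fast_part (m_head m')) m2 (8 + ((2 * ?D + 40) + (8 + Suc 5))) ?Q"
        using part4[of m2] by (simp add: P_def)
    qed
  qed
  define rotate_part where "rotate_part = calc (o1 mod L = 0) \<bind> (\<lambda>c.
    (if c then rotate_prog k else skip) \<bind> (\<lambda>_. pop_part))"
  have part2: "spec rotate_part m' (Suc (5 + (Suc (Suc (6 + (8 + ((2 * ?D + 40) + (8 + Suc 5)))))))) ?Q"
    if S': "simulates k m' y1 o1 (queues A, overflows A)" for m'
    unfolding rotate_part_def
  proof (rule spec_calc_bind, rule spec_bind)
    show "spec (if o1 mod L = 0 then rotate_prog k else skip) m' 5
      (\<lambda>_ m2. simulates k m2 y1 o1 (b1, overflows A))"
      using rotate_spec[OF S' k_pos] S' by (auto simp: b1_def spec_def wp_skip)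
  qed (rule part3)
  have "spec (get_offset \<bind> (\<lambda>o0. calc ((o0 + 1) mod W) \<bind> (\<lambda>o1. set_offset o1 \<bind> (\<lambda>_.
      (if o1 = 0 then flush_prog else skip) \<bind> (\<lambda>_. calc (o1 mod L = 0) \<bind> (\<lambda>c.
    (if c then rotate_prog k else skip) \<bind> (\<lambda>_. pop_part))))))) m
    (Suc (Suc (Suc (4 + Suc (5 + Suc (Suc (6 + (8 + ((2 * ?D + 40) + (8 + Suc 5)))))))))) ?Q"
    unfolding get_offset_def set_offset_def
  proof (rule spec_read_bind, rule spec_calc_bind, rule spec_write_bind,
      unfold off, unfold o1_def[symmetric] rotate_part_def[symmetric], rule spec_bind)
    show "spec (if o1 = 0 then flush_prog else skip) ?m1 4
      (\<lambda>_ m2. simulates k m2 y1 o1 (queues A, overflows A))"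
    proof (cases "o1 = 0")
      case True
      have "refines ?m1 (inst A)" using S1 by (simp add: simulates_def)
      then have "spec flush_prog ?m1 4 (\<lambda>_ m2. simulates k m2 y1 o1 (queues A, overflows A))"
        by (rule spec_mono[OF flush_spec]) (use True simulates_same_queues[OF S1] in \<open>auto simp: y1_def\<close>)
      then show ?thesis using True by simp
    next
      case False
      then show ?thesis using S1 by (simp add: y1_def spec_def wp_skip)
    qed
  qed (rule part2)
  then show ?thesis
    unfolding wfast_add_prog_def Let_def pop_part_def fast_part_def last_part_def
    by (elim spec_mono) auto
qed

lemma win_query_spec:
  assumes S: "represents m A" and inv: "fast_inv n (inst A)"
  shows "spec (win_query_prog W M \<epsilon> \<phi> x) m 10 (\<lambda>r m'. m' = m \<and> r = win_query W M \<epsilon> \<phi> A x)"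
    (is "spec _ _ _ ?Q")
proof -
  have "refines m (inst A)" and ovf: "m_ovf m = overflows A" using S by (auto simp: simulates_def)
  have "spec (win_query_prog W M \<epsilon> \<phi> x) m (8 + 2) ?Q"
    unfolding win_query_prog_def Let_def
  proof (rule spec_bind[OF fast_query_spec[OF \<open>refines m (inst A)\<close> inv]])
    fix q m'
    assume "m' = m \<and> q = query (inst A) x"
    then show "spec (get_ovf x \<bind> (\<lambda>v. case v of None \<Rightarrow> calc (2 * u + q) | Some n \<Rightarrow> calc (u * (n + 2) + q mod u)))
      m' 2 ?Q"
      using ovf by (auto simp: spec_def wp_simps mem_ops win_query_def split: option.splits)
  qed
  then show ?thesis by simp
qed

text \<open>Per id one step reads the cell, ten answer the window query, and two test and
  insert.\<close>

lemma scan_queue_spec: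
  assumes "represents m A" and "fast_inv n (inst A)"
  shows "spec (scan_queue_prog W M \<epsilon> \<phi> \<theta> j l i H) m (13 * l) (\<lambda>r m'. m' = m \<and>
    r = H \<union> {x \<in> set (map (\<lambda>i. m_cell m (j, i)) [i..<i + l]). real (win_query W M \<epsilon> \<phi> A x) \<ge> real M * real W * \<theta>})"
proof (induction l arbitrary: i H)
  case 0
  then show ?case by (auto intro: spec_return)
next
  case (Suc l)
  let ?R = "\<lambda>x. real (win_query W M \<epsilon> \<phi> A x) \<ge> real M * real W * \<theta>"
  let ?x = "m_cell m (j, i)"
  let ?H = "if ?R ?x then insert ?x H else H"
  let ?Q = "\<lambda>r m'. m' = m \<and> r = H \<union> {x \<in> set (map (\<lambda>i. m_cell m (j, i)) [i..<i + Suc l]). ?R x}"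
  have rest: "spec (scan_queue_prog W M \<epsilon> \<phi> \<theta> j l (i + 1) ?H) m (13 * l) ?Q"
  proof (rule spec_mono[OF Suc])
    fix r m'
    assume "m' = m \<and> r = ?H \<union> {x \<in> set (map (\<lambda>i. m_cell m (j, i)) [i + 1..<i + 1 + l]). ?R x}"
    moreover have "[i..<i + Suc l] = i # [i + 1..<i + 1 + l]" by (simp add: upt_conv_Cons del: upt_Suc)
    ultimately show "?Q r m'" by (auto simp del: upt_Suc)
  qed simp
  have "spec (win_query_prog W M \<epsilon> \<phi> ?x \<bind> (\<lambda>v. calc (real v \<ge> real M * real W * \<theta>) \<bind> (\<lambda>c.
    calc (if c then insert ?x H else H) \<bind> (\<lambda>H'. scan_queue_prog W M \<epsilon> \<phi> \<theta> j l (i + 1) H')))) m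
    (10 + Suc (Suc (13 * l))) ?Q"
  proof (rule spec_bind[OF win_query_spec[OF assms]])
    fix v m'
    assume "m' = m \<and> v = win_query W M \<epsilon> \<phi> A ?x"
    then show "spec (calc (real v \<ge> real M * real W * \<theta>) \<bind> (\<lambda>c.
      calc (if c then insert ?x H else H) \<bind> (\<lambda>H'. scan_queue_prog W M \<epsilon> \<phi> \<theta> j l (i + 1) H'))) m'
      (Suc (Suc (13 * l))) ?Q"
      using rest by (intro spec_calc_bind) simp
  qed
  then have "spec (scan_queue_prog W M \<epsilon> \<phi> \<theta> j (Suc l) i H) m (Suc (10 + Suc (Suc (13 * l)))) ?Q"
    unfolding scan_queue_prog.simps get_cell_def by (intro spec_read_bind)
  then show ?case by (elim spec_mono) auto
qed

lemma scan_slots_spec: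
  assumes S: "represents m A" and inv: "fast_inv n (inst A)"
  shows "spec (scan_slots_prog W M \<epsilon> \<phi> \<theta> J H) m (2 * J + 13 * (\<Sum>j<J. length (slot m j))) (\<lambda>r m'. m' = m \<and>
    r = H \<union> {x \<in> (\<Union>j<J. set (slot m j)). real (win_query W M \<epsilon> \<phi> A x) \<ge> real M * real W * \<theta>})"
proof (induction J arbitrary: H)
  case 0
  then show ?case by (auto intro: spec_return)
next
  case (Suc J)
  let ?R = "\<lambda>x. real (win_query W M \<epsilon> \<phi> A x) \<ge> real M * real W * \<theta>"
  let ?Q = "\<lambda>r m'. m' = m \<and> r = H \<union> {x \<in> (\<Union>j<Suc J. set (slot m j)). ?R x}"
  let ?f = "m_front m J" and ?l = "m_back m J"
  have "?f \<le> ?l" using S by (simp add: simulates_def ring_def)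
  then have slot: "slot m J = map (\<lambda>i. m_cell m (J, i)) [?f..<?f + (?l - ?f)]"
    by (simp add: slot_def)
  have len: "?l - ?f = length (slot m J)" by (simp add: slot_def)
  have "spec (scan_queue_prog W M \<epsilon> \<phi> \<theta> J (?l - ?f) ?f H \<bind> (\<lambda>H'. scan_slots_prog W M \<epsilon> \<phi> \<theta> J H')) m
    (13 * (?l - ?f) + (2 * J + 13 * (\<Sum>j<J. length (slot m j)))) ?Q"
  proof (rule spec_bind[OF scan_queue_spec[OF assms]], unfold slot[symmetric])
    fix H' m'
    assume "m' = m \<and> H' = H \<union> {x \<in> set (slot m J). ?R x}"
    then show "spec (scan_slots_prog W M \<epsilon> \<phi> \<theta> J H') m' (2 * J + 13 * (\<Sum>j<J. length (slot m j))) ?Q"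
      by (auto intro!: spec_mono[OF Suc] simp: lessThan_Suc)
  qed
  then have "spec (scan_slots_prog W M \<epsilon> \<phi> \<theta> (Suc J) H) m
    (Suc (Suc (13 * (?l - ?f) + (2 * J + 13 * (\<Sum>j<J. length (slot m j)))))) ?Q"
    unfolding scan_slots_prog.simps get_front_def get_back_def by (intro spec_read_bind)
  then show ?case unfolding len by (elim spec_mono) auto
qed

text \<open>The scan follows slot numbers rather than ages. Since \<open>slot_index\<close> is a
  bijection, this affects neither the union of the queues nor their total length.\<close>

lemma heavy_hitters_spec:
  assumes S: "represents m A" and inv: "fast_inv n (inst A)"
  shows "spec (heavy_hitters_prog W M \<epsilon> \<phi> \<theta>) m (2 * (k + 1) + 13 * length (concat (queues A)))
    (\<lambda>r m'. m' = m \<and> r = {x \<in> set (concat (queues A)). real (win_query W M \<epsilon> \<phi> A x) \<ge> real M * real W * \<theta>})"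
proof -
  have ring: "m_head m \<le> k" "length (queues A) = Suc k"
    "\<And>i. i < Suc k \<Longrightarrow> queues A ! i = slot m (slot_index k (m_head m) i)"
    using S by (auto simp: simulates_def ring_def)
  have bij: "bij_betw (slot_index k (m_head m)) {..<Suc k} {..<Suc k}"
    by (rule bij_betw_slot_index[OF ring(1)])
  have "(\<Sum>j<Suc k. length (slot m j)) = (\<Sum>i<Suc k. length (slot m (slot_index k (m_head m) i)))"
    by (rule sum.reindex_bij_betw[OF bij, symmetric])
  also have "\<dots> = (\<Sum>i<Suc k. length (queues A ! i))"
    by (rule sum.cong) (use ring(3) in auto)
  also have "\<dots> = length (concat (queues A))"
    unfolding length_concat sum_list_sum_nth using ring(2) by (auto simp: lessThan_atLeast0)
  finally have len: "(\<Sum>j<Suc k. length (slot m j)) = length (concat (queues A))" .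
  have "(\<Union>j<Suc k. set (slot m j)) = (\<Union>i<Suc k. set (slot m (slot_index k (m_head m) i)))"
    using bij_betw_imp_surj_on[OF bij] by (metis image_image)
  also have "\<dots> = (\<Union>i<Suc k. set (queues A ! i))" using ring(3) by auto
  also have "\<dots> = set (concat (queues A))"
    using ring(2) by (auto simp: in_set_conv_nth[of _ "queues A"]) (metis nth_mem)+
  finally have set: "(\<Union>j<Suc k. set (slot m j)) = set (concat (queues A))" .
  show ?thesis
    unfolding heavy_hitters_prog_def
    by (rule spec_mono[OF scan_slots_spec[OF assms]]) (auto simp: len set simp del: lessThan_Suc sum.lessThan_Suc)
qed

lemma wfast_run_inv:
  assumes "weighted_stream U M p" "wfast_run W M \<epsilon> \<phi> p A"
  shows "\<exists>n. fast_inv n (inst A)"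
proof -
  obtain As where "wfast_trace W M \<epsilon> \<phi> U p As" "As (length p) = A"
    using wfast_run_trace[OF assms] .
  then show ?thesis using wfast_trace.inv_state[of W M \<epsilon> \<phi> U p As "length p"] by blast
qed

lemma represents_init: "represents (wfast_mem_init :: 'a mem) (wfast_init \<epsilon>)"
proof -
  have "partial_refines (wfast_mem_init :: 'a mem) {} {0} f g {0} {}" for f g
    by (auto simp: partial_refines_def heap_def dll_def glist_def wfast_mem_init_def zero_group_def)
  then have "refines (wfast_mem_init :: 'a mem) fast_init"
    by (auto simp: refines_def fast_init_def wfast_mem_init_def)
  moreover have "ring k (wfast_mem_init :: 'a mem) (replicate (k + 1) [])"
    unfolding ring_def by (auto simp: wfast_mem_init_def slot_def nth_replicate simp del: replicate_Suc)
  ultimately show ?thesis by (simp add: simulates_def wfast_init_def) (simp add: wfast_mem_init_def)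
qed

text \<open>Each executed insertion yields some abstract successor; chaining these gives a run that
  resolves the eviction choices as the program does.\<close>

lemma wfast_mem_represents:
  assumes "weighted_stream U M p"
  shows "\<exists>A. wfast_run W M \<epsilon> \<phi> p A \<and> represents (wfast_mem W M \<epsilon> \<phi> p) A"
  using assms
proof (induction p rule: rev_induct)
  case Nil
  then show ?case using represents_init by (auto simp: wfast_mem_def intro: wfast_run.intros)
next
  case (snoc e p)
  obtain x w where e: "e = (x, w)" by fastforce
  have stream: "weighted_stream U M p" and w: "w \<le> M"
    using snoc.prems by (auto simp: weighted_stream_def e)
  obtain A where A: "wfast_run W M \<epsilon> \<phi> p A" "represents (wfast_mem W M \<epsilon> \<phi> p) A"
    using snoc.IH[OF stream] by blast
  obtain n where "fast_inv n (inst A)" using wfast_run_inv[OF stream A(1)] by blast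
  from spec_run(1)[OF wfast_add_spec[OF A(2) this w, of x]]
  obtain A' where "wfast_add W M \<epsilon> \<phi> x w A A'"
    "represents (memory_after (wfast_add_prog W M \<epsilon> \<phi> x w) (wfast_mem W M \<epsilon> \<phi> p)) A'" by blast
  then show ?case using A(1) by (auto simp: e wfast_mem_def intro: wfast_run.intros)
qed

text \<open>The summand \<open>1\<close> comes from the \<open>s - 1\<close>, which is less than one
  unit of \<open>s\<close>.\<close>

lemma step_count_le: "real ((s - 1 + M) div s) \<le> 1 + 2 / \<phi>"
proof -
  have "real ((s - 1 + M) div s * s) \<le> real (s - 1 + M)"
    unfolding of_nat_le_iff by (rule div_times_less_eq_dividend)
  then have "real ((s - 1 + M) div s) \<le> real (s - 1 + M) / real s"
    using s_pos by (simp add: pos_le_divide_eq)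
  also have "\<dots> \<le> (real s + real M) / real s" using s_pos by (intro divide_right_mono) auto
  also have "\<dots> = 1 + real M / real s" using s_pos by (simp add: add_divide_distrib)
  also have "real M / real s \<le> real M / (real M * \<phi> / 2)"
    using s_real(2) M_pos phi_pos s_pos by (intro divide_left_mono) auto
  then have "1 + real M / real s \<le> 1 + 2 / \<phi>" using M_pos phi_pos by (simp add: field_simps)
  finally show ?thesis .
qed

end

text \<open>An insertion searches through at most \<open>1 + 2 / \<phi>\<close> hops of two steps
  each; \<open>100\<close> covers its remaining steps and also a window query. In
  \<open>65 = 13 * 5\<close>, the factor \<open>13\<close> is the cost per queued id and
  \<open>5\<close> comes from \<open>k \<le> 5 * max 1 (1 / \<epsilon>)\<close>.\<close>

definition time_constant :: "real \<Rightarrow> real" where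
  "time_constant \<phi> = 2 * (1 + 2 / \<phi>) + 100 + 65 * (2 + \<phi>)"

context wfast_params
begin

lemma time_constant_ge:
  "100 \<le> time_constant \<phi>"
  "real (2 * ((s - 1 + M) div s) + 100) \<le> time_constant \<phi>"
proof -
  have "0 < 2 / \<phi>" using phi_pos by simp
  then show "100 \<le> time_constant \<phi>" using phi_pos by (simp add: time_constant_def)
  show "real (2 * ((s - 1 + M) div s) + 100) \<le> time_constant \<phi>"
    using step_count_le phi_pos by (simp add: time_constant_def)
qed

lemma heavy_hitters_time:
  assumes "real n \<le> real k * (2 + \<phi>)"
  shows "real (2 * (k + 1) + 13 * n) \<le> time_constant \<phi> * max 1 (1 / \<epsilon>)"
proof -
  define x where "x = max 1 (1 / \<epsilon>)"
  have x: "1 \<le> x" "1 / \<epsilon> \<le> x" by (auto simp: x_def)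
  \<comment> \<open>\<open>k\<close> may exceed \<open>4 / \<epsilon>\<close> by up to one through
    rounding; for large \<open>\<epsilon>\<close> this one dominates, which is why the maximum with
    \<open>1\<close> appears.\<close>
  have "real k \<le> 5 * x" using k_le x by simp
  moreover from this have "real k * (2 + \<phi>) \<le> 5 * x * (2 + \<phi>)"
    using phi_pos by (intro mult_right_mono) auto
  ultimately have "real (2 * (k + 1) + 13 * n) \<le> 2 * (5 * x + x) + 13 * (5 * x * (2 + \<phi>))"
    using assms x(1) by simp
  also have "\<dots> = (12 + 65 * (2 + \<phi>)) * x" by (simp add: algebra_simps)
  also have "\<dots> \<le> time_constant \<phi> * x"
  proof (rule mult_right_mono)
    have "0 < 2 / \<phi>" using phi_pos by simp
    then show "12 + 65 * (2 + \<phi>) \<le> time_constant \<phi>" by (simp add: time_constant_def)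
  qed (use x in auto)
  finally show ?thesis unfolding x_def .
qed

text \<open>Queued ids lie in \<open>U\<close> and reported items are queued, so testing the queued
  ids alone loses nothing and adds nothing.\<close>

lemma heavy_hitters_eq_reported:
  assumes "weighted_stream U M p" "wfast_run W M \<epsilon> \<phi> p A" "\<epsilon> \<le> \<theta>"
  shows "{x \<in> set (concat (queues A)). real (win_query W M \<epsilon> \<phi> A x) \<ge> real M * real W * \<theta>} =
    reported W M \<epsilon> \<phi> U \<theta> A"
  using wfast_run_queues(1)[OF assms(1,2)] wfast_run_queues(2)[OF assms]
  unfolding reported_def by blast

lemma wfast_correct:
  assumes stream: "weighted_stream U M p"
  defines "m \<equiv> wfast_mem W M \<epsilon> \<phi> p"
  shows "\<exists>A. wfast_run W M \<epsilon> \<phi> p A \<and>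
    (\<forall>x\<in>U. \<forall>w\<in>{1..M}. real (running_time (wfast_add_prog W M \<epsilon> \<phi> x w) m) \<le> time_constant \<phi>) \<and>
    (\<forall>x\<in>U. result_of (win_query_prog W M \<epsilon> \<phi> x) m = win_query W M \<epsilon> \<phi> A x \<and>
       memory_after (win_query_prog W M \<epsilon> \<phi> x) m = m \<and>
       real (running_time (win_query_prog W M \<epsilon> \<phi> x) m) \<le> time_constant \<phi>) \<and>
    (\<forall>\<theta>. \<epsilon> \<le> \<theta> \<longrightarrow>
       result_of (heavy_hitters_prog W M \<epsilon> \<phi> \<theta>) m = reported W M \<epsilon> \<phi> U \<theta> A \<and>
       memory_after (heavy_hitters_prog W M \<epsilon> \<phi> \<theta>) m = m \<and>
       real (running_time (heavy_hitters_prog W M \<epsilon> \<phi> \<theta>) m) \<le> time_constant \<phi> * max 1 (1 / \<epsilon>))"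
proof -
  obtain A where A: "wfast_run W M \<epsilon> \<phi> p A" "represents m A"
    using wfast_mem_represents[OF stream] unfolding m_def by blast
  obtain n where inv: "fast_inv n (inst A)" using wfast_run_inv[OF stream A(1)] by blast
  show ?thesis
  proof (intro exI[of _ A] conjI ballI allI impI)
    show "wfast_run W M \<epsilon> \<phi> p A" by (rule A(1))
  next
    fix x w assume "w \<in> {1..M}"
    then have "running_time (wfast_add_prog W M \<epsilon> \<phi> x w) m \<le> 2 * ((s - 1 + M) div s) + 100"
      using spec_run(2)[OF wfast_add_spec[OF A(2) inv, of w x]] by simp
    then have "real (running_time (wfast_add_prog W M \<epsilon> \<phi> x w) m) \<le> real (2 * ((s - 1 + M) div s) + 100)"
      unfolding of_nat_le_iff .
    then show "real (running_time (wfast_add_prog W M \<epsilon> \<phi> x w) m) \<le> time_constant \<phi>"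
      using time_constant_ge(2) by linarith
  next
    fix x
    note run = spec_run[OF win_query_spec[OF A(2) inv, of x]]
    show "result_of (win_query_prog W M \<epsilon> \<phi> x) m = win_query W M \<epsilon> \<phi> A x"
      "memory_after (win_query_prog W M \<epsilon> \<phi> x) m = m" using run(1) by auto
    show "real (running_time (win_query_prog W M \<epsilon> \<phi> x) m) \<le> time_constant \<phi>"
      using run(2) time_constant_ge(1) by linarith
  next
    fix \<theta> assume \<theta>: "\<epsilon> \<le> \<theta>"
    note run = spec_run[OF heavy_hitters_spec[OF A(2) inv, of \<theta>]]
    show "result_of (heavy_hitters_prog W M \<epsilon> \<phi> \<theta>) m = reported W M \<epsilon> \<phi> U \<theta> A"
      using run(1) heavy_hitters_eq_reported[OF stream A(1) \<theta>] by simp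
    show "memory_after (heavy_hitters_prog W M \<epsilon> \<phi> \<theta>) m = m" using run(1) by simp
    show "real (running_time (heavy_hitters_prog W M \<epsilon> \<phi> \<theta>) m) \<le> time_constant \<phi> * max 1 (1 / \<epsilon>)"
      using heavy_hitters_time[OF wfast_run_queues(3)[OF stream A(1)]] run(2) by linarith
  qed
qed

end

theorem theorem6:
  fixes \<phi> :: real
  assumes "\<phi> > 0"
  shows "\<exists>K::real. \<forall>(U::'a set) (W::nat) (M::nat) (\<epsilon>::real) (p::('a \<times> nat) list).
    W > 0 \<longrightarrow> M > 0 \<longrightarrow> \<epsilon> > 0 \<longrightarrow> block_count \<epsilon> dvd W \<longrightarrow> weighted_stream U M p \<longrightarrow>
    (\<forall>A \<theta>. wfast_run W M \<epsilon> \<phi> p A \<longrightarrow>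
       solves_heavy_hitters U W \<theta> \<epsilon> M p (reported W M \<epsilon> \<phi> U \<theta> A)) \<and>
    (let m = wfast_mem W M \<epsilon> \<phi> p in
     \<exists>A. wfast_run W M \<epsilon> \<phi> p A \<and>
       (\<forall>x\<in>U. \<forall>w\<in>{1..M}. real (running_time (wfast_add_prog W M \<epsilon> \<phi> x w) m) \<le> K) \<and>
       (\<forall>x\<in>U. result_of (win_query_prog W M \<epsilon> \<phi> x) m = win_query W M \<epsilon> \<phi> A x \<and>
              memory_after (win_query_prog W M \<epsilon> \<phi> x) m = m \<and>
              real (running_time (win_query_prog W M \<epsilon> \<phi> x) m) \<le> K) \<and>
       (\<forall>\<theta>. \<epsilon> \<le> \<theta> \<longrightarrow>
          result_of (heavy_hitters_prog W M \<epsilon> \<phi> \<theta>) m = reported W M \<epsilon> \<phi> U \<theta> A \<and>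
          memory_after (heavy_hitters_prog W M \<epsilon> \<phi> \<theta>) m = m \<and>
          real (running_time (heavy_hitters_prog W M \<epsilon> \<phi> \<theta>) m) \<le> K * max 1 (1 / \<epsilon>)))"
proof (intro exI[of _ "time_constant \<phi>"] allI impI)
  fix U :: "'a set" and W M :: nat and \<epsilon> :: real and p :: "('a \<times> nat) list"
  assume "W > 0" "M > 0" "\<epsilon> > 0" "block_count \<epsilon> dvd W" and stream: "weighted_stream U M p"
  then interpret wfast_params W M \<epsilon> \<phi> using assms by unfold_locales
  show "(\<forall>A \<theta>. wfast_run W M \<epsilon> \<phi> p A \<longrightarrow>
       solves_heavy_hitters U W \<theta> \<epsilon> M p (reported W M \<epsilon> \<phi> U \<theta> A)) \<and>
    (let m = wfast_mem W M \<epsilon> \<phi> p in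
     \<exists>A. wfast_run W M \<epsilon> \<phi> p A \<and>
       (\<forall>x\<in>U. \<forall>w\<in>{1..M}. real (running_time (wfast_add_prog W M \<epsilon> \<phi> x w) m) \<le> time_constant \<phi>) \<and>
       (\<forall>x\<in>U. result_of (win_query_prog W M \<epsilon> \<phi> x) m = win_query W M \<epsilon> \<phi> A x \<and>
              memory_after (win_query_prog W M \<epsilon> \<phi> x) m = m \<and>
              real (running_time (win_query_prog W M \<epsilon> \<phi> x) m) \<le> time_constant \<phi>) \<and>
       (\<forall>\<theta>. \<epsilon> \<le> \<theta> \<longrightarrow>
          result_of (heavy_hitters_prog W M \<epsilon> \<phi> \<theta>) m = reported W M \<epsilon> \<phi> U \<theta> A \<and>
          memory_after (heavy_hitters_prog W M \<epsilon> \<phi> \<theta>) m = m \<and>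
          real (running_time (heavy_hitters_prog W M \<epsilon> \<phi> \<theta>) m) \<le> time_constant \<phi> * max 1 (1 / \<epsilon>)))"
    unfolding Let_def using wfast_run_solves[OF stream] wfast_correct[OF stream] by blast
qed

end
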